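(* Let $P,A_I,A_O,B_I,B_O,F$ be finite-dimensional Hilbert spaces and let $U:P\otimes A_O\otimes B_O\to A_I\otimes B_I\otimes F$ be a unitary operator. The following are equivalent: (1) $U$ represents a pure quantum superchannel with two slots $A$ (input $A_I$, output $A_O$) and $B$ (input $B_I$, output $B_O$). (2) For all $|\pi\rangle,|\pi'\rangle\in P$; all $|\alpha\rangle,|\alpha'\rangle,|\alpha^\perp\rangle\in A_O$ with $|\alpha\rangle\perp|\alpha^\perp\rangle$; all $|\beta\rangle,|\beta'\rangle,|\beta^\perp\rangle\in B_O$ with $|\beta\rangle\perp|\beta^\perp\rangle$; all $|\Gamma\rangle\rangle,|\Gamma'\rangle\rangle\in A_I\otimes B_I$; all $|\phi\rangle,|\phi'\rangle\in A_I$; and all $|\psi\rangle,|\psi'\rangle\in B_I$: (a) $\big(\langle\langle\Gamma|\,U(|\pi\rangle|\alpha\rangle|\beta\rangle),\ \langle\langle\Gamma'|\,U(|\pi'\rangle|\alpha^\perp\rangle|\beta^\perp\rangle)\big)=0$; (b) $\big(\langle\psi|\,U(|\pi\rangle|\alpha\rangle|\beta\rangle),\ \langle\psi'|\,U(|\pi'\rangle|\alpha'\rangle|\beta^\perp\rangle)\big)=0$; (c) $\big(\langle\phi|\,U(|\pi\rangle|\alpha\rangle|\beta\rangle),\ \langle\phi'|\,U(|\pi'\rangle|\alpha^\perp\rangle|\beta'\rangle)\big)=0$. (3) $U$ represents a direct sum of pure combs with two slots $A$ and $B$.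
   Context: All Hilbert spaces are finite-dimensional; $(\cdot,\cdot)$ is the inner product. In (a), $\langle\langle\Gamma|$ denotes the partial inner product with $|\Gamma\rangle\rangle$ on $A_I\otimes B_I$, mapping $A_I\otimes B_I\otimes F\to F$; in (b), $\langle\psi|$ is the partial inner product on $B_I$, mapping into $A_I\otimes F$; in (c), $\langle\phi|$ is the partial inner product on $A_I$, mapping into $B_I\otimes F$; $|\pi\rangle|\alpha\rangle|\beta\rangle\in P\otimes A_O\otimes B_O$. Choi operator of a map $\mathcal{E}:\mathcal{L}(\mathcal{H}_I)\to\mathcal{L}(\mathcal{H}_O)$: $E=\sum_{i,i'}|i\rangle\langle i'|\otimes\mathcal{E}(|i\rangle\langle i'|)$; Choi vector of an operator $X:\mathcal{H}_I\to\mathcal{H}_O$: $|X\rangle\rangle=\sum_i|i\rangle\otimes X|i\rangle$; link product $E*G=\mathrm{Tr}_1[(E\otimes1_2)(1_0\otimes G^{T_1})]$. A two-slot supermap $[\mathcal{L}(A_I)\to\mathcal{L}(A_O)]\otimes[\mathcal{L}(B_I)\to\mathcal{L}(B_O)]\to[\mathcal{L}(P)\to\mathcal{L}(F)]$ has Choi operator $W\in\mathcal{L}(P\otimes A_I\otimes A_O\otimes B_I\otimes B_O\otimes F)$ acting by $W*(E_A\otimes E_B)$ (with arbitrary auxiliary spaces carried along). It is a quantum superchannel if for all auxiliary spaces and all CPTP maps $\mathcal{E}_A:\mathcal{L}(A_I\otimes A_I')\to\mathcal{L}(A_O\otimes A_O')$, $\mathcal{E}_B:\mathcal{L}(B_I\otimes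 B_I')\to\mathcal{L}(B_O\otimes B_O')$ the output $W*(E_A\otimes E_B)$ is the Choi operator of a CPTP map $\mathcal{L}(P\otimes A_I'\otimes B_I')\to\mathcal{L}(F\otimes A_O'\otimes B_O')$; pure if unitary-channel inputs always give unitary-channel outputs. $U$ represents the supermap with Choi operator $|U\rangle\rangle\langle\langle U|$. A quantum comb of $A\prec B$: a two-slot superchannel whose Choi operator $W\ge0$ satisfies $\mathrm{Tr}_FW=1^{B_O}\otimes R_2$, $\mathrm{Tr}_{B_I}R_2=1^{A_O}\otimes R_1$, $\mathrm{Tr}_{A_I}R_1=1^P$ for some $R_2,R_1$ (i.e. realizable by a circuit using $A$ before $B$); a comb of $B\prec A$ is defined with $A,B$ exchanged. $U$ represents a direct sum of pure combs if there are orthogonal decompositions $P=P^{A\prec B}\oplus P^{B\prec A}$, $F=F^{A\prec B}\oplus F^{B\prec A}$ and unitaries $U^{A\prec B}:P^{A\prec B}\otimes A_O\otimes B_O\to A_I\otimes B_I\otimes F^{A\prec B}$ representing a quantum comb of $A\prec B$ and $U^{B\prec A}:P^{B\prec A}\otimes A_O\otimes B_O\to A_I\otimes B_I\otimes F^{B\prec A}$ representing a quantum comb of $B\prec A$, with $U=U^{A\prec B}\oplus U^{B\prec A}$. *)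

theory Defs
  imports Complex_Main "Jordan_Normal_Form.Matrix"
begin

section \<open>Multipartite index encoding (mixed radix, first factor most significant)\<close>

text \<open>A finite-dimensional Hilbert space of dimension d is C^d; tensor products are
  Kronecker products.  A basis index of H_1 \<otimes> ... \<otimes> H_k (dimensions ds) is a tuple
  of local indices, flattened by enc and unflattened by dec.\<close>

fun enc :: "nat list \<Rightarrow> nat list \<Rightarrow> nat" where
  "enc (d # ds) (i # is) = i * prod_list ds + enc ds is"
| "enc _ _ = 0"

definition dec :: "nat list \<Rightarrow> nat \<Rightarrow> nat list" where
  "dec ds k = map (\<lambda>j. (k div prod_list (drop (Suc j) ds)) mod (ds ! j)) [0..<length ds]"

definition tuples :: "nat list \<Rightarrow> nat list set" where
  "tuples ds = {xs. length xs = length ds \<and> (\<forall>j<length ds. xs ! j < ds ! j)}"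

definition cinner :: "complex vec \<Rightarrow> complex vec \<Rightarrow> complex" where
  "cinner x y = (\<Sum>i<dim_vec x. cnj (x $ i) * y $ i)"

definition adj :: "complex mat \<Rightarrow> complex mat" where
  "adj M = mat (dim_col M) (dim_row M) (\<lambda>(i,j). cnj (M $$ (j,i)))"

definition qtrace :: "complex mat \<Rightarrow> complex" where
  "qtrace A = (\<Sum>i<dim_row A. A $$ (i,i))"

definition unitary_mat :: "complex mat \<Rightarrow> bool" where
  "unitary_mat M \<longleftrightarrow> dim_row M = dim_col M \<and>
     M * adj M = 1\<^sub>m (dim_row M) \<and> adj M * M = 1\<^sub>m (dim_col M)"

definition psd :: "nat \<Rightarrow> complex mat \<Rightarrow> bool" where
  "psd n A \<longleftrightarrow> A \<in> carrier_mat n n \<and>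
     (\<forall>v \<in> carrier_vec n. Im (cinner v (A *\<^sub>v v)) = 0 \<and> Re (cinner v (A *\<^sub>v v)) \<ge> 0)"

definition kvec :: "nat list \<Rightarrow> complex vec list \<Rightarrow> complex vec" where
  "kvec ds vs = vec (prod_list ds) (\<lambda>k. prod_list (map2 (\<lambda>v i. v $ i) vs (dec ds k)))"

definition kron :: "complex mat \<Rightarrow> complex mat \<Rightarrow> complex mat" where
  "kron A B = mat (dim_row A * dim_row B) (dim_col A * dim_col B)
     (\<lambda>(i,j). A $$ (i div dim_row B, j div dim_col B) * B $$ (i mod dim_row B, j mod dim_col B))"

definition linmap :: "nat \<Rightarrow> nat \<Rightarrow> (complex mat \<Rightarrow> complex mat) \<Rightarrow> bool" where
  "linmap dI dO E \<longleftrightarrow>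
     (\<forall>A \<in> carrier_mat dI dI. E A \<in> carrier_mat dO dO) \<and>
     (\<forall>A \<in> carrier_mat dI dI. \<forall>B \<in> carrier_mat dI dI. E (A + B) = E A + E B) \<and>
     (\<forall>A \<in> carrier_mat dI dI. \<forall>c. E (c \<cdot>\<^sub>m A) = c \<cdot>\<^sub>m E A)"

definition blk :: "nat \<Rightarrow> nat \<Rightarrow> complex mat \<Rightarrow> nat \<Rightarrow> nat \<Rightarrow> complex mat" where
  "blk dI n \<rho> k l = mat dI dI (\<lambda>(a,b). \<rho> $$ (a * n + k, b * n + l))"

definition ext_id :: "nat \<Rightarrow> nat \<Rightarrow> nat \<Rightarrow> (complex mat \<Rightarrow> complex mat) \<Rightarrow> complex mat \<Rightarrow> complex mat" where
  "ext_id dI dO n E \<rho> = mat (dO * n) (dO * n)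
     (\<lambda>(i,j). E (blk dI n \<rho> (i mod n) (j mod n)) $$ (i div n, j div n))"

definition cptp :: "nat \<Rightarrow> nat \<Rightarrow> (complex mat \<Rightarrow> complex mat) \<Rightarrow> bool" where
  "cptp dI dO E \<longleftrightarrow> linmap dI dO E \<and>
     (\<forall>n. \<forall>\<rho>. psd (dI * n) \<rho> \<longrightarrow> psd (dO * n) (ext_id dI dO n E \<rho>)) \<and>
     (\<forall>\<rho> \<in> carrier_mat dI dI. qtrace (E \<rho>) = qtrace \<rho>)"

text \<open>Choi operator E = sum_{i,i'} |i><i'| \<otimes> E(|i><i'|), on C^dI \<otimes> C^dO.\<close>
definition ketbra :: "nat \<Rightarrow> nat \<Rightarrow> nat \<Rightarrow> complex mat" where
  "ketbra d i i' = mat d d (\<lambda>(a,b). if a = i \<and> b = i' then 1 else 0)"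

definition choi :: "nat \<Rightarrow> nat \<Rightarrow> (complex mat \<Rightarrow> complex mat) \<Rightarrow> complex mat" where
  "choi dI dO E = mat (dI * dO) (dI * dO)
     (\<lambda>(i,j). E (ketbra dI (i div dO) (j div dO)) $$ (i mod dO, j mod dO))"

definition uchan :: "complex mat \<Rightarrow> complex mat \<Rightarrow> complex mat" where
  "uchan V = (\<lambda>\<rho>. V * \<rho> * adj V)"

text \<open>Dimensions are given as a list ds = [dP, dAI, dAO, dBI, dBO, dF]; the Choi operator
  W of a supermap lives on P \<otimes> A_I \<otimes> A_O \<otimes> B_I \<otimes> B_O \<otimes> F (in this order).\<close>

text \<open>Choi operator |U>><<U| of the supermap represented by U : P\<otimes>A_O\<otimes>B_O \<rightarrow> A_I\<otimes>B_I\<otimes>F,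
  with the factors of |U>> reordered to P A_I A_O B_I B_O F.\<close>
definition choivecU :: "nat list \<Rightarrow> complex mat \<Rightarrow> complex vec" where
  "choivecU ds U = vec (prod_list ds) (\<lambda>k. let x = dec ds k in
     U $$ (enc [ds!1, ds!3, ds!5] [x!1, x!3, x!5], enc [ds!0, ds!2, ds!4] [x!0, x!2, x!4]))"

definition repW :: "nat list \<Rightarrow> complex mat \<Rightarrow> complex mat" where
  "repW ds U = mat (prod_list ds) (prod_list ds)
     (\<lambda>(i,j). choivecU ds U $ i * cnj (choivecU ds U $ j))"

text \<open>Link product W * (E_A \<otimes> E_B), where E_A is on A_I A_I' A_O A_O' (dims a1 a2 the
  auxiliary ones), E_B on B_I B_I' B_O B_O'; the result is on P A_I' B_I' F A_O' B_O'.
  Entrywise, (E*G)[(i0,i2),(j0,j2)] = sum_{k,l} E[(i0,k),(j0,l)] G[(k,i2),(l,j2)].\<close>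
definition link :: "nat list \<Rightarrow> nat \<Rightarrow> nat \<Rightarrow> nat \<Rightarrow> nat \<Rightarrow> complex mat \<Rightarrow> complex mat \<Rightarrow> complex mat \<Rightarrow> complex mat" where
  "link ds a1 a2 b1 b2 W EA EB =
    (let dso = [ds!0, a1, b1, ds!5, a2, b2];
         dsa = [ds!1, a1, ds!2, a2];
         dsb = [ds!3, b1, ds!4, b2] in
     mat (prod_list dso) (prod_list dso) (\<lambda>(i,j). let x = dec dso i; y = dec dso j in
       \<Sum>s \<in> tuples [ds!1, ds!2, ds!3, ds!4]. \<Sum>t \<in> tuples [ds!1, ds!2, ds!3, ds!4].
          W $$ (enc ds [x!0, s!0, s!1, s!2, s!3, x!3], enc ds [y!0, t!0, t!1, t!2, t!3, y!3])
        * EA $$ (enc dsa [s!0, x!1, s!1, x!4], enc dsa [t!0, y!1, t!1, y!4])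
        * EB $$ (enc dsb [s!2, x!2, s!3, x!5], enc dsb [t!2, y!2, t!3, y!5])))"

definition superchannel :: "nat list \<Rightarrow> complex mat \<Rightarrow> bool" where
  "superchannel ds W \<longleftrightarrow>
     (\<forall>a1 a2 b1 b2 EA EB. 0 < a1 \<and> 0 < a2 \<and> 0 < b1 \<and> 0 < b2 \<and>
        cptp (ds!1 * a1) (ds!2 * a2) EA \<and> cptp (ds!3 * b1) (ds!4 * b2) EB \<longrightarrow>
        (\<exists>G. cptp (ds!0 * a1 * b1) (ds!5 * a2 * b2) G \<and>
             choi (ds!0 * a1 * b1) (ds!5 * a2 * b2) G =
             link ds a1 a2 b1 b2 W (choi (ds!1 * a1) (ds!2 * a2) EA) (choi (ds!3 * b1) (ds!4 * b2) EB)))"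

definition pure_supermap :: "nat list \<Rightarrow> complex mat \<Rightarrow> bool" where
  "pure_supermap ds W \<longleftrightarrow>
     (\<forall>a1 a2 b1 b2 VA VB. 0 < a1 \<and> 0 < a2 \<and> 0 < b1 \<and> 0 < b2 \<and>
        VA \<in> carrier_mat (ds!2 * a2) (ds!1 * a1) \<and> unitary_mat VA \<and>
        VB \<in> carrier_mat (ds!4 * b2) (ds!3 * b1) \<and> unitary_mat VB \<longrightarrow>
        (\<exists>V. V \<in> carrier_mat (ds!5 * a2 * b2) (ds!0 * a1 * b1) \<and> unitary_mat V \<and>
             choi (ds!0 * a1 * b1) (ds!5 * a2 * b2) (uchan V) =
             link ds a1 a2 b1 b2 W (choi (ds!1 * a1) (ds!2 * a2) (uchan VA))
                                   (choi (ds!3 * b1) (ds!4 * b2) (uchan VB))))"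

definition pure_superchannel :: "nat list \<Rightarrow> complex mat \<Rightarrow> bool" where
  "pure_superchannel ds W \<longleftrightarrow> superchannel ds W \<and> pure_supermap ds W"

definition ent :: "nat list \<Rightarrow> complex mat \<Rightarrow> nat list \<Rightarrow> nat list \<Rightarrow> complex" where
  "ent ds M x y = M $$ (enc ds x, enc ds y)"

text \<open>Comb of A \<prec> B: W \<ge> 0, Tr_F W = 1^{B_O} \<otimes> R_2, Tr_{B_I} R_2 = 1^{A_O} \<otimes> R_1,
  Tr_{A_I} R_1 = 1^P, with R_2 on P A_I A_O B_I and R_1 on P A_I.\<close>
definition comb_AB :: "nat list \<Rightarrow> complex mat \<Rightarrow> bool" where
  "comb_AB ds W \<longleftrightarrow> superchannel ds W \<and> psd (prod_list ds) W \<and>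
    (\<exists>R2 R1.
       R2 \<in> carrier_mat (prod_list (take 4 ds)) (prod_list (take 4 ds)) \<and>
       R1 \<in> carrier_mat (prod_list (take 2 ds)) (prod_list (take 2 ds)) \<and>
       (\<forall>x \<in> tuples (take 5 ds). \<forall>y \<in> tuples (take 5 ds).
          (\<Sum>f<ds!5. ent ds W (x @ [f]) (y @ [f])) =
          (if x!4 = y!4 then ent (take 4 ds) R2 (take 4 x) (take 4 y) else 0)) \<and>
       (\<forall>x \<in> tuples (take 3 ds). \<forall>y \<in> tuples (take 3 ds).
          (\<Sum>b<ds!3. ent (take 4 ds) R2 (x @ [b]) (y @ [b])) =
          (if x!2 = y!2 then ent (take 2 ds) R1 (take 2 x) (take 2 y) else 0)) \<and>
       (\<forall>p < ds!0. \<forall>p' < ds!0.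
          (\<Sum>a<ds!1. ent (take 2 ds) R1 [p, a] [p', a]) = (if p = p' then 1 else 0)))"

definition swp :: "nat list \<Rightarrow> nat list" where
  "swp xs = map (\<lambda>k. xs ! k) [0, 3, 4, 1, 2, 5]"

definition swapW :: "nat list \<Rightarrow> complex mat \<Rightarrow> complex mat" where
  "swapW ds W = mat (prod_list ds) (prod_list ds)
     (\<lambda>(i,j). ent ds W (swp (dec (swp ds) i)) (swp (dec (swp ds) j)))"

definition comb_BA :: "nat list \<Rightarrow> complex mat \<Rightarrow> bool" where
  "comb_BA ds W \<longleftrightarrow> comb_AB (swp ds) (swapW ds W)"

text \<open>Orthogonal decompositions P = P1 \<oplus> P2, F = F1 \<oplus> F2 are given by unitaries QP, QF
  (change of orthonormal basis) and sizes kP, kF: P1 is spanned by the first kP columns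
  of QP and P2 by the remaining ones (similarly for F).  U1 : P1\<otimes>A_O\<otimes>B_O \<rightarrow> A_I\<otimes>B_I\<otimes>F1 and
  U2 : P2\<otimes>A_O\<otimes>B_O \<rightarrow> A_I\<otimes>B_I\<otimes>F2 are written in these bases.\<close>
definition dsum_op :: "nat list \<Rightarrow> nat \<Rightarrow> nat \<Rightarrow> complex mat \<Rightarrow> complex mat \<Rightarrow> complex mat" where
  "dsum_op ds kP kF U1 U2 =
    mat (ds!1 * ds!3 * ds!5) (ds!0 * ds!2 * ds!4) (\<lambda>(i,j).
      let x = dec [ds!1, ds!3, ds!5] i; y = dec [ds!0, ds!2, ds!4] j in
      if y!0 < kP \<and> x!2 < kF then
        U1 $$ (enc [ds!1, ds!3, kF] x, enc [kP, ds!2, ds!4] y)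
      else if kP \<le> y!0 \<and> kF \<le> x!2 then
        U2 $$ (enc [ds!1, ds!3, ds!5 - kF] [x!0, x!1, x!2 - kF],
               enc [ds!0 - kP, ds!2, ds!4] [y!0 - kP, y!1, y!2])
      else 0)"

definition direct_sum_pure_combs :: "nat list \<Rightarrow> complex mat \<Rightarrow> bool" where
  "direct_sum_pure_combs ds U \<longleftrightarrow>
    (\<exists>kP kF QP QF U1 U2. kP \<le> ds!0 \<and> kF \<le> ds!5 \<and>
       QP \<in> carrier_mat (ds!0) (ds!0) \<and> unitary_mat QP \<and>
       QF \<in> carrier_mat (ds!5) (ds!5) \<and> unitary_mat QF \<and>
       U1 \<in> carrier_mat (ds!1 * ds!3 * kF) (kP * ds!2 * ds!4) \<and> unitary_mat U1 \<and>
       comb_AB [kP, ds!1, ds!2, ds!3, ds!4, kF] (repW [kP, ds!1, ds!2, ds!3, ds!4, kF] U1) \<and>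
       U2 \<in> carrier_mat (ds!1 * ds!3 * (ds!5 - kF)) ((ds!0 - kP) * ds!2 * ds!4) \<and> unitary_mat U2 \<and>
       comb_BA [ds!0 - kP, ds!1, ds!2, ds!3, ds!4, ds!5 - kF]
               (repW [ds!0 - kP, ds!1, ds!2, ds!3, ds!4, ds!5 - kF] U2) \<and>
       U = kron (1\<^sub>m (ds!1 * ds!3)) QF * dsum_op ds kP kF U1 U2 * adj (kron QP (1\<^sub>m (ds!2 * ds!4))))"

definition pin_AB :: "nat list \<Rightarrow> complex vec \<Rightarrow> complex vec \<Rightarrow> complex vec" where
  "pin_AB ds \<Gamma> v = vec (ds!5) (\<lambda>f. \<Sum>a<ds!1. \<Sum>b<ds!3.
      cnj (\<Gamma> $ enc [ds!1, ds!3] [a, b]) * v $ enc [ds!1, ds!3, ds!5] [a, b, f])"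

definition pin_B :: "nat list \<Rightarrow> complex vec \<Rightarrow> complex vec \<Rightarrow> complex vec" where
  "pin_B ds \<psi> v = vec (ds!1 * ds!5) (\<lambda>k. \<Sum>b<ds!3.
      cnj (\<psi> $ b) * v $ enc [ds!1, ds!3, ds!5] [k div ds!5, b, k mod ds!5])"

definition pin_A :: "nat list \<Rightarrow> complex vec \<Rightarrow> complex vec \<Rightarrow> complex vec" where
  "pin_A ds \<phi> v = vec (ds!3 * ds!5) (\<lambda>k. \<Sum>a<ds!1.
      cnj (\<phi> $ a) * v $ enc [ds!1, ds!3, ds!5] [a, k div ds!5, k mod ds!5])"

definition cond2 :: "nat list \<Rightarrow> complex mat \<Rightarrow> bool" where
  "cond2 ds U \<longleftrightarrow>
    (\<forall>\<pi> \<in> carrier_vec (ds!0). \<forall>\<pi>' \<in> carrier_vec (ds!0).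
     \<forall>\<alpha> \<in> carrier_vec (ds!2). \<forall>\<alpha>' \<in> carrier_vec (ds!2). \<forall>\<alpha>\<^sub>p \<in> carrier_vec (ds!2).
     \<forall>\<beta> \<in> carrier_vec (ds!4). \<forall>\<beta>' \<in> carrier_vec (ds!4). \<forall>\<beta>\<^sub>p \<in> carrier_vec (ds!4).
     \<forall>\<Gamma> \<in> carrier_vec (ds!1 * ds!3). \<forall>\<Gamma>' \<in> carrier_vec (ds!1 * ds!3).
     \<forall>\<phi> \<in> carrier_vec (ds!1). \<forall>\<phi>' \<in> carrier_vec (ds!1).
     \<forall>\<psi> \<in> carrier_vec (ds!3). \<forall>\<psi>' \<in> carrier_vec (ds!3).
     cinner \<alpha> \<alpha>\<^sub>p = 0 \<and> cinner \<beta> \<beta>\<^sub>p = 0 \<longrightarrow>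
       (let Uv = (\<lambda>p a b. U *\<^sub>v kvec [ds!0, ds!2, ds!4] [p, a, b]) in
        cinner (pin_AB ds \<Gamma> (Uv \<pi> \<alpha> \<beta>)) (pin_AB ds \<Gamma>' (Uv \<pi>' \<alpha>\<^sub>p \<beta>\<^sub>p)) = 0 \<and>
        cinner (pin_B ds \<psi> (Uv \<pi> \<alpha> \<beta>)) (pin_B ds \<psi>' (Uv \<pi>' \<alpha>' \<beta>\<^sub>p)) = 0 \<and>
        cinner (pin_A ds \<phi> (Uv \<pi> \<alpha> \<beta>)) (pin_A ds \<phi>' (Uv \<pi>' \<alpha>\<^sub>p \<beta>')) = 0))"

end

theory Submission
  imports Defs "Jordan_Normal_Form.Determinant"
begin

text \<open>Let u (a, b, f; p, x, y) be the entries of U, with a, b, f, p, x, y indexing A_I, B_I, F, P, A_O, B_O,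
  and let G be the Gram kernel obtained by contracting F between the adjoint of U and U.  In basis
  indices, condition (2) says that G is a sum of a kernel proportional to the identity on A_O and one
  proportional to the identity on B_O, that tracing out A_I leaves the identity on B_O, and that
  tracing out B_I leaves the identity on A_O.

  (1) and (2): the partial trace over the outputs of W * (E_A \<otimes> E_B) is a contraction of G with the
  reduced Choi operators of E_A and E_B.  Channels affinely span the operators with the right partial
  trace, so that this contraction is always the identity exactly if G satisfies the three conditions.

  (2) implies (3): the Heisenberg images of L(A_I) act on P and B_O with blocks X, and those of L(B_I) act
  on P and A_O with blocks Y, so G = X Y = Y X.  The first condition says that the parts of X and Y
  which are not multiples of the identity on B_O and on A_O annihilate each other.  The subspace of P on
  which Y is trivial is invariant under all X and Y, and X is trivial on its orthogonal complement.
  This is the decomposition of P; U carries it to F since the Gram kernel is block diagonal.\<close>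

section \<open>Multi-indices\<close>

text \<open>What makes \<open>X\<close> and \<open>Y\<close> multiply is U U^* = 1: the map T -> U^*
  T U is then multiplicative on L(A_I \<otimes> B_I \<otimes> F), and the entries of
  \<open>G\<close> are those of the images of |a><a'| \<otimes> |b><b'| \<otimes> 1. The isometry
  property supplies the normalisations of traces. The obstacle is to split P compatibly with both
  families at once. The subspace is therefore defined by linear equations on \<open>Y\<close>. Its
  invariance under \<open>X\<close> is commutation; under \<open>Y\<close> it needs the product rule
  for matrix units; and the orthogonal complement is controlled because the adjoints of the
  non-trivial parts of \<open>X\<close> map into the subspace. Being proportional to the identity is
  tested against the reference index 0, which turns the first condition into an inclusion-exclusion
  formula. The dimensions of the two parts of F are not prescribed: they come out of a basis adapted
  to the image of the first part of P, and counting squared norms by rows and by columns shows that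
  they fit. For (1), auxiliary systems enter only through partial traces, so channels without them
  already force the conditions.\<close>

lemma sum_lessThan_mult:
  fixes f :: "nat \<Rightarrow> 'a::comm_monoid_add"
  shows "(\<Sum>i<m * n. f i) = (\<Sum>a<m. \<Sum>b<n. f (a * n + b))"
proof -
  have "(\<Sum>i<m * n. f i) = (\<Sum>a<m. sum f {a * n..<a * n + n})"
    by (rule sum.nat_group[symmetric])
  also have "\<dots> = (\<Sum>a<m. \<Sum>b<n. f (a * n + b))"
  proof (rule sum.cong[OF refl])
    fix a
    show "sum f {a * n..<a * n + n} = (\<Sum>b<n. f (a * n + b))"
      using sum.shift_bounds_nat_ivl[of f 0 "a * n" n]
      by (simp add: add.commute lessThan_atLeast0)
  qed
  finally show ?thesis .
qed

lemma mult_add_less: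
  fixes a b m n :: nat
  assumes "a < m" "b < n"
  shows "a * n + b < m * n"
proof -
  have "a * n + b < Suc a * n" using assms by simp
  also have "\<dots> \<le> m * n" using assms by (intro mult_le_mono1) simp
  finally show ?thesis .
qed

lemma dec_Nil [simp]: "dec [] k = []"
  by (simp add: dec_def)

lemma dec_Cons [simp]: "dec (d # ds) k = (k div prod_list ds) mod d # dec ds k"
  unfolding dec_def by (simp add: upt_conv_Cons map_Suc_upt[symmetric] del: upt_Suc)

text \<open>The quotient behind each digit grows by a multiple of that digit's dimension. If the
  remaining dimensions multiply to 0, the quotient is a division by 0 and the digit is 0 on both
  sides. In \<open>dec_enc\<close> this strips the leading digit.\<close>

lemma dec_add_mult: "dec ds (i * prod_list ds + k) = dec ds k"
proof (induction ds arbitrary: i)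
  case (Cons d ds)
  show ?case
  proof (cases "prod_list ds = 0")
    case False
    have "i * prod_list (d # ds) + k = k + prod_list ds * (i * d)" by (simp add: algebra_simps)
    then have "((i * prod_list (d # ds) + k) div prod_list ds) mod d = (k div prod_list ds) mod d"
      using False by (metis div_mult_self2 add.commute mod_mult_self1)
    moreover have "dec ds (i * prod_list (d # ds) + k) = dec ds k"
      using Cons.IH[of "i * d"] by (simp add: algebra_simps)
    ultimately show ?thesis by simp
  next
    case True then show ?thesis using Cons.IH[of "i * d"] by (simp add: algebra_simps del: prod_list_zero_iff)
  qed
qed simp

lemma tuples_Nil [simp]: "tuples [] = {[]}"
  by (auto simp: tuples_def)

lemma tuples_Cons: "tuples (d # ds) = (\<lambda>(i, xs). i # xs) ` ({..<d} \<times> tuples ds)"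
proof (intro Set.set_eqI iffI)
  fix xs assume "xs \<in> tuples (d # ds)"
  then have l: "length xs = Suc (length ds)" and b: "\<And>j. j < Suc (length ds) \<Longrightarrow> xs ! j < (d # ds) ! j"
    by (auto simp: tuples_def)
  obtain i ys where xs: "xs = i # ys" using l by (cases xs) auto
  have "i < d" using b[of 0] xs by simp
  moreover have "ys \<in> tuples ds" using l b[of "Suc _"] xs by (auto simp: tuples_def)
  ultimately show "xs \<in> (\<lambda>(i, xs). i # xs) ` ({..<d} \<times> tuples ds)" using xs by auto
next
  fix xs assume "xs \<in> (\<lambda>(i, xs). i # xs) ` ({..<d} \<times> tuples ds)"
  then show "xs \<in> tuples (d # ds)"
    by (auto simp: tuples_def nth_Cons split: nat.splits)
qed

lemma Cons_in_tuples [simp]: "i # xs \<in> tuples (d # ds) \<longleftrightarrow> i < d \<and> xs \<in> tuples ds"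
  by (auto simp: tuples_Cons)

lemma Nil_in_tuples_Cons [simp]: "[] \<notin> tuples (d # ds)"
  by (auto simp: tuples_Cons)

lemma sum_tuples_Cons: "(\<Sum>t\<in>tuples (d # ds). f t) = (\<Sum>i<d. \<Sum>t\<in>tuples ds. f (i # t))"
proof -
  have "inj_on (\<lambda>(i, xs). i # xs) ({..<d} \<times> tuples ds)" by (auto simp: inj_on_def)
  then show ?thesis
    unfolding tuples_Cons sum.cartesian_product by (subst sum.reindex) (auto intro!: sum.cong)
qed

lemma enc_less: "xs \<in> tuples ds \<Longrightarrow> enc ds xs < prod_list ds"
proof (induction ds arbitrary: xs)
  case (Cons d ds)
  then obtain i ys where "xs = i # ys" "i < d" "ys \<in> tuples ds" by (auto simp: tuples_Cons)
  then show ?case using Cons.IH[of ys] by (simp add: mult_add_less)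
qed simp

lemma dec_enc: "xs \<in> tuples ds \<Longrightarrow> dec ds (enc ds xs) = xs"
proof (induction ds arbitrary: xs)
  case (Cons d ds)
  then obtain i ys where xs: "xs = i # ys" "i < d" "ys \<in> tuples ds" by (auto simp: tuples_Cons)
  then have e: "enc ds ys < prod_list ds" by (simp add: enc_less)
  then have "(i * prod_list ds + enc ds ys) div prod_list ds = i"
    by (metis add.right_neutral div_less div_mult_self3 not_less_zero)
  then show ?case using xs Cons.IH[of ys] by (simp add: dec_add_mult)
qed simp

lemma enc_dec:
  assumes "k < prod_list ds"
  shows "enc ds (dec ds k) = k" and "dec ds k \<in> tuples ds"
proof -
  \<comment> \<open>Generalised to every \<open>k\<close>: the tail of \<open>dec\<close> receives
    the same undivided \<open>k\<close>, so a bound on \<open>k\<close> would be lost and only the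
    residue is controlled.\<close>
  have "enc ds (dec ds k) = k mod prod_list ds \<and> (prod_list ds \<noteq> 0 \<longrightarrow> dec ds k \<in> tuples ds)" for k
  proof (induction ds arbitrary: k)
    case (Cons d ds)
    have "(k div prod_list ds) mod d * prod_list ds + k mod prod_list ds = k mod (d * prod_list ds)"
      by (metis mod_mult2_eq mult.commute)
    with Cons.IH[of k] show ?case by auto
  qed simp
  with assms show "enc ds (dec ds k) = k" "dec ds k \<in> tuples ds" by (auto simp del: prod_list_zero_iff)
qed

lemma enc2: "enc [d1, d2] [i, j] = i * d2 + j"
  and enc3: "enc [d1, d2, d3] [i, j, k] = (i * d2 + j) * d3 + k"
  and enc4: "enc [d1, d2, d3, d4] [i, j, k, l] = (i * d2 + j) * (d3 * d4) + (k * d4 + l)"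
  by (simp_all add: algebra_simps)

section \<open>Positive semidefinite matrices\<close>

lemma cinner_mult_mat_vec:
  assumes "A \<in> carrier_mat n n" "v \<in> carrier_vec n"
  shows "cinner v (A *\<^sub>v v) = (\<Sum>i<n. \<Sum>j<n. cnj (v $ i) * A $$ (i, j) * v $ j)"
  using assms unfolding cinner_def
  by (auto simp: scalar_prod_def sum_distrib_left mult.assoc lessThan_atLeast0 intro!: sum.cong)

text \<open>The quadratic form of \<open>psd\<close> on plain functions, so that kernels can be
  reindexed and test vectors written down without vector carriers.\<close>

definition psdf :: "nat \<Rightarrow> (nat \<Rightarrow> nat \<Rightarrow> complex) \<Rightarrow> bool" where
  "psdf n A \<longleftrightarrow> (\<forall>v. Im (\<Sum>i<n. \<Sum>j<n. cnj (v i) * A i j * v j) = 0 \<and>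
                    0 \<le> Re (\<Sum>i<n. \<Sum>j<n. cnj (v i) * A i j * v j))"

lemma psd_iff_psdf: "psd n A \<longleftrightarrow> A \<in> carrier_mat n n \<and> psdf n (\<lambda>i j. A $$ (i, j))"
proof (cases "A \<in> carrier_mat n n")
  case True
  show ?thesis
  proof
    assume p: "psd n A"
    show "A \<in> carrier_mat n n \<and> psdf n (\<lambda>i j. A $$ (i, j))"
      unfolding psdf_def
    proof (intro conjI allI True)
      fix v :: "nat \<Rightarrow> complex"
      have "(\<Sum>i<n. \<Sum>j<n. cnj (v i) * A $$ (i, j) * v j) = cinner (vec n v) (A *\<^sub>v vec n v)"
        by (subst cinner_mult_mat_vec[OF True]) auto
      then show "Im (\<Sum>i<n. \<Sum>j<n. cnj (v i) * A $$ (i, j) * v j) = 0"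
        "0 \<le> Re (\<Sum>i<n. \<Sum>j<n. cnj (v i) * A $$ (i, j) * v j)"
        using p by (auto simp: psd_def)
    qed
  next
    assume "A \<in> carrier_mat n n \<and> psdf n (\<lambda>i j. A $$ (i, j))"
    then show "psd n A"
      using cinner_mult_mat_vec[OF True] unfolding psd_def psdf_def by auto
  qed
qed (simp add: psd_def)

text \<open>The form of a sum of rank one kernels is the sum of the squared moduli of the overlaps
  \<open>z m\<close> of the test vector with the \<open>w m\<close>.\<close>

lemma psdfI_gram:
  assumes "finite M" and "\<And>i j. i < n \<Longrightarrow> j < n \<Longrightarrow> A i j = (\<Sum>m\<in>M. w m i * cnj (w m j))"
  shows "psdf n A"
  unfolding psdf_def
proof
  fix v :: "nat \<Rightarrow> complex"
  define z where "z m = (\<Sum>j<n. cnj (w m j) * v j)" for m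
  have "(\<Sum>i<n. \<Sum>j<n. cnj (v i) * A i j * v j)
      = (\<Sum>i<n. \<Sum>j<n. \<Sum>m\<in>M. cnj (v i) * w m i * (cnj (w m j) * v j))"
    by (intro sum.cong refl) (simp add: assms sum_distrib_left sum_distrib_right mult_ac)
  also have "\<dots> = (\<Sum>m\<in>M. \<Sum>i<n. \<Sum>j<n. cnj (v i) * w m i * (cnj (w m j) * v j))"
    by (subst sum.swap[of _ M], subst sum.swap[of _ M]) simp
  also have "\<dots> = (\<Sum>m\<in>M. cnj (z m) * z m)"
    unfolding z_def cnj_sum sum_product by (simp add: mult_ac)
  also have "\<dots> = of_real (\<Sum>m\<in>M. (cmod (z m))\<^sup>2)"
    by (simp add: complex_norm_square mult.commute del: of_real_power)
  finally have q: "(\<Sum>i<n. \<Sum>j<n. cnj (v i) * A i j * v j) = of_real (\<Sum>m\<in>M. (cmod (z m))\<^sup>2)" .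
  show "Im (\<Sum>i<n. \<Sum>j<n. cnj (v i) * A i j * v j) = 0 \<and>
        0 \<le> Re (\<Sum>i<n. \<Sum>j<n. cnj (v i) * A i j * v j)"
    unfolding q by (simp add: sum_nonneg)
qed

lemma quad_two_point:
  fixes A :: "nat \<Rightarrow> nat \<Rightarrow> complex"
  assumes "i < n" "j < n" "i \<noteq> j"
  shows "(\<Sum>k<n. \<Sum>l<n. cnj (if k = i then s else if k = j then t else 0) * A k l
            * (if l = i then s else if l = j then t else 0))
       = cnj s * A i i * s + cnj s * A i j * t + cnj t * A j i * s + cnj t * A j j * t"
proof -
  define v where "v = (\<lambda>k. if k = i then s else if k = j then t else (0::complex))"
  have *: "(\<Sum>k<n. f k) = f i + f j" if "\<And>k. k \<noteq> i \<Longrightarrow> k \<noteq> j \<Longrightarrow> f k = 0" for f :: "nat \<Rightarrow> complex"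
  proof -
    have "(\<Sum>k<n. f k) = (\<Sum>k\<in>{i, j}. f k)"
      using assms that by (intro sum.mono_neutral_right) auto
    then show ?thesis using assms by simp
  qed
  have "(\<Sum>k<n. \<Sum>l<n. cnj (v k) * A k l * v l)
      = (\<Sum>k<n. cnj (v k) * A k i * v i + cnj (v k) * A k j * v j)"
    by (intro sum.cong refl *) (simp add: v_def)
  also have "\<dots> = (cnj (v i) * A i i * v i + cnj (v i) * A i j * v j)
      + (cnj (v j) * A j i * v i + cnj (v j) * A j j * v j)"
    by (rule *) (simp add: v_def)
  finally show ?thesis using assms by (simp add: v_def)
qed

lemma psdf_two_point:
  assumes "psdf n A" "i < n" "j < n" "i \<noteq> j"
  shows "Im (cnj s * A i i * s + cnj s * A i j * t + cnj t * A j i * s + cnj t * A j j * t) = 0"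
    and "0 \<le> Re (cnj s * A i i * s + cnj s * A i j * t + cnj t * A j i * s + cnj t * A j j * t)"
  using assms(1)[unfolded psdf_def, rule_format, of "\<lambda>k. if k = i then s else if k = j then t else 0"]
  unfolding quad_two_point[OF assms(2-4)] by auto

lemma psdf_diag:
  assumes "psdf n A" "i < n"
  shows "Im (A i i) = 0" "0 \<le> Re (A i i)"
proof -
  have "(\<Sum>k<n. \<Sum>l<n. cnj (if k = i then 1 else 0) * A k l * (if l = i then 1 else 0)) = A i i"
    using assms(2) by (simp add: if_distrib[of cnj] if_distrib[of "\<lambda>x. _ * x"] if_distrib[of "\<lambda>x. x * _"] sum.delta cong: if_cong)
  then show "Im (A i i) = 0" "0 \<le> Re (A i i)"
    using assms(1)[unfolded psdf_def, rule_format, of "\<lambda>k. if k = i then 1 else 0"] by auto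
qed

lemma psdf_hermitian:
  assumes "psdf n A" "i < n" "j < n"
  shows "A j i = cnj (A i j)"
proof (cases "i = j")
  case True
  then show ?thesis using psdf_diag(1)[OF assms(1,2)] by (simp add: complex_eq_iff)
next
  case False
  have "Im (A i i) = 0" "Im (A j j) = 0" using psdf_diag(1) assms by auto
  \<comment> \<open>The vector e_i + e_j forces the imaginary part of A_ij + A_ji to vanish, the
    vector e_i + i e_j the real part of A_ij - A_ji.\<close>
  then show ?thesis
    using psdf_two_point(1)[OF assms False, of 1 1] psdf_two_point(1)[OF assms False, of 1 \<i>]
    by (simp add: complex_eq_iff)
qed

text \<open>On e_i - r conj(A_ij) e_j the form is affine in the real number r with slope -2
  |A_ij|^2, because the quadratic term carries A_jj = 0. Nonnegativity for all r forces the slope to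
  be 0.\<close>

lemma psdf_zero_diag:
  assumes "psdf n A" "i < n" "j < n" "A j j = 0"
  shows "A i j = 0"
proof (cases "i = j")
  case False
  have h: "A j i = cnj (A i j)" by (rule psdf_hermitian[OF assms(1-3)])
  define c where "c = Re (A i i)"
  have c: "A i i = of_real c" using psdf_diag(1)[OF assms(1,2)] by (simp add: c_def complex_eq_iff)
  have c0: "0 \<le> c" using psdf_diag(2)[OF assms(1,2)] by (simp add: c_def)
  define m where "m = (cmod (A i j))\<^sup>2"
  have mm: "A i j * cnj (A i j) = of_real m" by (simp add: m_def complex_norm_square del: of_real_power)
  have "0 \<le> c - 2 * r * m" for r :: real
  proof -
    have "cnj 1 * A i i * 1 + cnj 1 * A i j * (- of_real r * cnj (A i j))
        + cnj (- of_real r * cnj (A i j)) * A j i * 1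
        + cnj (- of_real r * cnj (A i j)) * A j j * (- of_real r * cnj (A i j))
        = of_real c - 2 * of_real r * (A i j * cnj (A i j))"
      by (simp add: assms(4) h c algebra_simps)
    also have "\<dots> = of_real (c - 2 * r * m)" unfolding mm by simp
    finally show ?thesis
      using psdf_two_point(2)[OF assms(1-3) False, of 1 "- of_real r * cnj (A i j)"] by simp
  qed
  \<comment> \<open>Unless \<open>m\<close> is 0, the bound at this value of \<open>r\<close> reads
    0 \<le> -1.\<close>
  from this[of "(c + 1) / (2 * m)"] have "m = 0"
    using c0 by (cases "m = 0") (auto simp: field_simps)
  then show ?thesis by (simp add: m_def)
qed (use assms in simp)

text \<open>Cholesky factorisation, peeling off the last index: subtracting the rank one kernel
  built on the last column leaves the Schur complement, which is positive again.\<close>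

lemma psdf_decomp:
  assumes "psdf n A"
  shows "\<exists>w :: nat \<Rightarrow> nat \<Rightarrow> complex. \<forall>i<n. \<forall>j<n. A i j = (\<Sum>k<n. w k i * cnj (w k j))"
  using assms
proof (induction n arbitrary: A)
  case (Suc n)
  note h = psdf_hermitian[OF Suc.prems]
  define c where "c = Re (A n n)"
  have c: "A n n = of_real c" using psdf_diag(1)[OF Suc.prems, of n] by (simp add: c_def complex_eq_iff)
  have c0: "0 \<le> c" using psdf_diag(2)[OF Suc.prems, of n] by (simp add: c_def)
  have z: "A i n = 0" if "c = 0" "i < Suc n" for i
    using psdf_zero_diag[OF Suc.prems that(2), of n] that(1) c by simp
  have z': "A n i = 0" if "c = 0" "i < Suc n" for i
    using h[of i n] z[OF that] that(2) by simp
  \<comment> \<open>Schur complement of the last diagonal entry; for c = 0 the division by zero yields A itself,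
    whose last row and column vanish.\<close>
  define B where "B i j = A i j - A i n * A n j / of_real c" for i j
  have "psdf n B"
    unfolding psdf_def
  proof
    fix v :: "nat \<Rightarrow> complex"
    define t where "t = (\<Sum>j<n. A n j * v j)"
    \<comment> \<open>This last component minimises the form of \<open>A\<close> over all extensions
      of \<open>v\<close>; the minimum is the form of the Schur complement at
      \<open>v\<close>.\<close>
    define v' where "v' k = (if k = n then - t / of_real c else v k)" for k
    have ct: "cnj t = (\<Sum>i<n. cnj (v i) * A i n)"
      unfolding t_def cnj_sum by (intro sum.cong refl) (simp add: h[of n] mult.commute)
    have "(\<Sum>i<Suc n. \<Sum>j<Suc n. cnj (v' i) * A i j * v' j)
       = (\<Sum>i<n. (\<Sum>j<n. cnj (v i) * A i j * v j) + cnj (v i) * A i n * (- t / of_real c))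
         + (cnj (- t / of_real c) * t + cnj (- t / of_real c) * of_real c * (- t / of_real c))"
    proof -
      have 1: "(\<Sum>j<Suc n. cnj (v' i) * A i j * v' j)
          = (\<Sum>j<n. cnj (v i) * A i j * v j) + cnj (v i) * A i n * (- t / of_real c)" if "i < n" for i
        using that by (simp add: v'_def)
      have 2: "(\<Sum>j<Suc n. cnj (v' n) * A n j * v' j)
          = cnj (- t / of_real c) * t + cnj (- t / of_real c) * of_real c * (- t / of_real c)"
        unfolding t_def sum_distrib_left by (simp add: v'_def c mult.assoc t_def)
      show ?thesis unfolding sum.lessThan_Suc[of _ n] 2[unfolded sum.lessThan_Suc[of _ n]]
        by (intro arg_cong2[where f = "(+)"] sum.cong refl) (simp_all add: v'_def)
    qed
    also have "\<dots> = (\<Sum>i<n. \<Sum>j<n. cnj (v i) * A i j * v j) + cnj t * (- t / of_real c)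
         + (cnj (- t / of_real c) * t + cnj (- t / of_real c) * of_real c * (- t / of_real c))"
      by (simp only: sum.distrib ct sum_distrib_right)
    also have "\<dots> = (\<Sum>i<n. \<Sum>j<n. cnj (v i) * A i j * v j) - cnj t * t / of_real c"
      by (cases "c = 0") (simp_all add: field_simps)
    also have "\<dots> = (\<Sum>i<n. \<Sum>j<n. cnj (v i) * B i j * v j)"
    proof -
      have "cnj t * t / of_real c = (\<Sum>i<n. \<Sum>j<n. cnj (v i) * (A i n * A n j / of_real c) * v j)"
        by (simp only: ct) (simp only: t_def sum_product sum_divide_distrib, simp add: mult_ac)
      then show ?thesis
        unfolding B_def by (simp add: algebra_simps sum_subtractf)
    qed
    finally show "Im (\<Sum>i<n. \<Sum>j<n. cnj (v i) * B i j * v j) = 0 \<and>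
        0 \<le> Re (\<Sum>i<n. \<Sum>j<n. cnj (v i) * B i j * v j)"
      using Suc.prems[unfolded psdf_def, rule_format, of v'] by simp
  qed
  from Suc.IH[OF this] obtain w where w: "\<And>i j. i < n \<Longrightarrow> j < n \<Longrightarrow> B i j = (\<Sum>k<n. w k i * cnj (w k j))"
    by blast
  define w' where "w' k i = (if k = n then A i n / of_real (sqrt c) else if i = n then 0 else w k i)" for k i
  have sq: "complex_of_real (sqrt c) * of_real (sqrt c) = of_real c"
    using c0 by (metis of_real_mult real_sqrt_mult_self abs_of_nonneg)
  have "A i j = (\<Sum>k<Suc n. w' k i * cnj (w' k j))" if ij: "i < Suc n" "j < Suc n" for i j
  proof -
    have last: "w' n i * cnj (w' n j) = A i n * A n j / of_real c"
      using h[of n j] ij sq by (simp add: w'_def mult.commute)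
    show ?thesis
    proof (cases "i = n \<or> j = n")
      case True
      then have "(\<Sum>k<n. w' k i * cnj (w' k j)) = 0" by (intro sum.neutral) (auto simp: w'_def)
      moreover have "A i n * A n j / of_real c = A i j"
        using True z z' ij c by (cases "c = 0") auto
      ultimately show ?thesis using last by simp
    next
      case False
      then have "(\<Sum>k<n. w' k i * cnj (w' k j)) = B i j"
        using w[of i j] ij by (auto simp: w'_def intro!: sum.cong)
      then show ?thesis using last by (simp add: B_def)
    qed
  qed
  then show ?case by blast
qed simp

section \<open>Choi operators of channels\<close>

text \<open>Trace preservation expressed on the Choi operator: its partial trace over the output is
  the identity of the input.\<close>

definition trace_out_id :: "nat \<Rightarrow> nat \<Rightarrow> complex mat \<Rightarrow> bool" where
  "trace_out_id dI dO J \<longleftrightarrow> (\<forall>i<dI. \<forall>i'<dI.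
     (\<Sum>k<dO. J $$ (i * dO + k, i' * dO + k)) = (if i = i' then 1 else 0))"

lemma choi_index:
  assumes "i < dI" "k < dO" "i' < dI" "k' < dO"
  shows "choi dI dO E $$ (i * dO + k, i' * dO + k') = E (ketbra dI i i') $$ (k, k')"
proof -
  have "i * dO + k < dI * dO" "i' * dO + k' < dI * dO" using assms by (simp_all add: mult_add_less)
  then show ?thesis using assms by (simp add: choi_def)
qed

lemma psdf_reindex:
  assumes "psdf n A" "bij_betw h {..<m} {..<n}" "\<And>i j. i < m \<Longrightarrow> j < m \<Longrightarrow> B i j = A (h i) (h j)"
  shows "psdf m B"
proof -
  obtain w where w: "\<And>i j. i < n \<Longrightarrow> j < n \<Longrightarrow> A i j = (\<Sum>k<n. w k i * cnj (w k j))"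
    using psdf_decomp[OF assms(1)] by blast
  have "h i < n" if "i < m" for i using assms(2) that by (auto dest: bij_betwE)
  then show ?thesis
    using assms(3) w by (intro psdfI_gram[of "{..<n}" _ _ "\<lambda>k i. w k (h i)"]) auto
qed

lemma psd_decomp:
  assumes "psd n A"
  obtains w :: "nat \<Rightarrow> nat \<Rightarrow> complex"
  where "\<And>i j. i < n \<Longrightarrow> j < n \<Longrightarrow> A $$ (i, j) = (\<Sum>k<n. w k i * cnj (w k j))"
  using assms psdf_decomp[of n "\<lambda>i j. A $$ (i, j)"] unfolding psd_iff_psdf by blast

text \<open>The Choi operator is the image of the unnormalised maximally entangled state under the
  map extended by the identity, up to an exchange of the two factors.\<close>

lemma psd_choi:
  assumes "cptp dI dO E"
  shows "psd (dI * dO) (choi dI dO E)"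
proof -
  define \<omega> where "\<omega> i = (if i div dI = i mod dI then 1 else (0::complex))" for i
  define \<rho> where "\<rho> = mat (dI * dI) (dI * dI) (\<lambda>(i, j). \<omega> i * cnj (\<omega> j))"
  have "psdf (dI * dI) (\<lambda>i j. \<rho> $$ (i, j))"
    by (rule psdfI_gram[of "{0::nat}" _ _ "\<lambda>_. \<omega>"]) (simp_all add: \<rho>_def)
  then have "psd (dI * dI) \<rho>" by (simp add: psd_iff_psdf \<rho>_def)
  then have p: "psd (dO * dI) (ext_id dI dO dI E \<rho>)"
    using assms unfolding cptp_def by blast
  have b: "blk dI dI \<rho> k l = ketbra dI k l" if "k < dI" "l < dI" for k l
  proof (rule eq_matI)
    fix i j assume "i < dim_row (ketbra dI k l)" "j < dim_col (ketbra dI k l)"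
    then have "i < dI" "j < dI" by (simp_all add: ketbra_def)
    then show "blk dI dI \<rho> k l $$ (i, j) = ketbra dI k l $$ (i, j)"
      using that mult_add_less[of i dI k dI] mult_add_less[of j dI l dI]
      by (simp add: blk_def ketbra_def \<rho>_def \<omega>_def)
  qed (simp_all add: blk_def ketbra_def)
  \<comment> \<open>\<open>ext_id\<close> lists the output before the ancilla, \<open>choi\<close>
    lists the input before the output; \<open>h\<close> exchanges the two factors.\<close>
  define h where "h i = (i mod dO) * dI + i div dO" for i
  have h: "h i < dO * dI" "h i div dI = i mod dO" "h i mod dI = i div dO" if "i < dI * dO" for i
  proof -
    have "dO > 0" using that by (cases dO) auto
    moreover have "i div dO < dI" using that by (simp add: less_mult_imp_div_less)
    ultimately show "h i < dO * dI" "h i div dI = i mod dO" "h i mod dI = i div dO"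
      by (simp_all add: h_def mult_add_less)
  qed
  have "inj_on h {..<dI * dO}"
  proof (rule inj_onI)
    fix i j assume "i \<in> {..<dI * dO}" "j \<in> {..<dI * dO}" and hh: "h i = h j"
    then have ij: "i < dI * dO" "j < dI * dO" by auto
    have "i mod dO = j mod dO" using h(2)[OF ij(1)] h(2)[OF ij(2)] unfolding hh by (rule subst)
    moreover have "i div dO = j div dO" using h(3)[OF ij(1)] h(3)[OF ij(2)] unfolding hh by (rule subst)
    ultimately have "i div dO * dO + i mod dO = j div dO * dO + j mod dO" by (simp only:)
    then show "i = j" unfolding div_mult_mod_eq .
  qed
  moreover have "h ` {..<dI * dO} \<subseteq> {..<dO * dI}" using h by auto
  ultimately have bij: "bij_betw h {..<dI * dO} {..<dO * dI}"
    unfolding bij_betw_def by (intro conjI card_subset_eq) (simp_all add: card_image)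
  have eq: "choi dI dO E $$ (i, j) = ext_id dI dO dI E \<rho> $$ (h i, h j)"
    if "i < dI * dO" "j < dI * dO" for i j
    using h[OF that(1)] h[OF that(2)] b[of "i div dO" "j div dO"] that
    by (simp add: choi_def ext_id_def less_mult_imp_div_less)
  have "psdf (dI * dO) (\<lambda>i j. choi dI dO E $$ (i, j))"
    by (rule psdf_reindex[OF conjunct2[OF p[unfolded psd_iff_psdf]] bij eq])
  then show ?thesis by (simp add: psd_iff_psdf choi_def)
qed

lemma trace_out_id_choi:
  assumes "cptp dI dO E"
  shows "trace_out_id dI dO (choi dI dO E)"
  unfolding trace_out_id_def
proof (intro allI impI)
  fix i i' assume i: "i < dI" "i' < dI"
  have k: "ketbra dI i i' \<in> carrier_mat dI dI" by (simp add: ketbra_def)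
  then have c: "E (ketbra dI i i') \<in> carrier_mat dO dO" using assms by (simp add: cptp_def linmap_def)
  have "(\<Sum>k<dO. choi dI dO E $$ (i * dO + k, i' * dO + k)) = qtrace (E (ketbra dI i i'))"
    using i c by (simp add: choi_index qtrace_def)
  also have "\<dots> = qtrace (ketbra dI i i')" using assms k by (simp add: cptp_def)
  also have "\<dots> = (if i = i' then 1 else 0)"
    using i by (auto simp: qtrace_def ketbra_def intro: sum.neutral)
  finally show "(\<Sum>k<dO. choi dI dO E $$ (i * dO + k, i' * dO + k)) = (if i = i' then 1 else 0)" .
qed

text \<open>Choi's correspondence read backwards: the entries of \<open>J\<close> define the map,
  and a decomposition of \<open>J\<close> into rank one kernels yields Kraus operators, hence
  complete positivity.\<close>

lemma cptp_from_choi: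
  assumes J: "psd (dI * dO) J" and tr: "trace_out_id dI dO J"
  obtains E where "cptp dI dO E" "choi dI dO E = J"
proof
  define E where "E \<rho> = mat dO dO (\<lambda>(k, k'). \<Sum>i<dI. \<Sum>i'<dI. \<rho> $$ (i, i') * J $$ (i * dO + k, i' * dO + k'))"
    for \<rho> :: "complex mat"
  obtain w where w: "\<And>i j. i < dI * dO \<Longrightarrow> j < dI * dO \<Longrightarrow> J $$ (i, j) = (\<Sum>m<dI * dO. w m i * cnj (w m j))"
    using psd_decomp[OF J] by blast
  have J': "J \<in> carrier_mat (dI * dO) (dI * dO)" using J by (simp add: psd_def)
  show "choi dI dO E = J"
  proof (rule eq_matI)
    fix i j assume "i < dim_row J" "j < dim_col J"
    then have ij: "i < dI * dO" "j < dI * dO" using J' by auto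
    then have 0: "0 < dO" by (cases dO) auto
    have d: "i div dO < dI" "j div dO < dI" using ij by (simp_all add: less_mult_imp_div_less)
    have "choi dI dO E $$ (i, j) = E (ketbra dI (i div dO) (j div dO)) $$ (i mod dO, j mod dO)"
      using ij by (simp add: choi_def)
    also have "\<dots> = (\<Sum>a<dI. \<Sum>a'<dI. (if a = i div dO \<and> a' = j div dO then 1 else 0)
        * J $$ (a * dO + i mod dO, a' * dO + j mod dO))"
      using 0 by (auto simp: E_def ketbra_def intro!: sum.cong)
    also have "\<dots> = (\<Sum>a<dI. \<Sum>a'<dI. if a = i div dO then if a' = j div dO then
        J $$ (a * dO + i mod dO, a' * dO + j mod dO) else 0 else 0)"
      by (intro sum.cong refl) auto
    also have "\<dots> = (\<Sum>a<dI. if a = i div dO then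
        J $$ (a * dO + i mod dO, (j div dO) * dO + j mod dO) else 0)"
      using d by (intro sum.cong refl) (simp add: sum.delta)
    also have "\<dots> = J $$ (i, j)" using d by (simp add: sum.delta)
    finally show "choi dI dO E $$ (i, j) = J $$ (i, j)" .
  qed (use J' in \<open>auto simp: choi_def\<close>)
  have "linmap dI dO E"
    unfolding linmap_def
    by (auto simp: E_def algebra_simps sum.distrib sum_distrib_left intro!: eq_matI)
  moreover have "qtrace (E \<rho>) = qtrace \<rho>" if r: "\<rho> \<in> carrier_mat dI dI" for \<rho>
  proof -
    have "qtrace (E \<rho>) = (\<Sum>k<dO. \<Sum>i<dI. \<Sum>i'<dI. \<rho> $$ (i, i') * J $$ (i * dO + k, i' * dO + k))"
      by (simp add: qtrace_def E_def)
    also have "\<dots> = (\<Sum>i<dI. \<Sum>i'<dI. \<Sum>k<dO. \<rho> $$ (i, i') * J $$ (i * dO + k, i' * dO + k))"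
      by (subst sum.swap, rule sum.cong[OF refl], rule sum.swap)
    also have "\<dots> = (\<Sum>i<dI. \<Sum>i'<dI. if i' = i then \<rho> $$ (i, i') else 0)"
      using tr by (intro sum.cong refl) (auto simp: sum_distrib_left[symmetric] trace_out_id_def)
    also have "\<dots> = qtrace \<rho>" using r by (auto simp: sum.delta qtrace_def)
    finally show ?thesis .
  qed
  moreover have "psd (dO * n) (ext_id dI dO n E \<rho>)" if r: "psd (dI * n) \<rho>" for n \<rho>
  proof -
    obtain s where s: "\<And>i j. i < dI * n \<Longrightarrow> j < dI * n \<Longrightarrow> \<rho> $$ (i, j) = (\<Sum>m<dI * n. s m i * cnj (s m j))"
      using psd_decomp[OF r] by blast
    \<comment> \<open>The first index of \<open>ml\<close> selects a Kraus operator given by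
      \<open>w\<close>, the second a vector \<open>s\<close> in the decomposition of the input;
      \<open>g\<close> is that operator applied to that vector, with the ancilla carried
      along.\<close>
    define g where "g ml x = (\<Sum>i<dI. w (fst ml) (i * dO + x div n) * s (snd ml) (i * n + x mod n))" for ml x
    have "ext_id dI dO n E \<rho> $$ (x, y) = (\<Sum>ml\<in>{..<dI * dO} \<times> {..<dI * n}. g ml x * cnj (g ml y))"
      if "x < dO * n" "y < dO * n" for x y
    proof -
      have n: "0 < n" using that by (cases n) auto
      have d: "x div n < dO" "y div n < dO" using that by (simp_all add: less_mult_imp_div_less)
      have "ext_id dI dO n E \<rho> $$ (x, y) = (\<Sum>i<dI. \<Sum>j<dI. \<rho> $$ (i * n + x mod n, j * n + y mod n)
           * J $$ (i * dO + x div n, j * dO + y div n))"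
        using that d by (simp add: ext_id_def E_def blk_def)
      also have "\<dots> = (\<Sum>i<dI. \<Sum>j<dI. \<Sum>m<dI * dO. \<Sum>l<dI * n.
          (w m (i * dO + x div n) * s l (i * n + x mod n)) * cnj (w m (j * dO + y div n) * s l (j * n + y mod n)))"
      proof (intro sum.cong refl)
        fix i j assume "i \<in> {..<dI}" "j \<in> {..<dI}"
        then have ij: "i < dI" "j < dI" by auto
        have 1: "\<rho> $$ (i * n + x mod n, j * n + y mod n)
            = (\<Sum>l<dI * n. s l (i * n + x mod n) * cnj (s l (j * n + y mod n)))"
          by (rule s) (use ij n in \<open>simp_all add: mult_add_less\<close>)
        have 2: "J $$ (i * dO + x div n, j * dO + y div n)
            = (\<Sum>m<dI * dO. w m (i * dO + x div n) * cnj (w m (j * dO + y div n)))"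
          by (rule w) (use ij d in \<open>simp_all add: mult_add_less\<close>)
        show "\<rho> $$ (i * n + x mod n, j * n + y mod n) * J $$ (i * dO + x div n, j * dO + y div n)
          = (\<Sum>m<dI * dO. \<Sum>l<dI * n.
            (w m (i * dO + x div n) * s l (i * n + x mod n)) * cnj (w m (j * dO + y div n) * s l (j * n + y mod n)))"
          unfolding 1 2 sum_product by (subst sum.swap) (intro sum.cong refl, simp)
      qed
      also have "\<dots> = (\<Sum>i<dI. \<Sum>j<dI. \<Sum>ml\<in>{..<dI * dO} \<times> {..<dI * n}.
          (w (fst ml) (i * dO + x div n) * s (snd ml) (i * n + x mod n)) * cnj (w (fst ml) (j * dO + y div n) * s (snd ml) (j * n + y mod n)))"
        by (simp add: sum.cartesian_product case_prod_unfold)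
      also have "\<dots> = (\<Sum>ml\<in>{..<dI * dO} \<times> {..<dI * n}. \<Sum>i<dI. \<Sum>j<dI.
          (w (fst ml) (i * dO + x div n) * s (snd ml) (i * n + x mod n)) * cnj (w (fst ml) (j * dO + y div n) * s (snd ml) (j * n + y mod n)))"
        unfolding sum.swap[of _ "{..<dI * dO} \<times> {..<dI * n}"] ..
      also have "\<dots> = (\<Sum>ml\<in>{..<dI * dO} \<times> {..<dI * n}. g ml x * cnj (g ml y))"
        unfolding g_def cnj_sum sum_product ..
      finally show ?thesis .
    qed
    then have "psdf (dO * n) (\<lambda>x y. ext_id dI dO n E \<rho> $$ (x, y))"
      by (intro psdfI_gram[of "{..<dI * dO} \<times> {..<dI * n}"]) auto
    then show ?thesis by (simp add: psd_iff_psdf ext_id_def)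
  qed
  ultimately show "cptp dI dO E" by (simp add: cptp_def)
qed

text \<open>Every product |v_i| |v_j| is at most the squared norm of v, so the form of
  \<open>X\<close> is bounded by the sum of the moduli of its entries times that squared norm. A
  small multiple cannot outweigh \<open>c\<close> times the identity.\<close>

lemma psdf_perturbation:
  assumes herm: "\<And>i j. i < n \<Longrightarrow> j < n \<Longrightarrow> X j i = cnj (X i j)" and "0 < c"
  obtains e :: real where "0 < e" "psdf n (\<lambda>i j. (if i = j then of_real c else 0) + of_real e * X i j)"
proof
  define K where "K = (\<Sum>i<n. \<Sum>j<n. cmod (X i j))"
  have K0: "0 \<le> K" by (simp add: K_def sum_nonneg)
  \<comment> \<open>Only 0 < \<open>e\<close> and \<open>e * K\<close> \<le> \<open>c\<close>
    matter; the added 1 covers \<open>K\<close> = 0.\<close>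
  define e where "e = c / (K + 1)"
  show e0: "0 < e" using K0 assms(2) by (simp add: e_def)
  show "psdf n (\<lambda>i j. (if i = j then of_real c else 0) + of_real e * X i j)"
    unfolding psdf_def
  proof
    fix v :: "nat \<Rightarrow> complex"
    define N where "N = (\<Sum>i<n. (cmod (v i))\<^sup>2)"
    define q where "q = (\<Sum>i<n. \<Sum>j<n. cnj (v i) * X i j * v j)"
    have "(\<Sum>i<n. \<Sum>j<n. cnj (v i) * ((if i = j then of_real c else 0) + of_real e * X i j) * v j)
        = (\<Sum>i<n. \<Sum>j<n. if i = j then of_real c * (cnj (v i) * v i) else 0) + of_real e * q"
      unfolding q_def sum_distrib_left sum.distrib[symmetric]
      by (intro sum.cong refl) (auto simp: algebra_simps)
    also have "(\<Sum>i<n. \<Sum>j<n. if i = j then of_real c * (cnj (v i) * v i) else 0) = of_real (c * N)"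
      by (simp add: N_def sum_distrib_left complex_norm_square mult.commute del: of_real_power)
    finally have eq: "(\<Sum>i<n. \<Sum>j<n. cnj (v i) * ((if i = j then of_real c else 0) + of_real e * X i j) * v j)
        = of_real (c * N) + of_real e * q" .
    have "cnj q = (\<Sum>i<n. \<Sum>j<n. cnj (v j) * X j i * v i)"
      unfolding q_def cnj_sum
    proof (intro sum.cong refl)
      fix i j assume "i \<in> {..<n}" "j \<in> {..<n}"
      then have "X j i = cnj (X i j)" by (intro herm) auto
      then show "cnj (cnj (v i) * X i j * v j) = cnj (v j) * X j i * v i" by simp
    qed
    also have "\<dots> = q" unfolding q_def by (rule sum.swap)
    finally have im: "Im q = 0" by (simp add: complex_eq_iff)
    have vN: "cmod (v i) * cmod (v j) \<le> N" if "i < n" "j < n" for i j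
    proof -
      have b: "(cmod (v i))\<^sup>2 \<le> N" if "i < n" for i
        unfolding N_def using that by (intro member_le_sum) auto
      have "2 * (cmod (v i) * cmod (v j)) \<le> (cmod (v i))\<^sup>2 + (cmod (v j))\<^sup>2"
        using sum_squares_bound[of "cmod (v i)" "cmod (v j)"] by (simp add: mult.assoc)
      then show ?thesis using b[OF that(1)] b[OF that(2)] by linarith
    qed
    have "cmod q \<le> (\<Sum>i<n. \<Sum>j<n. cmod (cnj (v i) * X i j * v j))"
      unfolding q_def by (rule order_trans[OF norm_sum sum_mono]) (rule norm_sum)
    also have "\<dots> \<le> (\<Sum>i<n. \<Sum>j<n. cmod (X i j) * N)"
    proof (intro sum_mono)
      fix i j assume "i \<in> {..<n}" "j \<in> {..<n}"
      then have "cmod (X i j) * (cmod (v i) * cmod (v j)) \<le> cmod (X i j) * N"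
        by (intro mult_left_mono vN) auto
      then show "cmod (cnj (v i) * X i j * v j) \<le> cmod (X i j) * N" by (simp add: norm_mult mult_ac)
    qed
    also have "\<dots> = K * N" by (simp add: K_def sum_distrib_right)
    finally have "\<bar>Re q\<bar> \<le> K * N" using abs_Re_le_cmod order_trans by blast
    then have "e * \<bar>Re q\<bar> \<le> e * (K * N)" using e0 by simp
    also have "\<dots> \<le> c * N"
    proof -
      have "e * K \<le> c" using K0 assms(2) by (simp add: e_def field_simps)
      moreover have "0 \<le> N" by (simp add: N_def sum_nonneg)
      ultimately show ?thesis using mult_right_mono[of "e * K" c N] by (simp add: mult.assoc)
    qed
    finally have "e * \<bar>Re q\<bar> \<le> c * N" .
    moreover have "e * (- \<bar>Re q\<bar>) \<le> e * Re q" using e0 by (intro mult_left_mono) auto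
    ultimately have "0 \<le> c * N + e * Re q" by simp
    then show "Im (\<Sum>i<n. \<Sum>j<n. cnj (v i) * ((if i = j then of_real c else 0) + of_real e * X i j) * v j) = 0 \<and>
      0 \<le> Re (\<Sum>i<n. \<Sum>j<n. cnj (v i) * ((if i = j then of_real c else 0) + of_real e * X i j) * v j)"
      unfolding eq using im by simp
  qed
qed

text \<open>Perturbing the Choi operator of the maximally mixed channel by a small multiple of a Hermitian
  X with vanishing partial trace stays within the Choi operators of channels.\<close>

lemma functional_constant_on_channels:
  fixes l :: "nat \<Rightarrow> nat \<Rightarrow> complex"
  assumes const: "\<And>J. psd (dI * dO) J \<Longrightarrow> trace_out_id dI dO J \<Longrightarrow>
      (\<Sum>i<dI * dO. \<Sum>j<dI * dO. l i j * J $$ (i, j)) = c"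
    and "0 < dO"
    and X: "\<And>i i'. i < dI \<Longrightarrow> i' < dI \<Longrightarrow> (\<Sum>k<dO. X (i * dO + k) (i' * dO + k)) = 0"
  shows "(\<Sum>i<dI * dO. \<Sum>j<dI * dO. l i j * X i j) = 0"
proof -
  let ?n = "dI * dO"
  define L where "L Y = (\<Sum>i<?n. \<Sum>j<?n. l i j * Y i j)" for Y
  have Lcong: "L Y = L Z" if "\<And>i j. i < ?n \<Longrightarrow> j < ?n \<Longrightarrow> Y i j = Z i j" for Y Z
    unfolding L_def using that by (intro sum.cong) auto
  define D where "D i j = (if i = j then complex_of_real (1 / dO) else 0)" for i j :: nat
  have trD: "(\<Sum>k<dO. D (i * dO + k) (i' * dO + k)) = (if i = i' then 1 else 0)" for i i'
    using \<open>0 < dO\<close> by (simp add: D_def)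
  have const': "L Y = c" if "psdf ?n Y"
    "\<And>i i'. i < dI \<Longrightarrow> i' < dI \<Longrightarrow> (\<Sum>k<dO. Y (i * dO + k) (i' * dO + k)) = (if i = i' then 1 else 0)" for Y
  proof -
    let ?J = "mat ?n ?n (\<lambda>(i, j). Y i j)"
    have "psdf ?n (\<lambda>i j. ?J $$ (i, j))"
      by (rule psdf_reindex[OF that(1), of id]) auto
    then have "psd ?n ?J" by (simp add: psd_iff_psdf)
    moreover have "trace_out_id dI dO ?J"
      using that(2) by (auto simp: trace_out_id_def mult_add_less)
    ultimately have "L (\<lambda>i j. ?J $$ (i, j)) = c" unfolding L_def by (rule const)
    moreover have "L (\<lambda>i j. ?J $$ (i, j)) = L Y" by (rule Lcong) simp
    ultimately show ?thesis by simp
  qed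
  have D: "L D = c"
  proof (rule const')
    let ?s = "complex_of_real (sqrt (1 / dO))"
    have s: "?s * cnj ?s = complex_of_real (1 / dO)"
      by (simp del: of_real_divide real_sqrt_divide flip: of_real_mult)
    have "D i j = (\<Sum>m<?n. (if m = i then ?s else 0) * cnj (if m = j then ?s else 0))" if "i < ?n" for i j
    proof -
      have "(\<Sum>m<?n. (if m = i then ?s else 0) * cnj (if m = j then ?s else 0))
          = (\<Sum>m<?n. if m = i then (if i = j then ?s * cnj ?s else 0) else 0)"
        by (intro sum.cong refl) simp
      also have "\<dots> = (if i = j then ?s * cnj ?s else 0)" using that by (simp only: sum.delta finite_lessThan lessThan_iff if_True)
      finally show ?thesis unfolding D_def s by (rule sym)
    qed
    then show "psdf ?n D" by (intro psdfI_gram[of "{..<?n}"]) auto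
  qed (rule trD)
  have herm: "L Y = 0" if h: "\<And>i j. i < ?n \<Longrightarrow> j < ?n \<Longrightarrow> Y j i = cnj (Y i j)"
    and t: "\<And>i i'. i < dI \<Longrightarrow> i' < dI \<Longrightarrow> (\<Sum>k<dO. Y (i * dO + k) (i' * dO + k)) = 0" for Y
  proof -
    obtain e :: real where e: "0 < e" "psdf ?n (\<lambda>i j. (if i = j then of_real (1 / dO) else 0) + of_real e * Y i j)"
      by (rule psdf_perturbation[of ?n Y "1 / dO", OF h]) (use \<open>0 < dO\<close> in auto)
    then have p: "psdf ?n (\<lambda>i j. D i j + of_real e * Y i j)" by (simp add: D_def)
    have "L (\<lambda>i j. D i j + of_real e * Y i j) = c"
      by (rule const'[OF p]) (simp add: sum.distrib trD t flip: sum_distrib_left)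
    moreover have "L (\<lambda>i j. D i j + of_real e * Y i j) = L D + of_real e * L Y"
      by (simp add: L_def sum.distrib sum_distrib_left algebra_simps)
    ultimately show ?thesis using D e(1) by simp
  qed
  \<comment> \<open>Cartesian decomposition: \<open>L\<close> is complex linear, so the Hermitian
    case extends to all \<open>X\<close>. The partial trace of the adjoint vanishes together with
    that of \<open>X\<close>.\<close>
  define Y1 where "Y1 i j = X i j + cnj (X j i)" for i j
  define Y2 where "Y2 i j = - \<i> * X i j + \<i> * cnj (X j i)" for i j
  have X': "(\<Sum>k<dO. cnj (X (i' * dO + k) (i * dO + k))) = 0" if "i < dI" "i' < dI" for i i'
    using X[OF that(2,1)] by (metis cnj_sum complex_cnj_zero_iff)
  have "L Y1 = 0"
    by (rule herm) (simp_all add: Y1_def sum.distrib X X')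
  moreover have "L Y2 = 0"
    by (rule herm) (simp_all add: Y2_def sum_subtractf X X' flip: sum_distrib_left)
  moreover have "L X = L (\<lambda>i j. (1/2) * Y1 i j + (\<i> / 2) * Y2 i j)"
    by (rule Lcong) (simp add: Y1_def Y2_def algebra_simps)
  moreover have "\<dots> = (1/2) * L Y1 + (\<i> / 2) * L Y2"
    by (simp add: L_def sum.distrib sum_distrib_left algebra_simps)
  ultimately show ?thesis by (simp add: L_def)
qed

section \<open>Unitary matrices and unitary channels\<close>

lemma adj_carrier [simp]: "A \<in> carrier_mat n m \<Longrightarrow> adj A \<in> carrier_mat m n"
  by (auto simp: adj_def)

lemma unitary_mat_cols:
  assumes "U \<in> carrier_mat n m" "unitary_mat U"
  shows "n = m"
    and "\<And>j j'. j < m \<Longrightarrow> j' < m \<Longrightarrow> (\<Sum>i<n. cnj (U $$ (i, j)) * U $$ (i, j')) = (if j = j' then 1 else 0)"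
    and "\<And>i i'. i < n \<Longrightarrow> i' < n \<Longrightarrow> (\<Sum>j<m. U $$ (i, j) * cnj (U $$ (i', j))) = (if i = i' then 1 else 0)"
proof -
  show "n = m" using assms by (auto simp: unitary_mat_def)
  fix j j' assume j: "j < m" "j' < m"
  have "(adj U * U) $$ (j, j') = (\<Sum>i<n. cnj (U $$ (i, j)) * U $$ (i, j'))"
    using assms(1) j by (auto simp: scalar_prod_def adj_def lessThan_atLeast0)
  then show "(\<Sum>i<n. cnj (U $$ (i, j)) * U $$ (i, j')) = (if j = j' then 1 else 0)"
    using assms j by (simp add: unitary_mat_def)
next
  fix i i' assume i: "i < n" "i' < n"
  have "(U * adj U) $$ (i, i') = (\<Sum>j<m. U $$ (i, j) * cnj (U $$ (i', j)))"
    using assms(1) i by (auto simp: scalar_prod_def adj_def lessThan_atLeast0)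
  then show "(\<Sum>j<m. U $$ (i, j) * cnj (U $$ (i', j))) = (if i = i' then 1 else 0)"
    using assms i by (simp add: unitary_mat_def)
qed

text \<open>For square matrices a left inverse is also a right inverse, so orthonormal columns
  suffice.\<close>

lemma unitary_matI:
  assumes "U \<in> carrier_mat n n"
    and "\<And>j j'. j < n \<Longrightarrow> j' < n \<Longrightarrow> (\<Sum>i<n. cnj (U $$ (i, j)) * U $$ (i, j')) = (if j = j' then 1 else 0)"
  shows "unitary_mat U"
proof -
  have "(adj U * U) = 1\<^sub>m n"
    using assms by (intro eq_matI) (auto simp: scalar_prod_def adj_def lessThan_atLeast0)
  moreover from this have "U * adj U = 1\<^sub>m n"
    using assms(1) by (intro mat_mult_left_right_inverse[of "adj U" n U]) auto
  ultimately show ?thesis using assms(1) by (auto simp: unitary_mat_def)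
qed

text \<open>Conjugation by a single operator has a Choi operator of rank one, namely
  |V>><<V|.\<close>

lemma choi_uchan_index:
  assumes "V \<in> carrier_mat dO dI" "i < dI" "k < dO" "i' < dI" "k' < dO"
  shows "choi dI dO (uchan V) $$ (i * dO + k, i' * dO + k') = V $$ (k, i) * cnj (V $$ (k', i'))"
proof -
  have c: "V * ketbra dI i i' \<in> carrier_mat dO dI" using assms by (auto simp: ketbra_def)
  have 1: "(V * ketbra dI i i') $$ (k, j) = (if j = i' then V $$ (k, i) else 0)" if "j < dI" for j
  proof -
    have "(V * ketbra dI i i') $$ (k, j) = (\<Sum>l<dI. V $$ (k, l) * (if l = i \<and> j = i' then 1 else 0))"
      using assms that by (auto simp: ketbra_def scalar_prod_def lessThan_atLeast0)
    also have "\<dots> = (\<Sum>l<dI. if l = i then (if j = i' then V $$ (k, l) else 0) else 0)"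
      by (intro sum.cong refl) auto
    finally show ?thesis using assms by simp
  qed
  have "uchan V (ketbra dI i i') $$ (k, k') = (\<Sum>j<dI. (V * ketbra dI i i') $$ (k, j) * cnj (V $$ (k', j)))"
    using assms c by (auto simp: uchan_def scalar_prod_def adj_def lessThan_atLeast0 intro!: sum.cong)
  also have "\<dots> = (\<Sum>j<dI. if j = i' then V $$ (k, i) * cnj (V $$ (k', j)) else 0)"
    by (intro sum.cong refl) (simp add: 1)
  also have "\<dots> = V $$ (k, i) * cnj (V $$ (k', i'))" using assms by simp
  finally show ?thesis using assms by (simp add: choi_index)
qed

section \<open>The orthogonality conditions in basis indices\<close>

text \<open>The flattening is that of \<open>enc3\<close> for rows and columns; naming the six
  tensor indices lets the two slots be handled separately.\<close>

definition uent :: "nat \<Rightarrow> nat \<Rightarrow> nat \<Rightarrow> nat \<Rightarrow> complex mat \<Rightarrow> nat \<Rightarrow> nat \<Rightarrow> nat \<Rightarrow> nat \<Rightarrow> nat \<Rightarrow> nat \<Rightarrow> complex" where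
  "uent dAO dBI dBO dF U a b f p x y = U $$ ((a * dBI + b) * dF + f, (p * dAO + x) * dBO + y)"

text \<open>The entry of U^* T U between (p, x, y) and (p', x', y') for T = |a><a'| \<otimes>
  |b><b'| \<otimes> 1: the Heisenberg image of a matrix unit of A_I \<otimes> B_I.\<close>

definition gram :: "nat \<Rightarrow> (nat \<Rightarrow> nat \<Rightarrow> nat \<Rightarrow> nat \<Rightarrow> nat \<Rightarrow> nat \<Rightarrow> complex)
    \<Rightarrow> nat \<Rightarrow> nat \<Rightarrow> nat \<Rightarrow> nat \<Rightarrow> nat \<Rightarrow> nat \<Rightarrow> nat \<Rightarrow> nat \<Rightarrow> nat \<Rightarrow> nat \<Rightarrow> complex" where
  "gram dF u a b p x y a' b' p' x' y' = (\<Sum>f<dF. cnj (u a b f p x y) * u a' b' f p' x' y')"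

text \<open>The conditions (a), (b), (c) on the Gram kernel in basis indices: a sesquilinear form vanishes
  on all orthogonal pairs iff it is a multiple of the inner product.\<close>

definition slot_cond_AB where
  "slot_cond_AB dP dAI dAO dBI dBO G \<longleftrightarrow>
    (\<forall>a<dAI. \<forall>b<dBI. \<forall>p<dP. \<forall>x<dAO. \<forall>y<dBO. \<forall>a'<dAI. \<forall>b'<dBI. \<forall>p'<dP. \<forall>x'<dAO. \<forall>y'<dBO.
      G a b p x y a' b' p' x' y' =
        (if x = x' then G a b p 0 y a' b' p' 0 y' else 0)
      + (if y = y' then G a b p x 0 a' b' p' x' 0 else 0)
      - (if x = x' \<and> y = y' then G a b p 0 0 a' b' p' 0 0 else (0::complex)))"

definition slot_cond_B where
  "slot_cond_B dP dAI dAO dBI dBO G \<longleftrightarrow>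
    (\<forall>b<dBI. \<forall>p<dP. \<forall>x<dAO. \<forall>y<dBO. \<forall>b'<dBI. \<forall>p'<dP. \<forall>x'<dAO. \<forall>y'<dBO.
      (\<Sum>a<dAI. G a b p x y a b' p' x' y') =
        (if y = y' then \<Sum>a<dAI. G a b p x 0 a b' p' x' 0 else (0::complex)))"

definition slot_cond_A where
  "slot_cond_A dP dAI dAO dBI dBO G \<longleftrightarrow>
    (\<forall>a<dAI. \<forall>p<dP. \<forall>x<dAO. \<forall>y<dBO. \<forall>a'<dAI. \<forall>p'<dP. \<forall>x'<dAO. \<forall>y'<dBO.
      (\<Sum>b<dBI. G a b p x y a' b p' x' y') =
        (if x = x' then \<Sum>b<dBI. G a b p 0 y a' b p' 0 y' else (0::complex)))"

definition slot_conds where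
  "slot_conds dP dAI dAO dBI dBO G \<longleftrightarrow> slot_cond_AB dP dAI dAO dBI dBO G \<and>
     slot_cond_B dP dAI dAO dBI dBO G \<and> slot_cond_A dP dAI dAO dBI dBO G"

section \<open>Sesquilinear forms that vanish on orthogonal pairs\<close>

definition sesq :: "nat \<Rightarrow> (nat \<Rightarrow> nat \<Rightarrow> complex) \<Rightarrow> complex vec \<Rightarrow> complex vec \<Rightarrow> complex" where
  "sesq n s v w = (\<Sum>i<n. \<Sum>j<n. cnj (v $ i) * w $ j * s i j)"

lemma sesq_cong: "(\<And>i j. i < n \<Longrightarrow> j < n \<Longrightarrow> s i j = t i j) \<Longrightarrow> sesq n s v w = sesq n t v w"
  unfolding sesq_def by (intro sum.cong) auto

lemma sesq_unit_vec:
  assumes "i < n" "j < n"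
  shows "sesq n s (unit_vec n i) (unit_vec n j) = s i j"
proof -
  have "sesq n s (unit_vec n i) (unit_vec n j)
      = (\<Sum>k<n. \<Sum>l<n. if k = i then if l = j then s k l else 0 else 0)"
    using assms unfolding sesq_def by (intro sum.cong refl) simp
  also have "\<dots> = (\<Sum>k<n. if k = i then s k j else 0)"
    using assms by (intro sum.cong refl) simp
  finally show ?thesis using assms by simp
qed

lemma sesq_diff: "sesq n (\<lambda>i j. s i j - t i j) v w = sesq n s v w - sesq n t v w"
  by (simp add: sesq_def algebra_simps sum_subtractf)

lemma sesq_sum: "sesq n (\<lambda>i j. \<Sum>k\<in>K. s k i j) v w = (\<Sum>k\<in>K. sesq n (s k) v w)"
proof -
  have "sesq n (\<lambda>i j. \<Sum>k\<in>K. s k i j) v w = (\<Sum>i<n. \<Sum>j<n. \<Sum>k\<in>K. cnj (v $ i) * w $ j * s k i j)"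
    by (simp add: sesq_def sum_distrib_left)
  also have "\<dots> = (\<Sum>k\<in>K. sesq n (s k) v w)"
    unfolding sesq_def sum.swap[of _ K] ..
  finally show ?thesis .
qed

lemma sesq_delta: "v \<in> carrier_vec n \<Longrightarrow> sesq n (\<lambda>i j. if i = j then c else 0) v w = c * cinner v w"
  by (simp add: sesq_def cinner_def if_distrib[of "\<lambda>x. _ * x"] sum_distrib_left mult_ac cong: if_cong)

lemma cinner_add_left:
  assumes "u \<in> carrier_vec n" "v \<in> carrier_vec n" "w \<in> carrier_vec n"
  shows "cinner (u + v) w = cinner u w + cinner v w"
  using assms by (simp add: cinner_def ring_distribs sum.distrib)

lemma sesq_add_left:
  "u \<in> carrier_vec n \<Longrightarrow> v \<in> carrier_vec n \<Longrightarrow> sesq n s (u + v) w = sesq n s u w + sesq n s v w"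
  by (simp add: sesq_def ring_distribs sum.distrib)

lemma sesq_diff_right:
  "v \<in> carrier_vec n \<Longrightarrow> w \<in> carrier_vec n \<Longrightarrow> sesq n s u (v - w) = sesq n s u v - sesq n s u w"
  by (simp add: sesq_def ring_distribs sum_subtractf)

text \<open>Pairs of distinct basis vectors kill the off-diagonal entries. The orthogonal pair e_i +
  e_0, e_i - e_0 then equates each diagonal entry with the one at the reference index 0.\<close>

lemma sesq_orthogonal_iff:
  assumes "0 < n"
  shows "(\<forall>v\<in>carrier_vec n. \<forall>w\<in>carrier_vec n. cinner v w = 0 \<longrightarrow> sesq n s v w = 0) \<longleftrightarrow>
     (\<forall>i<n. \<forall>j<n. s i j = (if i = j then s 0 0 else 0))"
proof
  assume L: "\<forall>v\<in>carrier_vec n. \<forall>w\<in>carrier_vec n. cinner v w = 0 \<longrightarrow> sesq n s v w = 0"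
  have cu: "cinner (unit_vec n i) w = w $ i" if "i < n" for i and w :: "complex vec"
  proof -
    have "cinner (unit_vec n i) w = (\<Sum>k<n. if k = i then w $ k else 0)"
      unfolding cinner_def by (intro sum.cong) (use that in auto)
    then show ?thesis using that by simp
  qed
  have off: "s i j = 0" if ij: "i < n" "j < n" "i \<noteq> j" for i j
  proof -
    have "cinner (unit_vec n i) (unit_vec n j) = 0" unfolding cu[OF ij(1)] using ij by simp
    then have "sesq n s (unit_vec n i) (unit_vec n j) = 0" by (intro L[rule_format]) auto
    then show ?thesis unfolding sesq_unit_vec[OF ij(1,2)] .
  qed
  have diag: "s i i = s 0 0" if "i < n" for i
  proof (cases "i = 0")
    case False
    let ?v = "unit_vec n i + unit_vec n 0 :: complex vec" and ?w = "unit_vec n i - unit_vec n 0 :: complex vec"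
    have "cinner ?v ?w = ?w $ i + ?w $ 0"
      unfolding cinner_add_left[of "unit_vec n i" n "unit_vec n 0" ?w, simplified] cu[OF that] cu[OF assms] ..
    also have "\<dots> = 0" using that assms False by simp
    finally have "sesq n s ?v ?w = 0" by (intro L[rule_format]) auto
    moreover have "sesq n s ?v ?w = s i i + s 0 i - (s i 0 + s 0 0)"
      by (simp only: sesq_add_left[of _ n] sesq_diff_right[of _ n] sesq_unit_vec[OF that that]
          sesq_unit_vec[OF that assms] sesq_unit_vec[OF assms that] sesq_unit_vec[OF assms assms] unit_vec_carrier)
    ultimately show ?thesis using off[of i 0] off[of 0 i] that assms False by simp
  qed simp
  show "\<forall>i<n. \<forall>j<n. s i j = (if i = j then s 0 0 else 0)"
  proof (intro allI impI)
    fix i j assume "i < n" "j < n"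
    then show "s i j = (if i = j then s 0 0 else 0)"
      using off[of i j] diag[of i] by (cases "i = j") auto
  qed
next
  assume R: "\<forall>i<n. \<forall>j<n. s i j = (if i = j then s 0 0 else 0)"
  show "\<forall>v\<in>carrier_vec n. \<forall>w\<in>carrier_vec n. cinner v w = 0 \<longrightarrow> sesq n s v w = 0"
  proof (intro ballI impI)
    fix v w :: "complex vec" assume "v \<in> carrier_vec n" "w \<in> carrier_vec n" "cinner v w = 0"
    moreover have "sesq n s v w = sesq n (\<lambda>i j. if i = j then s 0 0 else 0) v w"
      by (rule sesq_cong) (rule R[rule_format])
    ultimately show "sesq n s v w = 0" by (simp add: sesq_delta)
  qed
qed

text \<open>The criterion for one factor is used twice: on the first factor with the second pair
  fixed, then on the second factor for what remains after removing the part proportional to the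
  identity on the first. That removal produces the inclusion-exclusion correction in the last
  term.\<close>

lemma sesq_orthogonal2_iff:
  assumes "0 < n" "0 < m"
  shows "(\<forall>v\<in>carrier_vec n. \<forall>w\<in>carrier_vec n. \<forall>v'\<in>carrier_vec m. \<forall>w'\<in>carrier_vec m.
        cinner v w = 0 \<and> cinner v' w' = 0 \<longrightarrow> sesq n (\<lambda>i j. sesq m (s i j) v' w') v w = 0) \<longleftrightarrow>
     (\<forall>i<n. \<forall>j<n. \<forall>k<m. \<forall>l<m. s i j k l = (if i = j then s 0 0 k l else 0)
        + (if k = l then s i j 0 0 else 0) - (if i = j \<and> k = l then s 0 0 0 0 else 0))"
    (is "?L \<longleftrightarrow> ?R")
proof -
  define t where "t i j k l = s i j k l - (if i = j then s 0 0 k l else 0)" for i j k l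
  have "?L \<longleftrightarrow> (\<forall>v'\<in>carrier_vec m. \<forall>w'\<in>carrier_vec m. cinner v' w' = 0 \<longrightarrow>
      (\<forall>i<n. \<forall>j<n. sesq m (s i j) v' w' = (if i = j then sesq m (s 0 0) v' w' else 0)))"
    using sesq_orthogonal_iff[OF assms(1), of "\<lambda>i j. sesq m (s i j) _ _"] by blast
  also have "\<dots> \<longleftrightarrow> (\<forall>v'\<in>carrier_vec m. \<forall>w'\<in>carrier_vec m. cinner v' w' = 0 \<longrightarrow>
      (\<forall>i<n. \<forall>j<n. sesq m (t i j) v' w' = 0))"
  proof -
    have "sesq m (t i j) v' w' = sesq m (s i j) v' w' - (if i = j then sesq m (s 0 0) v' w' else 0)" for i j v' w'
      unfolding t_def sesq_diff by (cases "i = j") (simp_all add: sesq_def)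
    then show ?thesis by simp
  qed
  also have "\<dots> \<longleftrightarrow> (\<forall>i<n. \<forall>j<n. \<forall>k<m. \<forall>l<m. t i j k l = (if k = l then t i j 0 0 else 0))"
    using sesq_orthogonal_iff[OF assms(2), of "t _ _"] by blast
  also have "\<dots> \<longleftrightarrow> ?R"
  proof -
    have "t i j k l = (if k = l then t i j 0 0 else 0) \<longleftrightarrow> s i j k l = (if i = j then s 0 0 k l else 0)
        + (if k = l then s i j 0 0 else 0) - (if i = j \<and> k = l then s 0 0 0 0 else 0)" for i j k l
      by (auto simp: t_def algebra_simps)
    then show ?thesis by simp
  qed
  finally show ?thesis .
qed

section \<open>Partial inner products as smeared Gram kernels\<close>

lemma sum_cnj_prod_combination:
  fixes w z :: "'j \<Rightarrow> 'f \<Rightarrow> complex"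
  shows "(\<Sum>f\<in>F. cnj (\<Sum>j\<in>J. c j * w j f) * (\<Sum>k\<in>K. d k * z k f))
       = (\<Sum>j\<in>J. \<Sum>k\<in>K. cnj (c j) * d k * (\<Sum>f\<in>F. cnj (w j f) * z k f))"
proof -
  have "(\<Sum>f\<in>F. cnj (\<Sum>j\<in>J. c j * w j f) * (\<Sum>k\<in>K. d k * z k f))
      = (\<Sum>f\<in>F. \<Sum>j\<in>J. \<Sum>k\<in>K. cnj (c j) * d k * (cnj (w j f) * z k f))"
    unfolding cnj_sum sum_product by (intro sum.cong refl) simp
  also have "\<dots> = (\<Sum>j\<in>J. \<Sum>f\<in>F. \<Sum>k\<in>K. cnj (c j) * d k * (cnj (w j f) * z k f))"
    by (rule sum.swap)
  also have "\<dots> = (\<Sum>j\<in>J. \<Sum>k\<in>K. \<Sum>f\<in>F. cnj (c j) * d k * (cnj (w j f) * z k f))"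
    by (intro sum.cong refl sum.swap)
  finally show ?thesis by (simp add: sum_distrib_left)
qed

lemma sum_cnj_prod_sesq:
  "(\<Sum>f\<in>F. cnj (\<Sum>j<n. v $ j * w j f) * (\<Sum>k<n. v' $ k * z k f))
     = sesq n (\<lambda>j k. \<Sum>f\<in>F. cnj (w j f) * z k f) v v'"
  unfolding sum_cnj_prod_combination sesq_def ..

text \<open>A partial inner product is antilinear in its bra, so the bra enters the expansions
  through conjugate coordinates.\<close>

definition vconj :: "complex vec \<Rightarrow> complex vec" where
  "vconj v = map_vec cnj v"

lemma vconj_simps [simp]: "i < dim_vec v \<Longrightarrow> vconj v $ i = cnj (v $ i)" "vconj v \<in> carrier_vec n \<longleftrightarrow> v \<in> carrier_vec n"
  by (auto simp: vconj_def)

text \<open>The inner product over F of the components (a, b) and (a', b') of \<open>U\<close>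
  applied to two product vectors, as \<open>sum_mult_kvec\<close> shows.\<close>

definition gram_prod :: "nat \<Rightarrow> nat \<Rightarrow> nat \<Rightarrow> nat \<Rightarrow> (nat \<Rightarrow> nat \<Rightarrow> nat \<Rightarrow> nat \<Rightarrow> nat \<Rightarrow> nat \<Rightarrow> complex)
    \<Rightarrow> complex vec \<Rightarrow> complex vec \<Rightarrow> complex vec \<Rightarrow> complex vec \<Rightarrow> complex vec \<Rightarrow> complex vec
    \<Rightarrow> nat \<Rightarrow> nat \<Rightarrow> nat \<Rightarrow> nat \<Rightarrow> complex" where
  "gram_prod dP dAO dBO dF u \<pi> \<alpha> \<beta> \<pi>' \<alpha>' \<beta>' a b a' b' =
     sesq dP (\<lambda>p p'. sesq dAO (\<lambda>x x'. sesq dBO (\<lambda>y y'. gram dF u a b p x y a' b' p' x' y') \<beta> \<beta>') \<alpha> \<alpha>') \<pi> \<pi>'"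

lemma mult_kvec_index:
  assumes U: "U \<in> carrier_mat (dAI * dBI * dF) (dP * dAO * dBO)" and "i < dAI * dBI" "f < dF"
  shows "(U *\<^sub>v kvec [dP, dAO, dBO] [\<pi>, \<alpha>, \<beta>]) $ (i * dF + f)
    = (\<Sum>p<dP. \<pi> $ p * (\<Sum>x<dAO. \<alpha> $ x * (\<Sum>y<dBO. \<beta> $ y * U $$ (i * dF + f, (p * dAO + x) * dBO + y))))"
proof -
  let ?k = "kvec [dP, dAO, dBO] [\<pi>, \<alpha>, \<beta>]"
  have i: "i * dF + f < dAI * dBI * dF" using assms by (simp add: mult_add_less)
  have k: "?k $ ((p * dAO + x) * dBO + y) = \<pi> $ p * \<alpha> $ x * \<beta> $ y"
    if "p < dP" "x < dAO" "y < dBO" for p x y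
  proof -
    have "dec [dP, dAO, dBO] ((p * dAO + x) * dBO + y) = [p, x, y]"
      using dec_enc[of "[p, x, y]" "[dP, dAO, dBO]"] that unfolding enc3 by simp
    moreover have "(p * dAO + x) * dBO + y < prod_list [dP, dAO, dBO]"
      using enc_less[of "[p, x, y]" "[dP, dAO, dBO]"] that unfolding enc3 by simp
    ultimately show ?thesis unfolding kvec_def by (simp del: dec_Cons add: mult.assoc)
  qed
  have "(U *\<^sub>v ?k) $ (i * dF + f) = (\<Sum>j<dP * dAO * dBO. U $$ (i * dF + f, j) * ?k $ j)"
    using U i by (auto simp: scalar_prod_def kvec_def lessThan_atLeast0 mult.assoc intro!: sum.cong)
  also have "\<dots> = (\<Sum>p<dP. \<Sum>x<dAO. \<Sum>y<dBO.
       U $$ (i * dF + f, (p * dAO + x) * dBO + y) * ?k $ ((p * dAO + x) * dBO + y))"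
    unfolding sum_lessThan_mult ..
  also have "\<dots> = (\<Sum>p<dP. \<Sum>x<dAO. \<Sum>y<dBO.
       U $$ (i * dF + f, (p * dAO + x) * dBO + y) * (\<pi> $ p * \<alpha> $ x * \<beta> $ y))"
    by (intro sum.cong refl) (simp add: k)
  finally show ?thesis by (simp add: sum_distrib_left mult_ac)
qed

lemma sum_mult_kvec:
  assumes U: "U \<in> carrier_mat (dAI * dBI * dF) (dP * dAO * dBO)"
    and "a < dAI" "b < dBI" "a' < dAI" "b' < dBI"
  shows "(\<Sum>f<dF. cnj ((U *\<^sub>v kvec [dP, dAO, dBO] [\<pi>, \<alpha>, \<beta>]) $ ((a * dBI + b) * dF + f))
      * (U *\<^sub>v kvec [dP, dAO, dBO] [\<pi>', \<alpha>', \<beta>']) $ ((a' * dBI + b') * dF + f))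
    = gram_prod dP dAO dBO dF (uent dAO dBI dBO dF U) \<pi> \<alpha> \<beta> \<pi>' \<alpha>' \<beta>' a b a' b'"
proof -
  have i: "a * dBI + b < dAI * dBI" "a' * dBI + b' < dAI * dBI"
    using assms by (simp_all add: mult_add_less)
  show ?thesis
    unfolding gram_prod_def gram_def uent_def sum_cnj_prod_sesq[symmetric]
    by (intro sum.cong refl) (simp only: mult_kvec_index[OF U i(1)] mult_kvec_index[OF U i(2)] lessThan_iff)
qed

lemma cinner_pin_AB:
  assumes U: "U \<in> carrier_mat (dAI * dBI * dF) (dP * dAO * dBO)"
    and g: "\<Gamma> \<in> carrier_vec (dAI * dBI)" "\<Gamma>' \<in> carrier_vec (dAI * dBI)"
  shows "cinner (pin_AB [dP, dAI, dAO, dBI, dBO, dF] \<Gamma> (U *\<^sub>v kvec [dP, dAO, dBO] [\<pi>, \<alpha>, \<beta>]))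
           (pin_AB [dP, dAI, dAO, dBI, dBO, dF] \<Gamma>' (U *\<^sub>v kvec [dP, dAO, dBO] [\<pi>', \<alpha>', \<beta>']))
    = sesq (dAI * dBI) (\<lambda>i i'. gram_prod dP dAO dBO dF (uent dAO dBI dBO dF U) \<pi> \<alpha> \<beta> \<pi>' \<alpha>' \<beta>'
        (i div dBI) (i mod dBI) (i' div dBI) (i' mod dBI)) (vconj \<Gamma>) (vconj \<Gamma>')"
proof -
  let ?ds = "[dP, dAI, dAO, dBI, dBO, dF]"
  have pin: "pin_AB ?ds \<Gamma> v = vec dF (\<lambda>f. \<Sum>i<dAI * dBI. vconj \<Gamma> $ i * v $ (i * dF + f))"
    if "\<Gamma> \<in> carrier_vec (dAI * dBI)" for \<Gamma> v
  proof -
    have "pin_AB ?ds \<Gamma> v = vec dF (\<lambda>f. \<Sum>a<dAI. \<Sum>b<dBI. vconj \<Gamma> $ (a * dBI + b) * v $ ((a * dBI + b) * dF + f))"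
      using that unfolding pin_AB_def by (intro eq_vecI) (auto simp: enc2 enc3 mult_add_less simp del: enc.simps intro!: sum.cong)
    then show ?thesis unfolding sum_lessThan_mult .
  qed
  show ?thesis
    unfolding pin[OF g(1)] pin[OF g(2)] cinner_def dim_vec
  proof -
    have "(\<Sum>f<dF. cnj (vec dF (\<lambda>f. \<Sum>i<dAI * dBI. vconj \<Gamma> $ i * (U *\<^sub>v kvec [dP, dAO, dBO] [\<pi>, \<alpha>, \<beta>]) $ (i * dF + f)) $ f)
        * vec dF (\<lambda>f. \<Sum>i<dAI * dBI. vconj \<Gamma>' $ i * (U *\<^sub>v kvec [dP, dAO, dBO] [\<pi>', \<alpha>', \<beta>']) $ (i * dF + f)) $ f)
     = sesq (dAI * dBI) (\<lambda>i i'. \<Sum>f<dF. cnj ((U *\<^sub>v kvec [dP, dAO, dBO] [\<pi>, \<alpha>, \<beta>]) $ (i * dF + f))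
        * (U *\<^sub>v kvec [dP, dAO, dBO] [\<pi>', \<alpha>', \<beta>']) $ (i' * dF + f)) (vconj \<Gamma>) (vconj \<Gamma>')"
      unfolding sum_cnj_prod_sesq[symmetric] by (intro sum.cong refl) simp
    also have "\<dots> = sesq (dAI * dBI) (\<lambda>i i'. gram_prod dP dAO dBO dF (uent dAO dBI dBO dF U) \<pi> \<alpha> \<beta> \<pi>' \<alpha>' \<beta>'
        (i div dBI) (i mod dBI) (i' div dBI) (i' mod dBI)) (vconj \<Gamma>) (vconj \<Gamma>')"
    proof (rule sesq_cong)
      fix i j assume ij: "i < dAI * dBI" "j < dAI * dBI"
      then have "0 < dBI" by (cases dBI) auto
      then show "(\<Sum>f<dF. cnj ((U *\<^sub>v kvec [dP, dAO, dBO] [\<pi>, \<alpha>, \<beta>]) $ (i * dF + f))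
        * (U *\<^sub>v kvec [dP, dAO, dBO] [\<pi>', \<alpha>', \<beta>']) $ (j * dF + f))
        = gram_prod dP dAO dBO dF (uent dAO dBI dBO dF U) \<pi> \<alpha> \<beta> \<pi>' \<alpha>' \<beta>'
        (i div dBI) (i mod dBI) (j div dBI) (j mod dBI)"
        using sum_mult_kvec[OF U, of "i div dBI" "i mod dBI" "j div dBI" "j mod dBI" \<pi> \<alpha> \<beta> \<pi>' \<alpha>' \<beta>'] ij
        by (simp add: less_mult_imp_div_less)
    qed
    finally show "(\<Sum>f<dF. cnj (vec dF (\<lambda>f. \<Sum>i<dAI * dBI. vconj \<Gamma> $ i * (U *\<^sub>v kvec [dP, dAO, dBO] [\<pi>, \<alpha>, \<beta>]) $ (i * dF + f)) $ f)
        * vec dF (\<lambda>f. \<Sum>i<dAI * dBI. vconj \<Gamma>' $ i * (U *\<^sub>v kvec [dP, dAO, dBO] [\<pi>', \<alpha>', \<beta>']) $ (i * dF + f)) $ f)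
     = sesq (dAI * dBI) (\<lambda>i i'. gram_prod dP dAO dBO dF (uent dAO dBI dBO dF U) \<pi> \<alpha> \<beta> \<pi>' \<alpha>' \<beta>'
        (i div dBI) (i mod dBI) (i' div dBI) (i' mod dBI)) (vconj \<Gamma>) (vconj \<Gamma>')" .
  qed
qed

text \<open>In condition (b) the factor A_I is not projected; it joins F in the inner product, which
  produces the sum over equal indices \<open>a\<close>.\<close>

lemma cinner_pin_B:
  assumes U: "U \<in> carrier_mat (dAI * dBI * dF) (dP * dAO * dBO)"
    and g: "\<psi> \<in> carrier_vec dBI" "\<psi>' \<in> carrier_vec dBI"
  shows "cinner (pin_B [dP, dAI, dAO, dBI, dBO, dF] \<psi> (U *\<^sub>v kvec [dP, dAO, dBO] [\<pi>, \<alpha>, \<beta>]))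
           (pin_B [dP, dAI, dAO, dBI, dBO, dF] \<psi>' (U *\<^sub>v kvec [dP, dAO, dBO] [\<pi>', \<alpha>', \<beta>']))
    = sesq dBI (\<lambda>b b'. \<Sum>a<dAI. gram_prod dP dAO dBO dF (uent dAO dBI dBO dF U) \<pi> \<alpha> \<beta> \<pi>' \<alpha>' \<beta>' a b a b')
        (vconj \<psi>) (vconj \<psi>')"
proof -
  let ?ds = "[dP, dAI, dAO, dBI, dBO, dF]"
  let ?v = "U *\<^sub>v kvec [dP, dAO, dBO] [\<pi>, \<alpha>, \<beta>]" and ?w = "U *\<^sub>v kvec [dP, dAO, dBO] [\<pi>', \<alpha>', \<beta>']"
  have pin: "pin_B ?ds \<psi> v $ (a * dF + f) = (\<Sum>b<dBI. vconj \<psi> $ b * v $ ((a * dBI + b) * dF + f))"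
    if "\<psi> \<in> carrier_vec dBI" "a < dAI" "f < dF" for \<psi> v a f
    using that unfolding pin_B_def by (auto simp: enc2 enc3 mult_add_less simp del: enc.simps intro!: sum.cong)
  have "cinner (pin_B ?ds \<psi> ?v) (pin_B ?ds \<psi>' ?w)
      = (\<Sum>k<dAI * dF. cnj (pin_B ?ds \<psi> ?v $ k) * pin_B ?ds \<psi>' ?w $ k)"
    by (simp add: cinner_def pin_B_def)
  also have "\<dots> = (\<Sum>a<dAI. \<Sum>f<dF. cnj (\<Sum>b<dBI. vconj \<psi> $ b * ?v $ ((a * dBI + b) * dF + f))
      * (\<Sum>b<dBI. vconj \<psi>' $ b * ?w $ ((a * dBI + b) * dF + f)))"
    unfolding sum_lessThan_mult by (intro sum.cong refl) (simp add: pin g)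
  also have "\<dots> = (\<Sum>a<dAI. sesq dBI (\<lambda>b b'. gram_prod dP dAO dBO dF (uent dAO dBI dBO dF U) \<pi> \<alpha> \<beta> \<pi>' \<alpha>' \<beta>' a b a b')
        (vconj \<psi>) (vconj \<psi>'))"
    unfolding sum_cnj_prod_sesq by (intro sum.cong refl sesq_cong) (simp add: sum_mult_kvec[OF U])
  finally show ?thesis unfolding sesq_sum .
qed

lemma cinner_pin_A:
  assumes U: "U \<in> carrier_mat (dAI * dBI * dF) (dP * dAO * dBO)"
    and g: "\<phi> \<in> carrier_vec dAI" "\<phi>' \<in> carrier_vec dAI"
  shows "cinner (pin_A [dP, dAI, dAO, dBI, dBO, dF] \<phi> (U *\<^sub>v kvec [dP, dAO, dBO] [\<pi>, \<alpha>, \<beta>]))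
           (pin_A [dP, dAI, dAO, dBI, dBO, dF] \<phi>' (U *\<^sub>v kvec [dP, dAO, dBO] [\<pi>', \<alpha>', \<beta>']))
    = sesq dAI (\<lambda>a a'. \<Sum>b<dBI. gram_prod dP dAO dBO dF (uent dAO dBI dBO dF U) \<pi> \<alpha> \<beta> \<pi>' \<alpha>' \<beta>' a b a' b)
        (vconj \<phi>) (vconj \<phi>')"
proof -
  let ?ds = "[dP, dAI, dAO, dBI, dBO, dF]"
  let ?v = "U *\<^sub>v kvec [dP, dAO, dBO] [\<pi>, \<alpha>, \<beta>]" and ?w = "U *\<^sub>v kvec [dP, dAO, dBO] [\<pi>', \<alpha>', \<beta>']"
  have pin: "pin_A ?ds \<phi> v $ (b * dF + f) = (\<Sum>a<dAI. vconj \<phi> $ a * v $ ((a * dBI + b) * dF + f))"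
    if "\<phi> \<in> carrier_vec dAI" "b < dBI" "f < dF" for \<phi> v b f
    using that unfolding pin_A_def by (auto simp: enc2 enc3 mult_add_less simp del: enc.simps intro!: sum.cong)
  have "cinner (pin_A ?ds \<phi> ?v) (pin_A ?ds \<phi>' ?w)
      = (\<Sum>k<dBI * dF. cnj (pin_A ?ds \<phi> ?v $ k) * pin_A ?ds \<phi>' ?w $ k)"
    by (simp add: cinner_def pin_A_def)
  also have "\<dots> = (\<Sum>b<dBI. \<Sum>f<dF. cnj (\<Sum>a<dAI. vconj \<phi> $ a * ?v $ ((a * dBI + b) * dF + f))
      * (\<Sum>a<dAI. vconj \<phi>' $ a * ?w $ ((a * dBI + b) * dF + f)))"
    unfolding sum_lessThan_mult by (intro sum.cong refl) (simp add: pin g)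
  also have "\<dots> = (\<Sum>b<dBI. sesq dAI (\<lambda>a a'. gram_prod dP dAO dBO dF (uent dAO dBI dBO dF U) \<pi> \<alpha> \<beta> \<pi>' \<alpha>' \<beta>' a b a' b)
        (vconj \<phi>) (vconj \<phi>'))"
    unfolding sum_cnj_prod_sesq by (intro sum.cong refl sesq_cong) (simp add: sum_mult_kvec[OF U])
  finally show ?thesis unfolding sesq_sum .
qed

lemma sesq_zero: "(\<And>i j. i < n \<Longrightarrow> j < n \<Longrightarrow> s i j = 0) \<Longrightarrow> sesq n s v w = 0"
  unfolding sesq_def by simp

text \<open>Basis vectors of P, A_I and B_I reduce each condition to single entries, to which the
  criteria for orthogonal pairs in A_O and B_O apply. Conversely, a form whose entries all vanish is
  zero on arbitrary vectors.\<close>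

lemma cond2_iff_slot_conds:
  fixes dP dAI dAO dBI dBO dF :: nat and U :: "complex mat"
  assumes pos: "0 < dAO" "0 < dBO"
    and U: "U \<in> carrier_mat (dAI * dBI * dF) (dP * dAO * dBO)"
  shows "cond2 [dP, dAI, dAO, dBI, dBO, dF] U \<longleftrightarrow> slot_conds dP dAI dAO dBI dBO (gram dF (uent dAO dBI dBO dF U))"
    (is "?L \<longleftrightarrow> ?R")
proof -
  let ?ds = "[dP, dAI, dAO, dBI, dBO, dF]"
  let ?v = "\<lambda>p a b. U *\<^sub>v kvec [dP, dAO, dBO] [p, a, b]"
  define g where "g = gram dF (uent dAO dBI dBO dF U)"
  define gp where "gp = gram_prod dP dAO dBO dF (uent dAO dBI dBO dF U)"
  have gp: "gp \<pi> \<alpha> \<beta> \<pi>' \<alpha>' \<beta>' a b a' b' =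
     sesq dP (\<lambda>p p'. sesq dAO (\<lambda>x x'. sesq dBO (\<lambda>y y'. g a b p x y a' b' p' x' y') \<beta> \<beta>') \<alpha> \<alpha>') \<pi> \<pi>'"
    for \<pi> \<alpha> \<beta> \<pi>' \<alpha>' \<beta>' a b a' b' by (simp add: gp_def gram_prod_def g_def)
  have AB: "cinner (pin_AB ?ds \<Gamma> (?v \<pi> \<alpha> \<beta>)) (pin_AB ?ds \<Gamma>' (?v \<pi>' \<alpha>' \<beta>')) = 
      sesq (dAI * dBI) (\<lambda>i i'. gp \<pi> \<alpha> \<beta> \<pi>' \<alpha>' \<beta>' (i div dBI) (i mod dBI) (i' div dBI) (i' mod dBI)) (vconj \<Gamma>) (vconj \<Gamma>')"
    if "\<Gamma> \<in> carrier_vec (dAI * dBI)" "\<Gamma>' \<in> carrier_vec (dAI * dBI)" for \<Gamma> \<Gamma>' \<pi> \<alpha> \<beta> \<pi>' \<alpha>' \<beta>'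
    unfolding gp_def by (rule cinner_pin_AB[OF U that])
  have B: "cinner (pin_B ?ds \<psi> (?v \<pi> \<alpha> \<beta>)) (pin_B ?ds \<psi>' (?v \<pi>' \<alpha>' \<beta>')) = 
      sesq dBI (\<lambda>b b'. \<Sum>a<dAI. gp \<pi> \<alpha> \<beta> \<pi>' \<alpha>' \<beta>' a b a b') (vconj \<psi>) (vconj \<psi>')"
    if "\<psi> \<in> carrier_vec dBI" "\<psi>' \<in> carrier_vec dBI" for \<psi> \<psi>' \<pi> \<alpha> \<beta> \<pi>' \<alpha>' \<beta>'
    unfolding gp_def by (rule cinner_pin_B[OF U that])
  have A: "cinner (pin_A ?ds \<phi> (?v \<pi> \<alpha> \<beta>)) (pin_A ?ds \<phi>' (?v \<pi>' \<alpha>' \<beta>')) = 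
      sesq dAI (\<lambda>a a'. \<Sum>b<dBI. gp \<pi> \<alpha> \<beta> \<pi>' \<alpha>' \<beta>' a b a' b) (vconj \<phi>) (vconj \<phi>')"
    if "\<phi> \<in> carrier_vec dAI" "\<phi>' \<in> carrier_vec dAI" for \<phi> \<phi>' \<pi> \<alpha> \<beta> \<pi>' \<alpha>' \<beta>'
    unfolding gp_def by (rule cinner_pin_A[OF U that])
  have cu: "vconj (unit_vec n i) = unit_vec n i" for n i
    by (intro eq_vecI) (auto simp: vconj_def unit_vec_def)
  have gp_unit_p: "gp (unit_vec dP p) \<alpha> \<beta> (unit_vec dP p') \<alpha>' \<beta>' a b a' b'
      = sesq dAO (\<lambda>x x'. sesq dBO (\<lambda>y y'. g a b p x y a' b' p' x' y') \<beta> \<beta>') \<alpha> \<alpha>'"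
    if "p < dP" "p' < dP" for p p' \<alpha> \<beta> \<alpha>' \<beta>' a b a' b'
    unfolding gp using that by (rule sesq_unit_vec)
  have 0: "cinner v (0\<^sub>v n) = 0" if "v \<in> carrier_vec n" for v n
    using that by (simp add: cinner_def)
  show ?thesis
  proof
    assume L: ?L
    have L': "cinner (pin_AB ?ds \<Gamma> (?v \<pi> \<alpha> \<beta>)) (pin_AB ?ds \<Gamma>' (?v \<pi>' \<alpha>p \<beta>p)) = 0 \<and>
        cinner (pin_B ?ds \<psi> (?v \<pi> \<alpha> \<beta>)) (pin_B ?ds \<psi>' (?v \<pi>' \<alpha>' \<beta>p)) = 0 \<and>
        cinner (pin_A ?ds \<phi> (?v \<pi> \<alpha> \<beta>)) (pin_A ?ds \<phi>' (?v \<pi>' \<alpha>p \<beta>')) = 0"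
      if "\<pi> \<in> carrier_vec dP" "\<pi>' \<in> carrier_vec dP" "\<alpha> \<in> carrier_vec dAO" "\<alpha>' \<in> carrier_vec dAO" "\<alpha>p \<in> carrier_vec dAO"
       "\<beta> \<in> carrier_vec dBO" "\<beta>' \<in> carrier_vec dBO" "\<beta>p \<in> carrier_vec dBO"
       "\<Gamma> \<in> carrier_vec (dAI * dBI)" "\<Gamma>' \<in> carrier_vec (dAI * dBI)" "\<phi> \<in> carrier_vec dAI" "\<phi>' \<in> carrier_vec dAI"
       "\<psi> \<in> carrier_vec dBI" "\<psi>' \<in> carrier_vec dBI" "cinner \<alpha> \<alpha>p = 0" "cinner \<beta> \<beta>p = 0"
      for \<pi> \<pi>' \<alpha> \<alpha>' \<alpha>p \<beta> \<beta>' \<beta>p \<Gamma> \<Gamma>' \<phi> \<phi>' \<psi> \<psi>'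
    proof -
      have nth: "?ds ! 0 = dP" "?ds ! 1 = dAI" "?ds ! 2 = dAO" "?ds ! 3 = dBI" "?ds ! 4 = dBO" by simp_all
      show ?thesis
        by (rule L[unfolded cond2_def Let_def nth, rule_format, OF that(1-14) conjI[OF that(15,16)]])
    qed
    \<comment> \<open>The three conditions share one list of variables. Filling the variables of the
      other two with zero vectors isolates one of them, and a zero vector satisfies every
      orthogonality premise.\<close>
    have LAB: "sesq (dAI * dBI) (\<lambda>i i'. gp \<pi> \<alpha> \<beta> \<pi>' \<alpha>' \<beta>' (i div dBI) (i mod dBI) (i' div dBI) (i' mod dBI)) (vconj \<Gamma>) (vconj \<Gamma>') = 0"
      if "\<pi> \<in> carrier_vec dP" "\<pi>' \<in> carrier_vec dP" "\<alpha> \<in> carrier_vec dAO" "\<alpha>' \<in> carrier_vec dAO"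
       "\<beta> \<in> carrier_vec dBO" "\<beta>' \<in> carrier_vec dBO" "\<Gamma> \<in> carrier_vec (dAI * dBI)" "\<Gamma>' \<in> carrier_vec (dAI * dBI)"
       "cinner \<alpha> \<alpha>' = 0" "cinner \<beta> \<beta>' = 0" for \<pi> \<alpha> \<beta> \<pi>' \<alpha>' \<beta>' \<Gamma> \<Gamma>'
      using L'[of \<pi> \<pi>' \<alpha> "0\<^sub>v dAO" \<alpha>' \<beta> "0\<^sub>v dBO" \<beta>' \<Gamma> \<Gamma>' "0\<^sub>v dAI" "0\<^sub>v dAI" "0\<^sub>v dBI" "0\<^sub>v dBI"] that
      unfolding AB[OF that(7,8), symmetric] by simp
    have LB: "sesq dBI (\<lambda>b b'. \<Sum>a<dAI. gp \<pi> \<alpha> \<beta> \<pi>' \<alpha>' \<beta>' a b a b') (vconj \<psi>) (vconj \<psi>') = 0"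
      if "\<pi> \<in> carrier_vec dP" "\<pi>' \<in> carrier_vec dP" "\<alpha> \<in> carrier_vec dAO" "\<alpha>' \<in> carrier_vec dAO"
       "\<beta> \<in> carrier_vec dBO" "\<beta>' \<in> carrier_vec dBO" "\<psi> \<in> carrier_vec dBI" "\<psi>' \<in> carrier_vec dBI"
       "cinner \<beta> \<beta>' = 0" for \<pi> \<alpha> \<beta> \<pi>' \<alpha>' \<beta>' \<psi> \<psi>'
      using L'[of \<pi> \<pi>' \<alpha> \<alpha>' "0\<^sub>v dAO" \<beta> "0\<^sub>v dBO" \<beta>' "0\<^sub>v (dAI * dBI)" "0\<^sub>v (dAI * dBI)" "0\<^sub>v dAI" "0\<^sub>v dAI" \<psi> \<psi>'] that 0[OF that(3)]
      unfolding B[OF that(7,8), symmetric] by simp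
    have LA: "sesq dAI (\<lambda>a a'. \<Sum>b<dBI. gp \<pi> \<alpha> \<beta> \<pi>' \<alpha>' \<beta>' a b a' b) (vconj \<phi>) (vconj \<phi>') = 0"
      if "\<pi> \<in> carrier_vec dP" "\<pi>' \<in> carrier_vec dP" "\<alpha> \<in> carrier_vec dAO" "\<alpha>' \<in> carrier_vec dAO"
       "\<beta> \<in> carrier_vec dBO" "\<beta>' \<in> carrier_vec dBO" "\<phi> \<in> carrier_vec dAI" "\<phi>' \<in> carrier_vec dAI"
       "cinner \<alpha> \<alpha>' = 0" for \<pi> \<alpha> \<beta> \<pi>' \<alpha>' \<beta>' \<phi> \<phi>'
      using L'[of \<pi> \<pi>' \<alpha> "0\<^sub>v dAO" \<alpha>' \<beta> \<beta>' "0\<^sub>v dBO" "0\<^sub>v (dAI * dBI)" "0\<^sub>v (dAI * dBI)" \<phi> \<phi>' "0\<^sub>v dBI" "0\<^sub>v dBI"] that 0[OF that(5)]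
      unfolding A[OF that(7,8), symmetric] by simp
    have "slot_cond_AB dP dAI dAO dBI dBO g"
      unfolding slot_cond_AB_def
    proof (intro allI impI)
      fix a b p x y a' b' p' x' y'
      assume i: "a < dAI" "b < dBI" "p < dP" "x < dAO" "y < dBO" "a' < dAI" "b' < dBI" "p' < dP" "x' < dAO" "y' < dBO"
      have "\<forall>v\<in>carrier_vec dAO. \<forall>w\<in>carrier_vec dAO. \<forall>v'\<in>carrier_vec dBO. \<forall>w'\<in>carrier_vec dBO.
        cinner v w = 0 \<and> cinner v' w' = 0 \<longrightarrow>
        sesq dAO (\<lambda>x x'. sesq dBO (\<lambda>y y'. g a b p x y a' b' p' x' y') v' w') v w = 0"
      proof (intro ballI impI)
        fix v w v' w' :: "complex vec"
        assume c: "v \<in> carrier_vec dAO" "w \<in> carrier_vec dAO" "v' \<in> carrier_vec dBO" "w' \<in> carrier_vec dBO"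
          "cinner v w = 0 \<and> cinner v' w' = 0"
        have k: "a * dBI + b < dAI * dBI" "a' * dBI + b' < dAI * dBI" using i by (simp_all add: mult_add_less)
        show "sesq dAO (\<lambda>x x'. sesq dBO (\<lambda>y y'. g a b p x y a' b' p' x' y') v' w') v w = 0"
        proof -
          have "sesq (dAI * dBI) (\<lambda>i i'. gp (unit_vec dP p) v v' (unit_vec dP p') w w' (i div dBI) (i mod dBI) (i' div dBI) (i' mod dBI))
              (vconj (unit_vec (dAI * dBI) (a * dBI + b))) (vconj (unit_vec (dAI * dBI) (a' * dBI + b'))) = 0"
            by (rule LAB) (use c in auto)
          moreover have "(a * dBI + b) div dBI = a" "(a * dBI + b) mod dBI = b"
            "(a' * dBI + b') div dBI = a'" "(a' * dBI + b') mod dBI = b'" using i by simp_all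
          ultimately show ?thesis
            unfolding cu sesq_unit_vec[OF k] using gp_unit_p[of p p'] i by simp
        qed
      qed
      from this[unfolded sesq_orthogonal2_iff[OF pos], rule_format, OF i(4,9,5,10)]
      show "g a b p x y a' b' p' x' y' = (if x = x' then g a b p 0 y a' b' p' 0 y' else 0)
        + (if y = y' then g a b p x 0 a' b' p' x' 0 else 0)
        - (if x = x' \<and> y = y' then g a b p 0 0 a' b' p' 0 0 else 0)" .
    qed
    moreover have "slot_cond_B dP dAI dAO dBI dBO g"
      unfolding slot_cond_B_def
    proof (intro allI impI)
      fix b p x y b' p' x' y'
      assume i: "b < dBI" "p < dP" "x < dAO" "y < dBO" "b' < dBI" "p' < dP" "x' < dAO" "y' < dBO"
      have "\<forall>v\<in>carrier_vec dBO. \<forall>w\<in>carrier_vec dBO. cinner v w = 0 \<longrightarrow>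
        sesq dBO (\<lambda>y y'. \<Sum>a<dAI. g a b p x y a b' p' x' y') v w = 0"
      proof (intro ballI impI)
        fix v w :: "complex vec"
        assume c: "v \<in> carrier_vec dBO" "w \<in> carrier_vec dBO" "cinner v w = 0"
        show "sesq dBO (\<lambda>y y'. \<Sum>a<dAI. g a b p x y a b' p' x' y') v w = 0"
        proof -
          have "sesq dBI (\<lambda>b b'. \<Sum>a<dAI. gp (unit_vec dP p) (unit_vec dAO x) v (unit_vec dP p') (unit_vec dAO x') w a b a b')
              (vconj (unit_vec dBI b)) (vconj (unit_vec dBI b')) = 0"
            by (rule LB) (use c in auto)
          then show ?thesis
            unfolding cu sesq_unit_vec[OF i(1,5)] gp_unit_p[OF i(2,6)] sesq_unit_vec[OF i(3,7)] sesq_sum .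
        qed
      qed
      from this[unfolded sesq_orthogonal_iff[OF pos(2)], rule_format, OF i(4,8)]
      show "(\<Sum>a<dAI. g a b p x y a b' p' x' y') = (if y = y' then \<Sum>a<dAI. g a b p x 0 a b' p' x' 0 else 0)" .
    qed
    moreover have "slot_cond_A dP dAI dAO dBI dBO g"
      unfolding slot_cond_A_def
    proof (intro allI impI)
      fix a p x y a' p' x' y'
      assume i: "a < dAI" "p < dP" "x < dAO" "y < dBO" "a' < dAI" "p' < dP" "x' < dAO" "y' < dBO"
      have "\<forall>v\<in>carrier_vec dAO. \<forall>w\<in>carrier_vec dAO. cinner v w = 0 \<longrightarrow>
        sesq dAO (\<lambda>x x'. \<Sum>b<dBI. g a b p x y a' b p' x' y') v w = 0"
      proof (intro ballI impI)
        fix v w :: "complex vec"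
        assume c: "v \<in> carrier_vec dAO" "w \<in> carrier_vec dAO" "cinner v w = 0"
        show "sesq dAO (\<lambda>x x'. \<Sum>b<dBI. g a b p x y a' b p' x' y') v w = 0"
        proof -
          have "sesq dAI (\<lambda>a a'. \<Sum>b<dBI. gp (unit_vec dP p) v (unit_vec dBO y) (unit_vec dP p') w (unit_vec dBO y') a b a' b)
              (vconj (unit_vec dAI a)) (vconj (unit_vec dAI a')) = 0"
            by (rule LA) (use c in auto)
          then show ?thesis
            unfolding cu sesq_unit_vec[OF i(1,5)] gp_unit_p[OF i(2,6)] sesq_unit_vec[OF i(4,8)] sesq_sum .
        qed
      qed
      from this[unfolded sesq_orthogonal_iff[OF pos(1)], rule_format, OF i(3,7)]
      show "(\<Sum>b<dBI. g a b p x y a' b p' x' y') = (if x = x' then \<Sum>b<dBI. g a b p 0 y a' b p' 0 y' else 0)" .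
    qed
    ultimately show ?R by (simp add: slot_conds_def g_def)
  next
    assume ?R
    then have RAB: "slot_cond_AB dP dAI dAO dBI dBO g" and RB: "slot_cond_B dP dAI dAO dBI dBO g"
      and RA: "slot_cond_A dP dAI dAO dBI dBO g" by (simp_all add: slot_conds_def g_def)
    have sAB: "gp \<pi> \<alpha> \<beta> \<pi>' \<alpha>' \<beta>' a b a' b' = 0"
      if c: "\<alpha> \<in> carrier_vec dAO" "\<alpha>' \<in> carrier_vec dAO" "\<beta> \<in> carrier_vec dBO" "\<beta>' \<in> carrier_vec dBO"
        "cinner \<alpha> \<alpha>' = 0" "cinner \<beta> \<beta>' = 0" and i: "a < dAI" "b < dBI" "a' < dAI" "b' < dBI"
      for \<pi> \<alpha> \<beta> \<pi>' \<alpha>' \<beta>' a b a' b'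
      unfolding gp
    proof (rule sesq_zero)
      fix p p' assume p: "p < dP" "p' < dP"
      have "\<forall>x<dAO. \<forall>x'<dAO. \<forall>y<dBO. \<forall>y'<dBO. g a b p x y a' b' p' x' y'
        = (if x = x' then g a b p 0 y a' b' p' 0 y' else 0)
        + (if y = y' then g a b p x 0 a' b' p' x' 0 else 0)
        - (if x = x' \<and> y = y' then g a b p 0 0 a' b' p' 0 0 else 0)"
        by (intro allI impI RAB[unfolded slot_cond_AB_def, rule_format] i p)
      from sesq_orthogonal2_iff[OF pos, of "\<lambda>x x' y y'. g a b p x y a' b' p' x' y'", THEN iffD2, OF this,
          rule_format, OF c(1-4) conjI[OF c(5,6)]]
      show "sesq dAO (\<lambda>x x'. sesq dBO (\<lambda>y y'. g a b p x y a' b' p' x' y') \<beta> \<beta>') \<alpha> \<alpha>' = 0" .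
    qed
    have sB: "(\<Sum>a<dAI. gp \<pi> \<alpha> \<beta> \<pi>' \<alpha>' \<beta>' a b a b') = 0"
      if c: "\<beta> \<in> carrier_vec dBO" "\<beta>' \<in> carrier_vec dBO" "cinner \<beta> \<beta>' = 0" and i: "b < dBI" "b' < dBI"
      for \<pi> \<alpha> \<beta> \<pi>' \<alpha>' \<beta>' b b'
      unfolding gp sesq_sum[symmetric]
    proof (rule sesq_zero, rule sesq_zero)
      fix p p' x x' assume p: "p < dP" "p' < dP" "x < dAO" "x' < dAO"
      have "\<forall>y<dBO. \<forall>y'<dBO. (\<Sum>a<dAI. g a b p x y a b' p' x' y')
        = (if y = y' then \<Sum>a<dAI. g a b p x 0 a b' p' x' 0 else 0)"
        by (intro allI impI RB[unfolded slot_cond_B_def, rule_format] i p)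
      from sesq_orthogonal_iff[OF pos(2), of "\<lambda>y y'. \<Sum>a<dAI. g a b p x y a b' p' x' y'", THEN iffD2, OF this,
          rule_format, OF c]
      show "sesq dBO (\<lambda>y y'. \<Sum>a<dAI. g a b p x y a b' p' x' y') \<beta> \<beta>' = 0" .
    qed
    have sA: "(\<Sum>b<dBI. gp \<pi> \<alpha> \<beta> \<pi>' \<alpha>' \<beta>' a b a' b) = 0"
      if c: "\<alpha> \<in> carrier_vec dAO" "\<alpha>' \<in> carrier_vec dAO" "cinner \<alpha> \<alpha>' = 0" and i: "a < dAI" "a' < dAI"
      for \<pi> \<alpha> \<beta> \<pi>' \<alpha>' \<beta>' a a'
    proof -
      \<comment> \<open>The sum over \<open>b\<close> and the form in B_O are pushed inside, so that
        the criterion can be applied in A_O with the vectors of B_O held fixed.\<close>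
      have "sesq dP (\<lambda>p p'. sesq dAO (\<lambda>x x'. sesq dBO (\<lambda>y y'. \<Sum>b<dBI. g a b p x y a' b p' x' y') \<beta> \<beta>') \<alpha> \<alpha>') \<pi> \<pi>' = 0"
      proof (rule sesq_zero)
        fix p p' assume p: "p < dP" "p' < dP"
        have "\<forall>x<dAO. \<forall>x'<dAO. sesq dBO (\<lambda>y y'. \<Sum>b<dBI. g a b p x y a' b p' x' y') \<beta> \<beta>'
          = (if x = x' then sesq dBO (\<lambda>y y'. \<Sum>b<dBI. g a b p 0 y a' b p' 0 y') \<beta> \<beta>' else 0)"
        proof (intro allI impI)
          fix x x' assume x: "x < dAO" "x' < dAO"
          have "sesq dBO (\<lambda>y y'. \<Sum>b<dBI. g a b p x y a' b p' x' y') \<beta> \<beta>'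
            = sesq dBO (\<lambda>y y'. if x = x' then \<Sum>b<dBI. g a b p 0 y a' b p' 0 y' else 0) \<beta> \<beta>'"
            by (intro sesq_cong RA[unfolded slot_cond_A_def, rule_format] i p x)
          then show "sesq dBO (\<lambda>y y'. \<Sum>b<dBI. g a b p x y a' b p' x' y') \<beta> \<beta>'
          = (if x = x' then sesq dBO (\<lambda>y y'. \<Sum>b<dBI. g a b p 0 y a' b p' 0 y') \<beta> \<beta>' else 0)"
            by (cases "x = x'") (simp_all add: sesq_zero)
        qed
        from sesq_orthogonal_iff[OF pos(1), of "\<lambda>x x'. sesq dBO (\<lambda>y y'. \<Sum>b<dBI. g a b p x y a' b p' x' y') \<beta> \<beta>'",
            THEN iffD2, OF this, rule_format, OF c]
        show "sesq dAO (\<lambda>x x'. sesq dBO (\<lambda>y y'. \<Sum>b<dBI. g a b p x y a' b p' x' y') \<beta> \<beta>') \<alpha> \<alpha>' = 0" .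
      qed
      then show ?thesis unfolding gp sesq_sum .
    qed
    show ?L
      unfolding cond2_def Let_def
    proof (intro ballI impI, goal_cases)
      case (1 \<pi> \<pi>' \<alpha> \<alpha>' \<alpha>p \<beta> \<beta>' \<beta>p \<Gamma> \<Gamma>' \<phi> \<phi>' \<psi> \<psi>')
      then have c: "\<alpha> \<in> carrier_vec dAO" "\<alpha>p \<in> carrier_vec dAO" "\<beta> \<in> carrier_vec dBO" "\<beta>p \<in> carrier_vec dBO"
          "cinner \<alpha> \<alpha>p = 0" "cinner \<beta> \<beta>p = 0"
        and \<Gamma>: "\<Gamma> \<in> carrier_vec (dAI * dBI)" "\<Gamma>' \<in> carrier_vec (dAI * dBI)"
        and \<phi>: "\<phi> \<in> carrier_vec dAI" "\<phi>' \<in> carrier_vec dAI"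
        and \<psi>: "\<psi> \<in> carrier_vec dBI" "\<psi>' \<in> carrier_vec dBI" by simp_all
      have d: "i div dBI < dAI" "i mod dBI < dBI" if "i < dAI * dBI" for i
        using that by (auto simp: less_mult_imp_div_less intro!: mod_less_divisor gr0I)
      have "cinner (pin_AB ?ds \<Gamma> (?v \<pi> \<alpha> \<beta>)) (pin_AB ?ds \<Gamma>' (?v \<pi>' \<alpha>p \<beta>p)) = 0"
        unfolding AB[OF \<Gamma>] by (intro sesq_zero sAB c d)
      moreover have "cinner (pin_B ?ds \<psi> (?v \<pi> \<alpha> \<beta>)) (pin_B ?ds \<psi>' (?v \<pi>' \<alpha>' \<beta>p)) = 0"
        unfolding B[OF \<psi>] by (intro sesq_zero sB c)
      moreover have "cinner (pin_A ?ds \<phi> (?v \<pi> \<alpha> \<beta>)) (pin_A ?ds \<phi>' (?v \<pi>' \<alpha>p \<beta>')) = 0"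
        unfolding A[OF \<phi>] by (intro sesq_zero sA c)
      ultimately show ?case by simp
    qed
  qed
qed

section \<open>The link product\<close>

text \<open>The link product over all wires of a Choi operator, whose entries \<open>t\<close> are
  indexed by input and output of the row and then of the column.\<close>

definition contract :: "nat \<Rightarrow> nat \<Rightarrow> (nat \<Rightarrow> nat \<Rightarrow> nat \<Rightarrow> nat \<Rightarrow> complex) \<Rightarrow> (nat \<Rightarrow> nat \<Rightarrow> nat \<Rightarrow> nat \<Rightarrow> complex) \<Rightarrow> complex" where
  "contract dI dO k t = (\<Sum>i<dI. \<Sum>x<dO. \<Sum>i'<dI. \<Sum>x'<dO. k i x i' x' * t i x i' x')"

lemma contract_cong:
  assumes "\<And>i x i' x'. i < dI \<Longrightarrow> x < dO \<Longrightarrow> i' < dI \<Longrightarrow> x' < dO \<Longrightarrow> k i x i' x' * t i x i' x' = k' i x i' x' * t' i x i' x'"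
  shows "contract dI dO k t = contract dI dO k' t'"
  unfolding contract_def using assms by (intro sum.cong) auto

lemma contract_unit:
  assumes "i < dI" "x < dO" "i' < dI" "x' < dO"
  shows "contract dI dO k (\<lambda>j y j' y'. if j = i \<and> y = x \<and> j' = i' \<and> y' = x' then 1 else 0) = k i x i' x'"
proof -
  have "contract dI dO k (\<lambda>j y j' y'. if j = i \<and> y = x \<and> j' = i' \<and> y' = x' then 1 else 0)
      = (\<Sum>j<dI. \<Sum>y<dO. \<Sum>j'<dI. \<Sum>y'<dO. if y' = x' then if j' = i' then if y = x then
           if j = i then k j y j' y' else 0 else 0 else 0 else 0)"
    unfolding contract_def by (intro sum.cong refl) simp
  then show ?thesis using assms by simp
qed

lemma contract_diff: "contract dI dO k (\<lambda>i x i' x'. t i x i' x' - s i x i' x') = contract dI dO k t - contract dI dO k s"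
  unfolding contract_def by (simp add: ring_distribs sum_subtractf)

lemma contract_diff_left: "contract dI dO (\<lambda>i x i' x'. k i x i' x' - l i x i' x') t = contract dI dO k t - contract dI dO l t"
  unfolding contract_def by (simp add: ring_distribs sum_subtractf)

lemma contract_scale: "contract dI dO k (\<lambda>i x i' x'. c * t i x i' x') = c * contract dI dO k t"
  unfolding contract_def by (simp add: sum_distrib_left mult.left_commute)

lemma contract_flat:
  "contract dI dO k (\<lambda>i x i' x'. X (i * dO + x) (i' * dO + x'))
    = (\<Sum>i<dI * dO. \<Sum>j<dI * dO. k (i div dO) (i mod dO) (j div dO) (j mod dO) * X i j)"
  unfolding contract_def sum_lessThan_mult by (intro sum.cong refl) simp

text \<open>Subtracting \<tau> times the maximally mixed channel from \<open>t\<close> leaves a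
  vanishing partial trace, which the functional annihilates. So its value on channels determines it
  on all operators whose partial trace is a multiple of the identity.\<close>

lemma contract_on_channels:
  assumes const: "\<And>J. psd (dI * dO) J \<Longrightarrow> trace_out_id dI dO J \<Longrightarrow>
      contract dI dO k (\<lambda>i x i' x'. J $$ (i * dO + x, i' * dO + x')) = c"
    and "0 < dO"
    and t: "\<And>i i'. i < dI \<Longrightarrow> i' < dI \<Longrightarrow> (\<Sum>x<dO. t i x i' x) = (if i = i' then \<tau> else 0)"
  shows "contract dI dO k t = \<tau> * c"
proof -
  let ?l = "\<lambda>i j. k (i div dO) (i mod dO) (j div dO) (j mod dO)"
  define D where "D i x i' x' = (if i = i' \<and> x = x' then complex_of_real (1 / dO) else 0)" for i x i' x' :: nat
  have L: "contract dI dO k s = 0"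
    if s: "\<And>i i'. i < dI \<Longrightarrow> i' < dI \<Longrightarrow> (\<Sum>x<dO. s i x i' x) = 0" for s
  proof -
    let ?X = "\<lambda>i j. s (i div dO) (i mod dO) (j div dO) (j mod dO)"
    have "contract dI dO k s = contract dI dO k (\<lambda>i x i' x'. ?X (i * dO + x) (i' * dO + x'))"
      by (rule contract_cong) simp
    also have "\<dots> = (\<Sum>i<dI * dO. \<Sum>j<dI * dO. ?l i j * ?X i j)" by (rule contract_flat)
    also have "\<dots> = 0"
    proof (rule functional_constant_on_channels[where c = c, OF _ \<open>0 < dO\<close>])
      fix J assume "psd (dI * dO) J" "trace_out_id dI dO J"
      then show "(\<Sum>i<dI * dO. \<Sum>j<dI * dO. ?l i j * J $$ (i, j)) = c"
        using const contract_flat[of dI dO k "\<lambda>i j. J $$ (i, j)"] by simp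
    next
      fix i i' assume "i < dI" "i' < dI"
      then show "(\<Sum>k<dO. ?X (i * dO + k) (i' * dO + k)) = 0" using s by simp
    qed
    finally show ?thesis .
  qed
  have trD: "(\<Sum>x<dO. D i x i' x) = (if i = i' then 1 else 0)" for i i'
    using \<open>0 < dO\<close> by (simp add: D_def)
  have "contract dI dO k D = c"
  proof -
    let ?J = "mat (dI * dO) (dI * dO) (\<lambda>(i, j). if i = j then complex_of_real (1 / dO) else 0)"
    \<comment> \<open>The zero perturbation: only positivity of the multiple of the identity is
      wanted here.\<close>
    have "psdf (dI * dO) (\<lambda>i j. if i = j then complex_of_real (1 / dO) else 0)"
      by (rule psdf_perturbation[of "dI * dO" "\<lambda>_ _. 0" "1 / dO"]) (use \<open>0 < dO\<close> in simp_all)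
    then have "psdf (dI * dO) (\<lambda>i j. ?J $$ (i, j))"
      by (rule psdf_reindex[where h = id]) auto
    then have psd: "psd (dI * dO) ?J" by (simp add: psd_iff_psdf)
    have e: "i * dO + x = i' * dO + x' \<longleftrightarrow> i = i' \<and> x = x'" if "x < dO" "x' < dO" for i x i' x'
    proof
      assume "i * dO + x = i' * dO + x'"
      then have "(i * dO + x) div dO = (i' * dO + x') div dO" "(i * dO + x) mod dO = (i' * dO + x') mod dO"
        by (simp_all only:)
      then show "i = i' \<and> x = x'" using that by simp
    qed simp
    have J: "?J $$ (i * dO + x, i' * dO + x') = D i x i' x'" if "i < dI" "x < dO" "i' < dI" "x' < dO" for i x i' x'
      using that by (simp add: D_def e mult_add_less)
    then have "trace_out_id dI dO ?J" unfolding trace_out_id_def using trD by (simp add: J)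
    from const[OF psd this] show ?thesis
      using contract_cong[of dI dO k "\<lambda>i x i' x'. ?J $$ (i * dO + x, i' * dO + x')" k D] J by simp
  qed
  moreover have "contract dI dO k (\<lambda>i x i' x'. t i x i' x' - \<tau> * D i x i' x') = 0"
    by (rule L) (simp add: sum_subtractf t trD flip: sum_distrib_left)
  ultimately show ?thesis by (simp add: contract_diff contract_scale)
qed

lemma sum_swap12: "(\<Sum>m\<in>M. \<Sum>q\<in>Q. \<Sum>r\<in>R. h m q r) = (\<Sum>q\<in>Q. \<Sum>r\<in>R. \<Sum>m\<in>M. h m q r)"
  by (subst sum.swap, rule sum.cong[OF refl], rule sum.swap)

lemma sum_swap22:
  "(\<Sum>b\<in>B. \<Sum>y\<in>Y. \<Sum>a\<in>A. \<Sum>x\<in>X. H b y a x) = (\<Sum>a\<in>A. \<Sum>x\<in>X. \<Sum>b\<in>B. \<Sum>y\<in>Y. H b y a x)"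
proof -
  have "(\<Sum>b\<in>B. \<Sum>y\<in>Y. \<Sum>a\<in>A. \<Sum>x\<in>X. H b y a x) = (\<Sum>b\<in>B. \<Sum>a\<in>A. \<Sum>y\<in>Y. \<Sum>x\<in>X. H b y a x)"
    by (rule sum.cong[OF refl], rule sum.swap)
  also have "\<dots> = (\<Sum>a\<in>A. \<Sum>b\<in>B. \<Sum>y\<in>Y. \<Sum>x\<in>X. H b y a x)"
    by (rule sum.swap)
  also have "\<dots> = (\<Sum>a\<in>A. \<Sum>b\<in>B. \<Sum>x\<in>X. \<Sum>y\<in>Y. H b y a x)"
    by (rule sum.cong[OF refl], rule sum.cong[OF refl], rule sum.swap)
  also have "\<dots> = (\<Sum>a\<in>A. \<Sum>x\<in>X. \<Sum>b\<in>B. \<Sum>y\<in>Y. H b y a x)"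
    by (rule sum.cong[OF refl], rule sum.swap)
  finally show ?thesis .
qed

lemma sum_tuples4: "(\<Sum>s\<in>tuples [d1, d2, d3, d4]. F s) = (\<Sum>a<d1. \<Sum>x<d2. \<Sum>b<d3. \<Sum>y<d4. F [a, x, b, y])"
  by (simp add: sum_tuples_Cons)

text \<open>After contraction with tB, the second and the third term of slot_cond_AB cancel by slot_cond_A.\<close>

lemma slot_conds_contract:
  assumes sc: "slot_conds dP dAI dAO dBI dBO G" and p: "p < dP" "p' < dP" and pos: "0 < dAO" "0 < dBO"
    and tA: "\<And>a a'. a < dAI \<Longrightarrow> a' < dAI \<Longrightarrow> (\<Sum>x<dAO. tA a x a' x) = (if a = a' then cA else 0)"
    and tB: "\<And>b b'. b < dBI \<Longrightarrow> b' < dBI \<Longrightarrow> (\<Sum>y<dBO. tB b y b' y) = (if b = b' then cB else 0)"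
  shows "contract dAI dAO (\<lambda>a x a' x'. contract dBI dBO (\<lambda>b y b' y'. G a b p x y a' b' p' x' y') tB) tA
     = cA * cB * (\<Sum>a<dAI. \<Sum>b<dBI. G a b p 0 0 a b p' 0 0)"
proof -
  have sAB: "G a b p x y a' b' p' x' y' =
        (if x = x' then G a b p 0 y a' b' p' 0 y' else 0)
      + (if y = y' then G a b p x 0 a' b' p' x' 0 else 0)
      - (if x = x' \<and> y = y' then G a b p 0 0 a' b' p' 0 0 else 0)"
    if "a < dAI" "b < dBI" "x < dAO" "y < dBO" "a' < dAI" "b' < dBI" "x' < dAO" "y' < dBO" for a b x y a' b' x' y'
    using sc that p unfolding slot_conds_def by (intro slot_cond_AB_def[THEN iffD1, rule_format]) auto
  have sB: "(\<Sum>a<dAI. G a b p x y a b' p' x' y') = (if y = y' then \<Sum>a<dAI. G a b p x 0 a b' p' x' 0 else 0)"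
    if "b < dBI" "x < dAO" "y < dBO" "b' < dBI" "x' < dAO" "y' < dBO" for b x y b' x' y'
    using sc that p unfolding slot_conds_def by (intro slot_cond_B_def[THEN iffD1, rule_format]) auto
  have sA: "(\<Sum>b<dBI. G a b p x y a' b p' x' y') = (if x = x' then \<Sum>b<dBI. G a b p 0 y a' b p' 0 y' else 0)"
    if "a < dAI" "x < dAO" "y < dBO" "a' < dAI" "x' < dAO" "y' < dBO" for a x y a' x' y'
    using sc that p unfolding slot_conds_def by (intro slot_cond_A_def[THEN iffD1, rule_format]) auto
  \<comment> \<open>A kernel proportional to the identity on the output sees \<open>t\<close> only
    through its partial trace.\<close>
  have diag: "contract dI dO (\<lambda>i y i' y'. if y = y' then h i i' else 0) t = c * (\<Sum>i<dI. h i i)"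
    if t: "\<And>i i'. i < dI \<Longrightarrow> i' < dI \<Longrightarrow> (\<Sum>y<dO. t i y i' y) = (if i = i' then c else 0)" for dI dO h t c
  proof -
    have "contract dI dO (\<lambda>i y i' y'. if y = y' then h i i' else 0) t
       = (\<Sum>i<dI. \<Sum>y<dO. \<Sum>i'<dI. h i i' * t i y i' y)"
      unfolding contract_def by (intro sum.cong refl) (simp add: if_distrib[of "\<lambda>z. z * _"] cong: if_cong)
    also have "\<dots> = (\<Sum>i<dI. \<Sum>i'<dI. h i i' * (\<Sum>y<dO. t i y i' y))"
      by (subst sum.swap[of _ "{..<dI}" "{..<dO}"]) (simp add: sum_distrib_left)
    also have "\<dots> = (\<Sum>i<dI. \<Sum>i'<dI. if i' = i then c * h i i else 0)"
      by (intro sum.cong refl) (auto simp: t)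
    finally show ?thesis by (simp add: sum_distrib_left)
  qed
  define h where "h a a' = contract dBI dBO (\<lambda>b y b' y'. G a b p 0 y a' b' p' 0 y') tB" for a a'
  have inner: "contract dBI dBO (\<lambda>b y b' y'. G a b p x y a' b' p' x' y') tB = (if x = x' then h a a' else 0)"
    if i: "a < dAI" "x < dAO" "a' < dAI" "x' < dAO" for a x a' x'
  proof -
    define k1 where "k1 b y b' y' = (if x = x' then G a b p 0 y a' b' p' 0 y' else 0)" for b y b' y'
    define k2 where "k2 b b' = (if x = x' then G a b p 0 0 a' b' p' 0 0 else 0) - G a b p x 0 a' b' p' x' 0" for b b'
    have "contract dBI dBO (\<lambda>b y b' y'. G a b p x y a' b' p' x' y') tB
        = contract dBI dBO (\<lambda>b y b' y'. k1 b y b' y' - (if y = y' then k2 b b' else 0)) tB"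
    proof (rule contract_cong)
      fix b y b' y' assume "b < dBI" "y < dBO" "b' < dBI" "y' < dBO"
      from sAB[OF i(1) this(1) i(2) this(2) i(3) this(3) i(4) this(4)]
      show "G a b p x y a' b' p' x' y' * tB b y b' y' = (k1 b y b' y' - (if y = y' then k2 b b' else 0)) * tB b y b' y'"
        unfolding k1_def k2_def by (cases "x = x'"; cases "y = y'") simp_all
    qed
    also have "\<dots> = contract dBI dBO k1 tB - cB * (\<Sum>b<dBI. k2 b b)"
      by (simp only: contract_diff_left diag[where t = tB and c = cB and dI = dBI and dO = dBO and h = k2, OF tB])
    also have "(\<Sum>b<dBI. k2 b b) = 0"
      unfolding k2_def sum_subtractf sA[OF i(1,2) pos(2) i(3,4) pos(2)] by simp
    also have "contract dBI dBO k1 tB = (if x = x' then h a a' else 0)"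
      by (simp add: k1_def h_def contract_def)
    finally show ?thesis by simp
  qed
  have "contract dAI dAO (\<lambda>a x a' x'. contract dBI dBO (\<lambda>b y b' y'. G a b p x y a' b' p' x' y') tB) tA
     = contract dAI dAO (\<lambda>a x a' x'. if x = x' then h a a' else 0) tA"
    by (rule contract_cong) (simp add: inner)
  also have "\<dots> = cA * (\<Sum>a<dAI. h a a)" by (rule diag[where t = tA and c = cA, OF tA])
  \<comment> \<open>After slot A has been contracted only the trace over A_I survives, and that is
    what \<open>slot_cond_B\<close> controls.\<close>
  also have "(\<Sum>a<dAI. h a a) = contract dBI dBO (\<lambda>b y b' y'. \<Sum>a<dAI. G a b p 0 y a b' p' 0 y') tB"
  proof -
    have "(\<Sum>a<dAI. h a a) = (\<Sum>b<dBI. \<Sum>y<dBO. \<Sum>a<dAI. \<Sum>b'<dBI. \<Sum>y'<dBO. G a b p 0 y a b' p' 0 y' * tB b y b' y')"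
      unfolding h_def contract_def
      by (rule sum_swap12)
    also have "\<dots> = (\<Sum>b<dBI. \<Sum>y<dBO. \<Sum>b'<dBI. \<Sum>y'<dBO. \<Sum>a<dAI. G a b p 0 y a b' p' 0 y' * tB b y b' y')"
      by (rule sum.cong[OF refl], rule sum.cong[OF refl], rule sum_swap12)
    finally show ?thesis by (simp add: contract_def sum_distrib_right)
  qed
  also have "\<dots> = contract dBI dBO (\<lambda>b y b' y'. if y = y' then \<Sum>a<dAI. G a b p 0 0 a b' p' 0 0 else 0) tB"
  proof (rule contract_cong)
    fix b y b' y' assume "b < dBI" "y < dBO" "b' < dBI" "y' < dBO"
    from sB[OF this(1) pos(1) this(2,3) pos(1) this(4)]
    show "(\<Sum>a<dAI. G a b p 0 y a b' p' 0 y') * tB b y b' y'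
        = (if y = y' then \<Sum>a<dAI. G a b p 0 0 a b' p' 0 0 else 0) * tB b y b' y'" by (rule arg_cong)
  qed
  also have "\<dots> = cB * (\<Sum>b<dBI. \<Sum>a<dAI. G a b p 0 0 a b p' 0 0)" by (rule diag[where t = tB and c = cB, OF tB])
  also have "(\<Sum>b<dBI. \<Sum>a<dAI. G a b p 0 0 a b p' 0 0) = (\<Sum>a<dAI. \<Sum>b<dBI. G a b p 0 0 a b p' 0 0)" by (rule sum.swap)
  finally show ?thesis by simp
qed

section \<open>The link product in tensor indices\<close>

lemma enc6: "enc [d1, d2, d3, d4, d5, d6] [p, s, t, f, k, l]
    = ((p * d2 + s) * d3 + t) * (d4 * d5 * d6) + ((f * d5 + k) * d6 + l)"
  by (simp add: algebra_simps)

lemma flat3_less: "p < d1 \<Longrightarrow> s < d2 \<Longrightarrow> t < d3 \<Longrightarrow> (p * d2 + s) * d3 + t < d1 * d2 * (d3::nat)"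
  by (intro mult_add_less)

lemma flat3_cases:
  assumes "i < d1 * d2 * (d3::nat)"
  obtains p s t where "p < d1" "s < d2" "t < d3" "i = (p * d2 + s) * d3 + t"
proof -
  have i: "i < prod_list [d1, d2, d3]" using assms by (simp add: mult.assoc)
  obtain p s t where "dec [d1, d2, d3] i = [p, s, t]" by simp
  with enc_dec[OF i] have "enc [d1, d2, d3] [p, s, t] = i" "[p, s, t] \<in> tuples [d1, d2, d3]" by (simp_all only:)
  then show ?thesis by (intro that[of p s t]) (simp_all only: enc3 Cons_in_tuples)
qed

lemma flat2_eq_iff:
  assumes "k < n" "l < (n::nat)"
  shows "i * n + k = j * n + l \<longleftrightarrow> i = j \<and> k = l"
proof
  assume "i * n + k = j * n + l"
  then have "(i * n + k) div n = (j * n + l) div n" "(i * n + k) mod n = (j * n + l) mod n"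
    by (simp_all only:)
  then show "i = j \<and> k = l" using assms by simp
qed simp

lemma choivecU_index:
  assumes "p < dP" "a < dAI" "x < dAO" "b < dBI" "y < dBO" "f < dF"
  shows "choivecU [dP, dAI, dAO, dBI, dBO, dF] U $ enc [dP, dAI, dAO, dBI, dBO, dF] [p, a, x, b, y, f]
    = uent dAO dBI dBO dF U a b f p x y"
proof -
  let ?ds = "[dP, dAI, dAO, dBI, dBO, dF]" and ?x = "[p, a, x, b, y, f]"
  have t: "?x \<in> tuples ?ds" using assms by simp
  have n: "?ds ! 0 = dP" "?ds ! 1 = dAI" "?ds ! 2 = dAO" "?ds ! 3 = dBI" "?ds ! 4 = dBO" "?ds ! 5 = dF"
    "?x ! 0 = p" "?x ! 1 = a" "?x ! 2 = x" "?x ! 3 = b" "?x ! 4 = y" "?x ! 5 = f" by simp_all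
  show ?thesis
    unfolding choivecU_def index_vec[OF enc_less[OF t]] dec_enc[OF t] Let_def n enc3 uent_def ..
qed

lemma repW_index:
  assumes "p < dP" "a < dAI" "x < dAO" "b < dBI" "y < dBO" "f < dF"
    and "p' < dP" "a' < dAI" "x' < dAO" "b' < dBI" "y' < dBO" "f' < dF"
  shows "repW [dP, dAI, dAO, dBI, dBO, dF] U $$
      (enc [dP, dAI, dAO, dBI, dBO, dF] [p, a, x, b, y, f], enc [dP, dAI, dAO, dBI, dBO, dF] [p', a', x', b', y', f'])
    = uent dAO dBI dBO dF U a b f p x y * cnj (uent dAO dBI dBO dF U a' b' f' p' x' y')"
proof -
  let ?ds = "[dP, dAI, dAO, dBI, dBO, dF]"
  have "enc ?ds [p, a, x, b, y, f] < prod_list ?ds" "enc ?ds [p', a', x', b', y', f'] < prod_list ?ds"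
    using assms by (intro enc_less; simp)+
  then show ?thesis
    unfolding repW_def using assms by (simp add: choivecU_index del: enc.simps prod_list.Cons)
qed

lemma link_index:
  assumes X: "p < dP" "s < a1" "t < b1" "f < dF" "k < a2" "l < b2"
    and Y: "p' < dP" "s' < a1" "t' < b1" "f' < dF" "k' < a2" "l' < b2"
  shows "link [dP, dAI, dAO, dBI, dBO, dF] a1 a2 b1 b2 (repW [dP, dAI, dAO, dBI, dBO, dF] U) EA EB $$
      (((p * a1 + s) * b1 + t) * (dF * a2 * b2) + ((f * a2 + k) * b2 + l),
       ((p' * a1 + s') * b1 + t') * (dF * a2 * b2) + ((f' * a2 + k') * b2 + l'))
    = (\<Sum>q\<in>tuples [dAI, dAO, dBI, dBO]. \<Sum>r\<in>tuples [dAI, dAO, dBI, dBO].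
        uent dAO dBI dBO dF U (q!0) (q!2) f p (q!1) (q!3) * cnj (uent dAO dBI dBO dF U (r!0) (r!2) f' p' (r!1) (r!3))
        * EA $$ ((q!0 * a1 + s) * (dAO * a2) + (q!1 * a2 + k), (r!0 * a1 + s') * (dAO * a2) + (r!1 * a2 + k'))
        * EB $$ ((q!2 * b1 + t) * (dBO * b2) + (q!3 * b2 + l), (r!2 * b1 + t') * (dBO * b2) + (r!3 * b2 + l')))"
proof -
  let ?ds = "[dP, dAI, dAO, dBI, dBO, dF]" and ?dso = "[dP, a1, b1, dF, a2, b2]"
  let ?x = "[p, s, t, f, k, l]" and ?y = "[p', s', t', f', k', l']"
  have tx: "?x \<in> tuples ?dso" and ty: "?y \<in> tuples ?dso" using X Y by simp_all
  have n: "?ds ! 0 = dP" "?ds ! 1 = dAI" "?ds ! 2 = dAO" "?ds ! 3 = dBI" "?ds ! 4 = dBO" "?ds ! 5 = dF"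
    "?x ! 0 = p" "?x ! 1 = s" "?x ! 2 = t" "?x ! 3 = f" "?x ! 4 = k" "?x ! 5 = l"
    "?y ! 0 = p'" "?y ! 1 = s'" "?y ! 2 = t'" "?y ! 3 = f'" "?y ! 4 = k'" "?y ! 5 = l'" by simp_all
  show ?thesis
    unfolding enc6[symmetric, of p a1 s b1 t dF a2 b2 f k l dP] enc6[symmetric, of p' a1 s' b1 t' dF a2 b2 f' k' l' dP]
    unfolding link_def Let_def n index_mat(1)[OF enc_less[OF tx] enc_less[OF ty]] prod.case dec_enc[OF tx] dec_enc[OF ty] enc4
  proof (intro sum.cong refl)
    fix q r assume "q \<in> tuples [dAI, dAO, dBI, dBO]" "r \<in> tuples [dAI, dAO, dBI, dBO]"
    then have "q!0 < dAI" "q!1 < dAO" "q!2 < dBI" "q!3 < dBO" "r!0 < dAI" "r!1 < dAO" "r!2 < dBI" "r!3 < dBO"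
      by (auto simp: tuples_Cons)
    then show "repW ?ds U $$ (enc ?ds [p, q!0, q!1, q!2, q!3, f], enc ?ds [p', r!0, r!1, r!2, r!3, f'])
        * EA $$ ((q!0 * a1 + s) * (dAO * a2) + (q!1 * a2 + k), (r!0 * a1 + s') * (dAO * a2) + (r!1 * a2 + k'))
        * EB $$ ((q!2 * b1 + t) * (dBO * b2) + (q!3 * b2 + l), (r!2 * b1 + t') * (dBO * b2) + (r!3 * b2 + l'))
      = uent dAO dBI dBO dF U (q!0) (q!2) f p (q!1) (q!3) * cnj (uent dAO dBI dBO dF U (r!0) (r!2) f' p' (r!1) (r!3))
        * EA $$ ((q!0 * a1 + s) * (dAO * a2) + (q!1 * a2 + k), (r!0 * a1 + s') * (dAO * a2) + (r!1 * a2 + k'))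
        * EB $$ ((q!2 * b1 + t) * (dBO * b2) + (q!3 * b2 + l), (r!2 * b1 + t') * (dBO * b2) + (r!3 * b2 + l'))"
      using X Y by (subst repW_index) simp_all
  qed
qed

text \<open>The Choi vector of \<open>U\<close> linked with the vectors \<open>vA\<close> and
  \<open>vB\<close>: the link product of rank one operators has rank one, and this is its
  vector.\<close>

definition link_vec :: "nat list \<Rightarrow> nat \<Rightarrow> nat \<Rightarrow> nat \<Rightarrow> nat \<Rightarrow> complex mat \<Rightarrow> (nat \<Rightarrow> complex) \<Rightarrow> (nat \<Rightarrow> complex) \<Rightarrow> nat \<Rightarrow> complex" where
  "link_vec ds a1 a2 b1 b2 U vA vB i = (let x = dec [ds!0, a1, b1, ds!5, a2, b2] i in
     \<Sum>q\<in>tuples [ds!1, ds!2, ds!3, ds!4]. uent (ds!2) (ds!3) (ds!4) (ds!5) U (q!0) (q!2) (x!3) (x!0) (q!1) (q!3)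
       * vA ((q!0 * a1 + x!1) * (ds!2 * a2) + (q!1 * a2 + x!4)) * vB ((q!2 * b1 + x!2) * (ds!4 * b2) + (q!3 * b2 + x!5)))"

text \<open>Since |U>><<U| has rank one, sums of rank one operators in the slots give a sum of rank
  one operators over all pairs. For channels this yields positivity, for unitary channels rank
  one.\<close>

lemma link_gram:
  assumes EA: "\<And>i j. i < dAI * a1 * (dAO * a2) \<Longrightarrow> j < dAI * a1 * (dAO * a2) \<Longrightarrow> EA $$ (i, j) = (\<Sum>m\<in>M. vA m i * cnj (vA m j))"
    and EB: "\<And>i j. i < dBI * b1 * (dBO * b2) \<Longrightarrow> j < dBI * b1 * (dBO * b2) \<Longrightarrow> EB $$ (i, j) = (\<Sum>m\<in>N. vB m i * cnj (vB m j))"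
    and ij: "i < dP * a1 * b1 * (dF * a2 * b2)" "j < dP * a1 * b1 * (dF * a2 * b2)"
  shows "link [dP, dAI, dAO, dBI, dBO, dF] a1 a2 b1 b2 (repW [dP, dAI, dAO, dBI, dBO, dF] U) EA EB $$ (i, j)
    = (\<Sum>m\<in>M. \<Sum>n\<in>N. link_vec [dP, dAI, dAO, dBI, dBO, dF] a1 a2 b1 b2 U (vA m) (vB n) i
        * cnj (link_vec [dP, dAI, dAO, dBI, dBO, dF] a1 a2 b1 b2 U (vA m) (vB n) j))"
proof -
  let ?ds = "[dP, dAI, dAO, dBI, dBO, dF]" and ?dso = "[dP, a1, b1, dF, a2, b2]" and ?T = "tuples [dAI, dAO, dBI, dBO]"
  have n: "?ds ! 0 = dP" "?ds ! 1 = dAI" "?ds ! 2 = dAO" "?ds ! 3 = dBI" "?ds ! 4 = dBO" "?ds ! 5 = dF" by simp_all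
  have ex: "\<exists>p s t f k l. p < dP \<and> s < a1 \<and> t < b1 \<and> f < dF \<and> k < a2 \<and> l < b2 \<and>
      i = ((p * a1 + s) * b1 + t) * (dF * a2 * b2) + ((f * a2 + k) * b2 + l) \<and> dec ?dso i = [p, s, t, f, k, l]"
    if "i < dP * a1 * b1 * (dF * a2 * b2)" for i
  proof -
    have i: "i < prod_list ?dso" using that by (simp add: mult.assoc)
    obtain p s t f k l where d: "dec ?dso i = [p, s, t, f, k, l]" by simp
    from enc_dec[OF i] have "enc ?dso [p, s, t, f, k, l] = i" "[p, s, t, f, k, l] \<in> tuples ?dso"
      unfolding d by simp_all
    then show ?thesis unfolding enc6 using d by (simp del: dec_Cons)
  qed
  obtain p s t f k l where X: "p < dP" "s < a1" "t < b1" "f < dF" "k < a2" "l < b2"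
    and i: "i = ((p * a1 + s) * b1 + t) * (dF * a2 * b2) + ((f * a2 + k) * b2 + l)" "dec ?dso i = [p, s, t, f, k, l]"
    using ex[OF ij(1)] by blast
  obtain p' s' t' f' k' l' where Y: "p' < dP" "s' < a1" "t' < b1" "f' < dF" "k' < a2" "l' < b2"
    and j: "j = ((p' * a1 + s') * b1 + t') * (dF * a2 * b2) + ((f' * a2 + k') * b2 + l')" "dec ?dso j = [p', s', t', f', k', l']"
    using ex[OF ij(2)] by blast
  define A where "A m q = vA m ((q!0 * a1 + s) * (dAO * a2) + (q!1 * a2 + k))" for m q
  define A' where "A' m q = vA m ((q!0 * a1 + s') * (dAO * a2) + (q!1 * a2 + k'))" for m q
  define B where "B m q = vB m ((q!2 * b1 + t) * (dBO * b2) + (q!3 * b2 + l))" for m q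
  define B' where "B' m q = vB m ((q!2 * b1 + t') * (dBO * b2) + (q!3 * b2 + l'))" for m q
  define u where "u q = uent dAO dBI dBO dF U (q!0) (q!2) f p (q!1) (q!3)" for q
  define u' where "u' q = uent dAO dBI dBO dF U (q!0) (q!2) f' p' (q!1) (q!3)" for q
  have g: "link_vec ?ds a1 a2 b1 b2 U (vA m) (vB n) i = (\<Sum>q\<in>?T. u q * A m q * B n q)" for m n
    unfolding link_vec_def n i(2) Let_def u_def A_def B_def by simp
  have g': "link_vec ?ds a1 a2 b1 b2 U (vA m) (vB n) j = (\<Sum>q\<in>?T. u' q * A' m q * B' n q)" for m n
    unfolding link_vec_def n j(2) Let_def u'_def A'_def B'_def by simp
  have "link ?ds a1 a2 b1 b2 (repW ?ds U) EA EB $$ (i, j) = (\<Sum>q\<in>?T. \<Sum>r\<in>?T. u q * cnj (u' r)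
      * (\<Sum>m\<in>M. A m q * cnj (A' m r)) * (\<Sum>n\<in>N. B n q * cnj (B' n r)))"
    unfolding i(1) j(1) link_index[OF X Y] u_def u'_def A_def A'_def B_def B'_def
  proof (intro sum.cong refl arg_cong2[where f = "(*)"] EA EB)
    fix q r assume "q \<in> ?T" "r \<in> ?T"
    then have "q!0 < dAI" "q!1 < dAO" "q!2 < dBI" "q!3 < dBO" "r!0 < dAI" "r!1 < dAO" "r!2 < dBI" "r!3 < dBO"
      by (auto simp: tuples_Cons)
    then show "(q!0 * a1 + s) * (dAO * a2) + (q!1 * a2 + k) < dAI * a1 * (dAO * a2)"
      "(r!0 * a1 + s') * (dAO * a2) + (r!1 * a2 + k') < dAI * a1 * (dAO * a2)"
      "(q!2 * b1 + t) * (dBO * b2) + (q!3 * b2 + l) < dBI * b1 * (dBO * b2)"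
      "(r!2 * b1 + t') * (dBO * b2) + (r!3 * b2 + l') < dBI * b1 * (dBO * b2)"
      using X Y by (simp_all add: mult_add_less)
  qed
  also have "\<dots> = (\<Sum>q\<in>?T. \<Sum>r\<in>?T. \<Sum>m\<in>M. \<Sum>n\<in>N. (u q * A m q * B n q) * cnj (u' r * A' m r * B' n r))"
    by (intro sum.cong refl) (simp add: sum_distrib_left sum_distrib_right mult_ac)
  also have "\<dots> = (\<Sum>m\<in>M. \<Sum>n\<in>N. \<Sum>q\<in>?T. \<Sum>r\<in>?T. (u q * A m q * B n q) * cnj (u' r * A' m r * B' n r))"
    by (rule sum_swap22)
  also have "\<dots> = (\<Sum>m\<in>M. \<Sum>n\<in>N. link_vec ?ds a1 a2 b1 b2 U (vA m) (vB n) i * cnj (link_vec ?ds a1 a2 b1 b2 U (vA m) (vB n) j))"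
    unfolding g g' cnj_sum sum_product ..
  finally show ?thesis .
qed

lemma gram_cnj: "gram dF u a' b' p' x' y' a b p x y = cnj (gram dF u a b p x y a' b' p' x' y')"
  by (simp add: gram_def mult.commute)

text \<open>Tracing out F turns |U>><<U| into the conjugate of the Gram kernel, conjugate because
  |U>><<U| conjugates its column index. Tracing out the auxiliary outputs reduces each Choi operator
  to the slot itself, with the auxiliary inputs left as parameters.\<close>

lemma link_trace:
  assumes X: "p < dP" "s < a1" "t < b1" and Y: "p' < dP" "s' < a1" "t' < b1"
  shows "(\<Sum>j<dF * a2 * b2. link [dP, dAI, dAO, dBI, dBO, dF] a1 a2 b1 b2 (repW [dP, dAI, dAO, dBI, dBO, dF] U) EA EB $$
      (((p * a1 + s) * b1 + t) * (dF * a2 * b2) + j, ((p' * a1 + s') * b1 + t') * (dF * a2 * b2) + j))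
    = contract dAI dAO (\<lambda>a x a' x'. contract dBI dBO (\<lambda>b y b' y'. cnj (gram dF (uent dAO dBI dBO dF U) a b p x y a' b' p' x' y'))
         (\<lambda>b y b' y'. \<Sum>l<b2. EB $$ ((b * b1 + t) * (dBO * b2) + (y * b2 + l), (b' * b1 + t') * (dBO * b2) + (y' * b2 + l))))
         (\<lambda>a x a' x'. \<Sum>k<a2. EA $$ ((a * a1 + s) * (dAO * a2) + (x * a2 + k), (a' * a1 + s') * (dAO * a2) + (x' * a2 + k)))"
proof -
  let ?ds = "[dP, dAI, dAO, dBI, dBO, dF]" and ?T = "tuples [dAI, dAO, dBI, dBO]"
  let ?u = "uent dAO dBI dBO dF U"
  define A where "A a x a' x' k = EA $$ ((a * a1 + s) * (dAO * a2) + (x * a2 + k), (a' * a1 + s') * (dAO * a2) + (x' * a2 + k))" for a x a' x' k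
  define B where "B b y b' y' l = EB $$ ((b * b1 + t) * (dBO * b2) + (y * b2 + l), (b' * b1 + t') * (dBO * b2) + (y' * b2 + l))" for b y b' y' l
  define uu where "uu q r f = ?u (q!0) (q!2) f p (q!1) (q!3) * cnj (?u (r!0) (r!2) f p' (r!1) (r!3))" for q r f
  define g where "g a x b y a' x' b' y' = cnj (gram dF ?u a b p x y a' b' p' x' y')" for a x b y a' x' b' y'
  have "(\<Sum>j<dF * a2 * b2. link ?ds a1 a2 b1 b2 (repW ?ds U) EA EB $$
      (((p * a1 + s) * b1 + t) * (dF * a2 * b2) + j, ((p' * a1 + s') * b1 + t') * (dF * a2 * b2) + j))
    = (\<Sum>f<dF. \<Sum>k<a2. \<Sum>l<b2. \<Sum>q\<in>?T. \<Sum>r\<in>?T. uu q r f * A (q!0) (q!1) (r!0) (r!1) k * B (q!2) (q!3) (r!2) (r!3) l)"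
    unfolding sum_lessThan_mult[of _ "dF * a2" b2] sum_lessThan_mult[of _ dF a2] uu_def A_def B_def
  proof (intro sum.cong refl)
    fix f k l assume "f \<in> {..<dF}" "k \<in> {..<a2}" "l \<in> {..<b2}"
    then have f: "f < dF" "k < a2" "l < b2" by auto
    show "link ?ds a1 a2 b1 b2 (repW ?ds U) EA EB $$
      (((p * a1 + s) * b1 + t) * (dF * a2 * b2) + ((f * a2 + k) * b2 + l), ((p' * a1 + s') * b1 + t') * (dF * a2 * b2) + ((f * a2 + k) * b2 + l))
     = (\<Sum>q\<in>?T. \<Sum>r\<in>?T. ?u (q!0) (q!2) f p (q!1) (q!3) * cnj (?u (r!0) (r!2) f p' (r!1) (r!3))
        * EA $$ ((q!0 * a1 + s) * (dAO * a2) + (q!1 * a2 + k), (r!0 * a1 + s') * (dAO * a2) + (r!1 * a2 + k))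
        * EB $$ ((q!2 * b1 + t) * (dBO * b2) + (q!3 * b2 + l), (r!2 * b1 + t') * (dBO * b2) + (r!3 * b2 + l)))"
      by (rule link_index[OF X f Y f])
  qed
  also have "\<dots> = (\<Sum>f<dF. \<Sum>k<a2. \<Sum>q\<in>?T. \<Sum>r\<in>?T. \<Sum>l<b2. uu q r f * A (q!0) (q!1) (r!0) (r!1) k * B (q!2) (q!3) (r!2) (r!3) l)"
    by (rule sum.cong[OF refl], rule sum.cong[OF refl], rule sum_swap12)
  also have "\<dots> = (\<Sum>f<dF. \<Sum>q\<in>?T. \<Sum>r\<in>?T. \<Sum>k<a2. \<Sum>l<b2. uu q r f * A (q!0) (q!1) (r!0) (r!1) k * B (q!2) (q!3) (r!2) (r!3) l)"
    by (rule sum.cong[OF refl], rule sum_swap12)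
  also have "\<dots> = (\<Sum>q\<in>?T. \<Sum>r\<in>?T. \<Sum>f<dF. \<Sum>k<a2. \<Sum>l<b2. uu q r f * A (q!0) (q!1) (r!0) (r!1) k * B (q!2) (q!3) (r!2) (r!3) l)"
    by (rule sum_swap12)
  also have "\<dots> = (\<Sum>q\<in>?T. \<Sum>r\<in>?T. g (q!0) (q!1) (q!2) (q!3) (r!0) (r!1) (r!2) (r!3) * (\<Sum>l<b2. B (q!2) (q!3) (r!2) (r!3) l) * (\<Sum>k<a2. A (q!0) (q!1) (r!0) (r!1) k))"
  proof (intro sum.cong refl)
    fix q r
    have "g (q!0) (q!1) (q!2) (q!3) (r!0) (r!1) (r!2) (r!3) = (\<Sum>f<dF. uu q r f)"
      by (simp add: g_def gram_def uu_def)
    then show "(\<Sum>f<dF. \<Sum>k<a2. \<Sum>l<b2. uu q r f * A (q!0) (q!1) (r!0) (r!1) k * B (q!2) (q!3) (r!2) (r!3) l)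
      = g (q!0) (q!1) (q!2) (q!3) (r!0) (r!1) (r!2) (r!3) * (\<Sum>l<b2. B (q!2) (q!3) (r!2) (r!3) l) * (\<Sum>k<a2. A (q!0) (q!1) (r!0) (r!1) k)"
      by (simp flip: sum_distrib_left sum_distrib_right)
  qed
  also have "\<dots> = (\<Sum>a<dAI. \<Sum>x<dAO. \<Sum>b<dBI. \<Sum>y<dBO. \<Sum>a'<dAI. \<Sum>x'<dAO. \<Sum>b'<dBI. \<Sum>y'<dBO.
      g a x b y a' x' b' y' * (\<Sum>l<b2. B b y b' y' l) * (\<Sum>k<a2. A a x a' x' k))"
    unfolding sum_tuples4 by simp
  also have "\<dots> = (\<Sum>a<dAI. \<Sum>x<dAO. \<Sum>a'<dAI. \<Sum>x'<dAO. \<Sum>b<dBI. \<Sum>y<dBO. \<Sum>b'<dBI. \<Sum>y'<dBO.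
      g a x b y a' x' b' y' * (\<Sum>l<b2. B b y b' y' l) * (\<Sum>k<a2. A a x a' x' k))"
    by (rule sum.cong[OF refl], rule sum.cong[OF refl], rule sum_swap22)
  finally show ?thesis
    unfolding contract_def sum_distrib_right by (simp only: g_def A_def B_def)
qed

section \<open>From the orthogonality conditions to pure superchannels\<close>

lemma slot_conds_cnj:
  assumes "slot_conds dP dAI dAO dBI dBO G"
  shows "slot_conds dP dAI dAO dBI dBO (\<lambda>a b p x y a' b' p' x' y'. cnj (G a b p x y a' b' p' x' y'))"
proof -
  have AB: "slot_cond_AB dP dAI dAO dBI dBO G" and B: "slot_cond_B dP dAI dAO dBI dBO G"
    and A: "slot_cond_A dP dAI dAO dBI dBO G" using assms by (simp_all add: slot_conds_def)
  have c: "(if P then cnj z else 0) = cnj (if P then z else 0)" for P z by simp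
  show ?thesis
    unfolding slot_conds_def slot_cond_AB_def slot_cond_B_def slot_cond_A_def
      cnj_sum[symmetric] c complex_cnj_add[symmetric] complex_cnj_diff[symmetric]
    by (intro conjI allI impI arg_cong[where f = cnj] AB[unfolded slot_cond_AB_def, rule_format]
        B[unfolded slot_cond_B_def, rule_format] A[unfolded slot_cond_A_def, rule_format])
qed

text \<open>For fixed auxiliary inputs the reduced Choi operator of a slot has partial trace 1 or 0
  times the identity, according to whether these inputs agree. So auxiliary spaces appear only as
  the constants \<open>cA\<close> and \<open>cB\<close> of
  \<open>slot_conds_contract\<close>.\<close>

lemma link_trace_out_id:
  assumes sc: "slot_conds dP dAI dAO dBI dBO (gram dF (uent dAO dBI dBO dF U))" and pos: "0 < dAO" "0 < dBO"
    and nrm: "\<And>p p'. p < dP \<Longrightarrow> p' < dP \<Longrightarrow> (\<Sum>a<dAI. \<Sum>b<dBI. gram dF (uent dAO dBI dBO dF U) a b p 0 0 a b p' 0 0) = (if p = p' then 1 else 0)"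
    and EA: "trace_out_id (dAI * a1) (dAO * a2) EA" and EB: "trace_out_id (dBI * b1) (dBO * b2) EB"
  shows "trace_out_id (dP * a1 * b1) (dF * a2 * b2)
    (link [dP, dAI, dAO, dBI, dBO, dF] a1 a2 b1 b2 (repW [dP, dAI, dAO, dBI, dBO, dF] U) EA EB)"
  unfolding trace_out_id_def
proof (intro allI impI)
  fix i i' assume "i < dP * a1 * b1" "i' < dP * a1 * b1"
  then obtain p s t p' s' t' where X: "p < dP" "s < a1" "t < b1" and i: "i = (p * a1 + s) * b1 + t"
    and Y: "p' < dP" "s' < a1" "t' < b1" and i': "i' = (p' * a1 + s') * b1 + t'"
    by (elim flat3_cases)
  let ?tB = "\<lambda>b y b' y'. \<Sum>l<b2. EB $$ ((b * b1 + t) * (dBO * b2) + (y * b2 + l), (b' * b1 + t') * (dBO * b2) + (y' * b2 + l))"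
  let ?tA = "\<lambda>a x a' x'. \<Sum>k<a2. EA $$ ((a * a1 + s) * (dAO * a2) + (x * a2 + k), (a' * a1 + s') * (dAO * a2) + (x' * a2 + k))"
  have tA: "(\<Sum>x<dAO. ?tA a x a' x) = (if a = a' then if s = s' then 1 else 0 else 0)" if "a < dAI" "a' < dAI" for a a'
    using EA[unfolded trace_out_id_def, rule_format, of "a * a1 + s" "a' * a1 + s'"] that X Y
    unfolding sum_lessThan_mult by (simp add: mult_add_less flat2_eq_iff)
  have tB: "(\<Sum>y<dBO. ?tB b y b' y) = (if b = b' then if t = t' then 1 else 0 else 0)" if "b < dBI" "b' < dBI" for b b'
    using EB[unfolded trace_out_id_def, rule_format, of "b * b1 + t" "b' * b1 + t'"] that X Y
    unfolding sum_lessThan_mult by (simp add: mult_add_less flat2_eq_iff)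
  have nrm': "(\<Sum>a<dAI. \<Sum>b<dBI. cnj (gram dF (uent dAO dBI dBO dF U) a b p 0 0 a b p' 0 0)) = cnj (if p = p' then 1 else 0)"
    unfolding cnj_sum[symmetric] nrm[OF X(1) Y(1)] ..
  have "contract dAI dAO (\<lambda>a x a' x'. contract dBI dBO (\<lambda>b y b' y'. cnj (gram dF (uent dAO dBI dBO dF U) a b p x y a' b' p' x' y')) ?tB) ?tA
      = (if s = s' then 1 else 0) * (if t = t' then 1 else 0)
        * (\<Sum>a<dAI. \<Sum>b<dBI. cnj (gram dF (uent dAO dBI dBO dF U) a b p 0 0 a b p' 0 0))"
    by (rule slot_conds_contract[where tA = ?tA and tB = ?tB, OF slot_conds_cnj[OF sc] X(1) Y(1) pos tA tB])
  then show "(\<Sum>k<dF * a2 * b2. link [dP, dAI, dAO, dBI, dBO, dF] a1 a2 b1 b2 (repW [dP, dAI, dAO, dBI, dBO, dF] U) EA EB $$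
      (i * (dF * a2 * b2) + k, i' * (dF * a2 * b2) + k)) = (if i = i' then 1 else 0)"
    unfolding i i' link_trace[OF X Y] nrm' using X Y by (simp add: flat2_eq_iff)
qed

lemma link_carrier:
  "link [dP, dAI, dAO, dBI, dBO, dF] a1 a2 b1 b2 W EA EB
    \<in> carrier_mat (dP * a1 * b1 * (dF * a2 * b2)) (dP * a1 * b1 * (dF * a2 * b2))"
  by (simp add: link_def mult.assoc)

text \<open>Complete positivity of the output comes from the rank one decomposition
  \<open>link_gram\<close>, trace preservation from the conditions through
  \<open>link_trace_out_id\<close>.\<close>

lemma superchannel_repW:
  assumes sc: "slot_conds dP dAI dAO dBI dBO (gram dF (uent dAO dBI dBO dF U))" and pos: "0 < dAO" "0 < dBO"
    and nrm: "\<And>p p'. p < dP \<Longrightarrow> p' < dP \<Longrightarrow> (\<Sum>a<dAI. \<Sum>b<dBI. gram dF (uent dAO dBI dBO dF U) a b p 0 0 a b p' 0 0) = (if p = p' then 1 else 0)"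
  shows "superchannel [dP, dAI, dAO, dBI, dBO, dF] (repW [dP, dAI, dAO, dBI, dBO, dF] U)"
proof -
  let ?ds = "[dP, dAI, dAO, dBI, dBO, dF]"
  have n: "?ds ! 0 = dP" "?ds ! 1 = dAI" "?ds ! 2 = dAO" "?ds ! 3 = dBI" "?ds ! 4 = dBO" "?ds ! 5 = dF" by simp_all
  have "\<exists>G. cptp (dP * a1 * b1) (dF * a2 * b2) G \<and> choi (dP * a1 * b1) (dF * a2 * b2) G =
      link ?ds a1 a2 b1 b2 (repW ?ds U) (choi (dAI * a1) (dAO * a2) EA) (choi (dBI * b1) (dBO * b2) EB)"
    if A: "cptp (dAI * a1) (dAO * a2) EA" and B: "cptp (dBI * b1) (dBO * b2) EB" for a1 a2 b1 b2 EA EB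
  proof -
    let ?L = "link ?ds a1 a2 b1 b2 (repW ?ds U) (choi (dAI * a1) (dAO * a2) EA) (choi (dBI * b1) (dBO * b2) EB)"
    let ?N = "dP * a1 * b1 * (dF * a2 * b2)"
    obtain vA where vA: "\<And>i j. i < dAI * a1 * (dAO * a2) \<Longrightarrow> j < dAI * a1 * (dAO * a2) \<Longrightarrow>
        choi (dAI * a1) (dAO * a2) EA $$ (i, j) = (\<Sum>k<dAI * a1 * (dAO * a2). vA k i * cnj (vA k j))"
      using psd_decomp[OF psd_choi[OF A]] by blast
    obtain vB where vB: "\<And>i j. i < dBI * b1 * (dBO * b2) \<Longrightarrow> j < dBI * b1 * (dBO * b2) \<Longrightarrow>
        choi (dBI * b1) (dBO * b2) EB $$ (i, j) = (\<Sum>k<dBI * b1 * (dBO * b2). vB k i * cnj (vB k j))"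
      using psd_decomp[OF psd_choi[OF B]] by blast
    have "psdf ?N (\<lambda>i j. ?L $$ (i, j))"
    proof (rule psdfI_gram[of "{..<dAI * a1 * (dAO * a2)} \<times> {..<dBI * b1 * (dBO * b2)}" _ _
          "\<lambda>mn. link_vec ?ds a1 a2 b1 b2 U (vA (fst mn)) (vB (snd mn))"])
      fix i j assume ij: "i < ?N" "j < ?N"
      show "?L $$ (i, j) = (\<Sum>mn\<in>{..<dAI * a1 * (dAO * a2)} \<times> {..<dBI * b1 * (dBO * b2)}.
          link_vec ?ds a1 a2 b1 b2 U (vA (fst mn)) (vB (snd mn)) i * cnj (link_vec ?ds a1 a2 b1 b2 U (vA (fst mn)) (vB (snd mn)) j))"
        using link_gram[where vA = vA and vB = vB and U = U, OF vA vB ij]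
        by (simp only: sum.cartesian_product case_prod_unfold)
    qed simp
    then have "psd ?N ?L" using link_carrier by (simp add: psd_iff_psdf)
    moreover have "trace_out_id (dP * a1 * b1) (dF * a2 * b2) ?L"
      by (rule link_trace_out_id[OF sc pos nrm trace_out_id_choi[OF A] trace_out_id_choi[OF B]])
    ultimately show ?thesis using cptp_from_choi by metis
  qed
  then show ?thesis unfolding superchannel_def n by blast
qed

lemma choi_uchan_gram:
  assumes "V \<in> carrier_mat dO dI" "i < dI * dO" "j < dI * dO"
  shows "choi dI dO (uchan V) $$ (i, j) = V $$ (i mod dO, i div dO) * cnj (V $$ (j mod dO, j div dO))"
proof -
  have "0 < dO" using assms by (cases dO) auto
  then show ?thesis
    using choi_uchan_index[OF assms(1), of "i div dO" "i mod dO" "j div dO" "j mod dO"] assms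
    by (simp add: less_mult_imp_div_less)
qed

lemma trace_out_id_choi_uchan:
  assumes V: "V \<in> carrier_mat dO dI" "unitary_mat V"
  shows "trace_out_id dI dO (choi dI dO (uchan V))"
  unfolding trace_out_id_def
proof (intro allI impI)
  fix i i' assume i: "i < dI" "i' < dI"
  have "(\<Sum>k<dO. choi dI dO (uchan V) $$ (i * dO + k, i' * dO + k)) = (\<Sum>k<dO. cnj (V $$ (k, i')) * V $$ (k, i))"
    using i by (intro sum.cong refl) (simp add: choi_uchan_index[OF V(1)])
  then show "(\<Sum>k<dO. choi dI dO (uchan V) $$ (i * dO + k, i' * dO + k)) = (if i = i' then 1 else 0)"
    unfolding unitary_mat_cols(2)[OF V i(2,1)] by simp
qed

text \<open>With unitary channels in the slots the link product is v v^* for a single vector.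
  Reshaped to a matrix, v is an isometry by trace preservation, and equal dimensions make it
  unitary.\<close>

lemma pure_supermap_repW:
  assumes sc: "slot_conds dP dAI dAO dBI dBO (gram dF (uent dAO dBI dBO dF U))"
    and pos: "0 < dAI" "0 < dAO" "0 < dBI" "0 < dBO"
    and nrm: "\<And>p p'. p < dP \<Longrightarrow> p' < dP \<Longrightarrow> (\<Sum>a<dAI. \<Sum>b<dBI. gram dF (uent dAO dBI dBO dF U) a b p 0 0 a b p' 0 0) = (if p = p' then 1 else 0)"
    and dims: "dAI * dBI * dF = dP * dAO * dBO"
  shows "pure_supermap [dP, dAI, dAO, dBI, dBO, dF] (repW [dP, dAI, dAO, dBI, dBO, dF] U)"
proof -
  let ?ds = "[dP, dAI, dAO, dBI, dBO, dF]"
  have n: "?ds ! 0 = dP" "?ds ! 1 = dAI" "?ds ! 2 = dAO" "?ds ! 3 = dBI" "?ds ! 4 = dBO" "?ds ! 5 = dF" by simp_all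
  have "\<exists>V. V \<in> carrier_mat (dF * a2 * b2) (dP * a1 * b1) \<and> unitary_mat V \<and>
      choi (dP * a1 * b1) (dF * a2 * b2) (uchan V) =
      link ?ds a1 a2 b1 b2 (repW ?ds U) (choi (dAI * a1) (dAO * a2) (uchan VA)) (choi (dBI * b1) (dBO * b2) (uchan VB))"
    if A: "VA \<in> carrier_mat (dAO * a2) (dAI * a1)" "unitary_mat VA"
     and B: "VB \<in> carrier_mat (dBO * b2) (dBI * b1)" "unitary_mat VB" for a1 a2 b1 b2 VA VB
  proof -
    let ?L = "link ?ds a1 a2 b1 b2 (repW ?ds U) (choi (dAI * a1) (dAO * a2) (uchan VA)) (choi (dBI * b1) (dBO * b2) (uchan VB))"
    let ?M = "dF * a2 * b2" and ?I = "dP * a1 * b1"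
    \<comment> \<open>The extra factor \<open>dAI * dBI\<close> allows the dimension equations of
      \<open>VA\<close>, \<open>VB\<close> and \<open>U\<close> to be inserted in turn; it is
      cancelled at the end because the input dimensions are positive.\<close>
    have "dAI * dBI * (dP * a1 * b1) = dP * (dAI * a1) * (dBI * b1)" by simp
    also have "\<dots> = dP * (dAO * a2) * (dBO * b2)"
      by (simp only: unitary_mat_cols(1)[OF A] unitary_mat_cols(1)[OF B])
    also have "\<dots> = dP * dAO * dBO * (a2 * b2)" by simp
    also have "\<dots> = dAI * dBI * (dF * a2 * b2)" unfolding dims[symmetric] by simp
    finally have sq: "?I = ?M" using pos by simp
    define v where "v = link_vec ?ds a1 a2 b1 b2 U (\<lambda>i. VA $$ (i mod (dAO * a2), i div (dAO * a2))) (\<lambda>i. VB $$ (i mod (dBO * b2), i div (dBO * b2)))"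
    have L: "?L $$ (i, j) = v i * cnj (v j)" if "i < ?I * ?M" "j < ?I * ?M" for i j
      using link_gram[where M = "{0::nat}" and N = "{0::nat}" and vA = "\<lambda>_ i. VA $$ (i mod (dAO * a2), i div (dAO * a2))"
         and vB = "\<lambda>_ i. VB $$ (i mod (dBO * b2), i div (dBO * b2))", OF _ _ that, of dAI dAO _ dBI dBO _ U]
      by (simp add: choi_uchan_gram[OF A(1)] choi_uchan_gram[OF B(1)] v_def)
    define V where "V = mat ?M ?I (\<lambda>(k, i). v (i * ?M + k))"
    have V: "V \<in> carrier_mat ?M ?I" by (simp add: V_def)
    have tr: "trace_out_id ?I ?M ?L"
      by (rule link_trace_out_id[OF sc pos(2,4) nrm trace_out_id_choi_uchan[OF A] trace_out_id_choi_uchan[OF B]])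
    have "unitary_mat V"
    proof (rule unitary_matI)
      show "V \<in> carrier_mat ?M ?M" using V sq by simp
      fix j j' assume j: "j < ?M" "j' < ?M"
      then have jI: "j < ?I" "j' < ?I" using sq by simp_all
      have "(\<Sum>k<?M. cnj (V $$ (k, j)) * V $$ (k, j')) = (\<Sum>k<?M. ?L $$ (j' * ?M + k, j * ?M + k))"
      proof (intro sum.cong refl)
        fix k assume "k \<in> {..<?M}"
        then have k: "k < ?M" by simp
        have "V $$ (k, j) = v (j * ?M + k)" "V $$ (k, j') = v (j' * ?M + k)"
          unfolding V_def using k jI by simp_all
        moreover have "?L $$ (j' * ?M + k, j * ?M + k) = v (j' * ?M + k) * cnj (v (j * ?M + k))"
          by (intro L mult_add_less jI k)
        ultimately show "cnj (V $$ (k, j)) * V $$ (k, j') = ?L $$ (j' * ?M + k, j * ?M + k)"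
          by (simp only: mult.commute)
      qed
      then show "(\<Sum>k<?M. cnj (V $$ (k, j)) * V $$ (k, j')) = (if j = j' then 1 else 0)"
        using tr[unfolded trace_out_id_def, rule_format, OF jI(2,1)] by auto
    qed
    moreover have "choi ?I ?M (uchan V) = ?L"
    proof (rule eq_matI)
      fix i j assume "i < dim_row ?L" "j < dim_col ?L"
      then have ij: "i < ?I * ?M" "j < ?I * ?M" unfolding carrier_matD[OF link_carrier] by simp_all
      have Ve: "V $$ (i mod ?M, i div ?M) = v i" if "i < ?I * ?M" for i
      proof -
        have "0 < ?M" using that by (cases "?M = 0") auto
        then have "i mod ?M < ?M" by (rule mod_less_divisor)
        moreover have "i div ?M < ?I" using that by (rule less_mult_imp_div_less)
        ultimately have "V $$ (i mod ?M, i div ?M) = v (i div ?M * ?M + i mod ?M)"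
          unfolding V_def by (simp only: index_mat(1) prod.case)
        then show ?thesis by (simp only: div_mult_mod_eq)
      qed
      show "choi ?I ?M (uchan V) $$ (i, j) = ?L $$ (i, j)"
        by (simp only: L[OF ij] choi_uchan_gram[OF V ij] Ve[OF ij(1)] Ve[OF ij(2)])
    qed (simp_all add: choi_def carrier_matD[OF link_carrier])
    ultimately show ?thesis using V by blast
  qed
  then show ?thesis unfolding pure_supermap_def n by blast
qed

section \<open>From superchannels back to the orthogonality conditions\<close>

lemma contract_swap:
  "contract dI dO (\<lambda>a x a' x'. contract eI eO (K a x a' x') s) t
    = contract eI eO (\<lambda>b y b' y'. contract dI dO (\<lambda>a x a' x'. K a x a' x' b y b' y') t) s"
proof -
  have c: "contract dI dO k t = (\<Sum>q\<in>tuples [dI, dO, dI, dO]. k (q!0) (q!1) (q!2) (q!3) * t (q!0) (q!1) (q!2) (q!3))"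
    for dI dO k t unfolding contract_def sum_tuples4 by simp
  show ?thesis
    unfolding c sum_distrib_right by (subst sum.swap) (simp add: mult_ac)
qed

text \<open>Channels without auxiliary systems suffice: the traced link product is bilinear in the
  two Choi operators and therefore known on all pairs whose partial traces are multiples of the
  identity. These include test operators that extract single entries of the Gram kernel.\<close>

lemma superchannel_imp_slot_conds:
  assumes super: "superchannel [dP, dAI, dAO, dBI, dBO, dF] (repW [dP, dAI, dAO, dBI, dBO, dF] U)"
    and pos: "0 < dAO" "0 < dBO"
  shows "slot_conds dP dAI dAO dBI dBO (gram dF (uent dAO dBI dBO dF U))"
proof -
  let ?ds = "[dP, dAI, dAO, dBI, dBO, dF]"
  have n: "?ds ! 0 = dP" "?ds ! 1 = dAI" "?ds ! 2 = dAO" "?ds ! 3 = dBI" "?ds ! 4 = dBO" "?ds ! 5 = dF" by simp_all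
  define g where "g a b p x y a' b' p' x' y' = cnj (gram dF (uent dAO dBI dBO dF U) a b p x y a' b' p' x' y')" for a b p x y a' b' p' x' y'
  define bil where "bil p p' tA tB = contract dAI dAO (\<lambda>a x a' x'. contract dBI dBO (\<lambda>b y b' y'. g a b p x y a' b' p' x' y') tB) tA"
    for p p' tA tB
  have base: "bil p p' (\<lambda>a x a' x'. JA $$ (a * dAO + x, a' * dAO + x')) (\<lambda>b y b' y'. JB $$ (b * dBO + y, b' * dBO + y')) = (if p = p' then 1 else 0)"
    if p: "p < dP" "p' < dP" and A: "psd (dAI * dAO) JA" "trace_out_id dAI dAO JA"
      and B: "psd (dBI * dBO) JB" "trace_out_id dBI dBO JB" for p p' JA JB
  proof -
    obtain EA where EA: "cptp dAI dAO EA" "choi dAI dAO EA = JA" using cptp_from_choi[OF A] .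
    obtain EB where EB: "cptp dBI dBO EB" "choi dBI dBO EB = JB" using cptp_from_choi[OF B] .
    obtain G where G: "cptp (dP * 1 * 1) (dF * 1 * 1) G"
      "choi (dP * 1 * 1) (dF * 1 * 1) G = link ?ds 1 1 1 1 (repW ?ds U) (choi (dAI * 1) (dAO * 1) EA) (choi (dBI * 1) (dBO * 1) EB)"
      using super[unfolded superchannel_def n, rule_format, of 1 1 1 1 EA EB] EA EB by auto
    have "trace_out_id (dP * 1 * 1) (dF * 1 * 1) (link ?ds 1 1 1 1 (repW ?ds U) JA JB)"
      using trace_out_id_choi[OF G(1)] G(2) EA EB by simp
    then have "(\<Sum>k<dF. link ?ds 1 1 1 1 (repW ?ds U) JA JB $$ (p * dF + k, p' * dF + k)) = (if p = p' then 1 else 0)"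
      using p by (simp add: trace_out_id_def)
    then show ?thesis
      using link_trace[where s = 0 and t = 0 and s' = 0 and t' = 0 and ?a1.0 = 1 and ?b1.0 = 1 and ?a2.0 = 1 and ?b2.0 = 1
        and dF = dF and dAI = dAI and dAO = dAO and dBI = dBI and dBO = dBO and U = U and EA = JA and EB = JB, OF p(1) _ _ p(2)]
      by (simp add: bil_def g_def)
  qed
  \<comment> \<open>Extension from channels to general operators, one slot at a time: A is extended
    with B held at a channel, and then B is extended.\<close>
  have bil: "bil p p' tA tB = \<sigma> * (\<tau> * (if p = p' then 1 else 0))"
    if p: "p < dP" "p' < dP"
    and tA: "\<And>a a'. a < dAI \<Longrightarrow> a' < dAI \<Longrightarrow> (\<Sum>x<dAO. tA a x a' x) = (if a = a' then \<tau> else 0)"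
    and tB: "\<And>b b'. b < dBI \<Longrightarrow> b' < dBI \<Longrightarrow> (\<Sum>y<dBO. tB b y b' y) = (if b = b' then \<sigma> else 0)"
    for p p' tA tB \<tau> \<sigma>
  proof -
    have *: "bil p p' tA (\<lambda>b y b' y'. JB $$ (b * dBO + y, b' * dBO + y')) = \<tau> * (if p = p' then 1 else 0)"
      if B: "psd (dBI * dBO) JB" "trace_out_id dBI dBO JB" for JB
      unfolding bil_def
      by (rule contract_on_channels[where t = tA and \<tau> = \<tau>, OF _ pos(1) tA], fold bil_def, rule base[OF p _ _ B])
    show ?thesis
      unfolding bil_def contract_swap[of dAI dAO dBI dBO _ tB tA]
      by (rule contract_on_channels[where t = tB and \<tau> = \<sigma>, OF _ pos(2) tB], unfold contract_swap[of dBI dBO dAI dAO _ tA], fold bil_def, rule *)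
  qed
  \<comment> \<open>The matrix unit |a><a'| on the input with |x><x'| on the output, made traceless
    on the output by subtracting |0><0| if x = x'.\<close>
  define tst where "tst a x a' x' i z i' z' = (if i = a \<and> z = x \<and> i' = a' \<and> z' = x' then 1 else 0)
      - (if x = x' then 1 else 0) * (if i = a \<and> z = 0 \<and> i' = a' \<and> z' = 0 then 1 else (0::complex))"
    for a x a' x' i z i' z' :: nat
  have tst_trace: "(\<Sum>z<d. tst a x a' x' i z i' z) = (if i = i' then 0 else 0)" if "x < d" "x' < d" for a x a' x' i i' d
  proof -
    have "(\<Sum>z<d. if i = a \<and> z = x \<and> i' = a' \<and> z = x' then 1 else 0) = (if i = a \<and> i' = a' \<and> x = x' then 1 else (0::complex))"
      if "x < d" for x x'
    proof -
      have "(\<Sum>z<d. if i = a \<and> z = x \<and> i' = a' \<and> z = x' then 1 else 0)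
        = (\<Sum>z<d. if z = x then if i = a \<and> i' = a' \<and> x = x' then 1 else 0 else (0::complex))"
        by (intro sum.cong refl) auto
      then show ?thesis using that by simp
    qed
    from this[of x x'] this[of 0 0] that show ?thesis
      unfolding tst_def sum_subtractf sum_distrib_left[symmetric] by auto
  qed
  have tst_contract: "contract dI dO k (tst a x a' x') = k a x a' x' - (if x = x' then 1 else 0) * k a 0 a' 0"
    if "a < dI" "x < dO" "a' < dI" "x' < dO" for dI dO k a x a' x'
  proof -
    have "0 < dO" using that by simp
    then show ?thesis
      unfolding tst_def contract_diff contract_scale using that by (simp only: contract_unit)
  qed
  \<comment> \<open>The identity on the input with |y><y'| on the output: pairing with it traces out
    the input of the slot.\<close>
  define dg where "dg y y' i z i' z' = (if i = i' \<and> z = y \<and> z' = y' then 1 else (0::complex))" for y y' i z i' z' :: nat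
  have dg_trace: "(\<Sum>z<d. dg y y' i z i' z) = (if i = i' then if y = y' then 1 else 0 else 0)" if "y < d" for d y y' i i'
  proof -
    have "(\<Sum>z<d. dg y y' i z i' z) = (\<Sum>z<d. if z = y then if i = i' \<and> y = y' then 1 else 0 else 0)"
      unfolding dg_def by (intro sum.cong refl) auto
    then show ?thesis using that by auto
  qed
  have dg_contract: "contract dI dO k (dg y y') = (\<Sum>i<dI. k i y i y')" if "y < dO" "y' < dO" for dI dO k y y'
  proof -
    have "contract dI dO k (dg y y') = (\<Sum>i<dI. \<Sum>z<dO. \<Sum>i'<dI. \<Sum>z'<dO. if z' = y' then if i' = i then if z = y then k i z i' z' else 0 else 0 else 0)"
      unfolding contract_def dg_def by (intro sum.cong refl) simp
    then show ?thesis using that by simp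
  qed
  have "slot_cond_AB dP dAI dAO dBI dBO g"
    unfolding slot_cond_AB_def
  proof (intro allI impI)
    fix a b p x y a' b' p' x' y'
    assume i: "a < dAI" "b < dBI" "p < dP" "x < dAO" "y < dBO" "a' < dAI" "b' < dBI" "p' < dP" "x' < dAO" "y' < dBO"
    \<comment> \<open>Both test operators have vanishing partial trace, so the functional is 0;
      expanding the two subtractions gives the four terms of \<open>slot_cond_AB\<close>.\<close>
    have "bil p p' (tst a x a' x') (tst b y b' y') = 0 * (0 * (if p = p' then 1 else 0))"
      by (rule bil[where tA = "tst a x a' x'" and tB = "tst b y b' y'" and \<tau> = 0 and \<sigma> = 0,
          OF i(3,8) tst_trace[OF i(4,9)] tst_trace[OF i(5,10)]])
    then have "g a b p x y a' b' p' x' y' - (if y = y' then 1 else 0) * g a b p x 0 a' b' p' x' 0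
      - (if x = x' then 1 else 0) * (g a b p 0 y a' b' p' 0 y' - (if y = y' then 1 else 0) * g a b p 0 0 a' b' p' 0 0) = 0"
      unfolding bil_def tst_contract[OF i(1,4,6,9)] tst_contract[OF i(2,5,7,10)] by simp
    then show "g a b p x y a' b' p' x' y' = (if x = x' then g a b p 0 y a' b' p' 0 y' else 0)
        + (if y = y' then g a b p x 0 a' b' p' x' 0 else 0)
        - (if x = x' \<and> y = y' then g a b p 0 0 a' b' p' 0 0 else 0)"
      by (cases "x = x'"; cases "y = y'") (simp_all add: algebra_simps)
  qed
  moreover have "slot_cond_B dP dAI dAO dBI dBO g"
    unfolding slot_cond_B_def
  proof (intro allI impI)
    fix b p x y b' p' x' y'
    assume i: "b < dBI" "p < dP" "x < dAO" "y < dBO" "b' < dBI" "p' < dP" "x' < dAO" "y' < dBO"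
    have "bil p p' (dg x x') (tst b y b' y') = 0 * ((if x = x' then 1 else 0) * (if p = p' then 1 else 0))"
      by (rule bil[where tA = "dg x x'" and tB = "tst b y b' y'" and \<tau> = "if x = x' then 1 else 0" and \<sigma> = 0,
          OF i(2,6) dg_trace[OF i(3)] tst_trace[OF i(4,8)]])
    then have "(\<Sum>a<dAI. g a b p x y a b' p' x' y' - (if y = y' then 1 else 0) * g a b p x 0 a b' p' x' 0) = 0"
      unfolding bil_def dg_contract[OF i(3,7)] tst_contract[OF i(1,4,5,8)] by simp
    then show "(\<Sum>a<dAI. g a b p x y a b' p' x' y') = (if y = y' then \<Sum>a<dAI. g a b p x 0 a b' p' x' 0 else 0)"
      unfolding sum_subtractf by (cases "y = y'") simp_all
  qed
  moreover have "slot_cond_A dP dAI dAO dBI dBO g"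
    unfolding slot_cond_A_def
  proof (intro allI impI)
    fix a p x y a' p' x' y'
    assume i: "a < dAI" "p < dP" "x < dAO" "y < dBO" "a' < dAI" "p' < dP" "x' < dAO" "y' < dBO"
    have "bil p p' (tst a x a' x') (dg y y') = (if y = y' then 1 else 0) * (0 * (if p = p' then 1 else 0))"
      by (rule bil[where tA = "tst a x a' x'" and tB = "dg y y'" and \<tau> = 0 and \<sigma> = "if y = y' then 1 else 0",
          OF i(2,6) tst_trace[OF i(3,7)] dg_trace[OF i(4)]])
    then have "(\<Sum>b<dBI. g a b p x y a' b p' x' y') - (if x = x' then 1 else 0) * (\<Sum>b<dBI. g a b p 0 y a' b p' 0 y') = 0"
      unfolding bil_def dg_contract[OF i(4,8)] tst_contract[OF i(1,3,5,7)] by simp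
    then show "(\<Sum>b<dBI. g a b p x y a' b p' x' y') = (if x = x' then \<Sum>b<dBI. g a b p 0 y a' b p' 0 y' else 0)"
      by (cases "x = x'") simp_all
  qed
  ultimately have "slot_conds dP dAI dAO dBI dBO g" by (simp add: slot_conds_def)
  from slot_conds_cnj[OF this] show ?thesis by (simp add: g_def)
qed

section \<open>Adapted orthonormal bases\<close>

lemma unitary_mat_mult:
  assumes A: "A \<in> carrier_mat n n" "unitary_mat A" and B: "B \<in> carrier_mat n n" "unitary_mat B"
  shows "unitary_mat (A * B)"
proof (rule unitary_matI)
  show "A * B \<in> carrier_mat n n" using A B by simp
  fix j j' assume j: "j < n" "j' < n"
  have AB: "(A * B) $$ (i, j) = (\<Sum>k<n. B $$ (k, j) * A $$ (i, k))" if "i < n" "j < n" for i j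
    using that A B by (auto simp: scalar_prod_def lessThan_atLeast0 mult.commute intro!: sum.cong)
  have "(\<Sum>i<n. cnj ((A * B) $$ (i, j)) * (A * B) $$ (i, j'))
      = (\<Sum>i<n. cnj (\<Sum>k<n. B $$ (k, j) * A $$ (i, k)) * (\<Sum>l<n. B $$ (l, j') * A $$ (i, l)))"
    by (intro sum.cong refl) (simp only: AB j lessThan_iff)
  also have "\<dots> = (\<Sum>k<n. \<Sum>l<n. cnj (B $$ (k, j)) * B $$ (l, j') * (\<Sum>i<n. cnj (A $$ (i, k)) * A $$ (i, l)))"
    by (rule sum_cnj_prod_combination)
  also have "\<dots> = (\<Sum>k<n. \<Sum>l<n. if l = k then cnj (B $$ (k, j)) * B $$ (l, j') else 0)"
    by (intro sum.cong refl) (auto simp: unitary_mat_cols(2)[OF A])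
  also have "\<dots> = (if j = j' then 1 else 0)"
    using unitary_mat_cols(2)[OF B j] by simp
  finally show "(\<Sum>i<n. cnj ((A * B) $$ (i, j)) * (A * B) $$ (i, j')) = (if j = j' then 1 else 0)" .
qed

lemma sum_delta_mult:
  fixes f :: "nat \<Rightarrow> complex"
  assumes "i < n"
  shows "(\<Sum>l<n. (if i = l then 1 else 0) * f l) = f i" and "(\<Sum>l<n. (if l = i then 1 else 0) * f l) = f i"
    and "(\<Sum>l<n. f l * (if i = l then 1 else 0)) = f i" and "(\<Sum>l<n. f l * (if l = i then 1 else 0)) = f i"
proof -
  have "(\<Sum>l<n. if l = i then f l else 0) = f i" using assms by simp
  moreover have "(\<Sum>l<n. (if i = l then 1 else 0) * f l) = (\<Sum>l<n. if l = i then f l else 0)"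
    "(\<Sum>l<n. (if l = i then 1 else 0) * f l) = (\<Sum>l<n. if l = i then f l else 0)"
    "(\<Sum>l<n. f l * (if i = l then 1 else 0)) = (\<Sum>l<n. if l = i then f l else 0)"
    "(\<Sum>l<n. f l * (if l = i then 1 else 0)) = (\<Sum>l<n. if l = i then f l else 0)"
    by (intro sum.cong refl; simp)+
  ultimately show "(\<Sum>l<n. (if i = l then 1 else 0) * f l) = f i" "(\<Sum>l<n. (if l = i then 1 else 0) * f l) = f i"
    "(\<Sum>l<n. f l * (if i = l then 1 else 0)) = f i" "(\<Sum>l<n. f l * (if l = i then 1 else 0)) = f i" by simp_all
qed

text \<open>The reflection along w = x + \<theta> r e_k, with r the norm of x, carries e_k to a
  multiple of x. Since x vanishes below \<open>k\<close>, so does w, and the first \<open>k\<close>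
  basis vectors stay fixed.\<close>

lemma householder:
  fixes x :: "nat \<Rightarrow> complex"
  assumes k: "k < n" and low: "\<And>j. j < k \<Longrightarrow> x j = 0" and nz: "\<exists>j<n. x j \<noteq> 0"
  obtains H c where "H \<in> carrier_mat n n" "unitary_mat H" "c \<noteq> 0"
    "\<And>i j. i < n \<Longrightarrow> j < k \<Longrightarrow> H $$ (i, j) = (if i = j then 1 else 0)"
    "\<And>i. i < n \<Longrightarrow> x i = c * H $$ (i, k)"
proof -
  define N where "N = (\<Sum>j<n. (cmod (x j))\<^sup>2)"
  have N0: "0 < N"
  proof -
    obtain j where "j < n" "x j \<noteq> 0" using nz by blast
    then have "0 < (cmod (x j))\<^sup>2" "(cmod (x j))\<^sup>2 \<le> N"
      unfolding N_def by (auto intro!: member_le_sum)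
    then show ?thesis by linarith
  qed
  define r where "r = sqrt N"
  have r: "0 < r" "r * r = N" using N0 by (simp_all add: r_def)
  \<comment> \<open>The phase of x_k, or 1 if x_k = 0. With it the two terms of \<open>w\<close> do
    not cancel: the overlap of \<open>w\<close> with \<open>x\<close> is N + r |x_k| and stays
    positive.\<close>
  define \<theta> where "\<theta> = (if x k = 0 then 1 else x k / of_real (cmod (x k)))"
  have th: "cnj \<theta> * \<theta> = 1" "cnj \<theta> * x k = of_real (cmod (x k))"
  proof -
    have zz: "cnj (x k) * x k = of_real (cmod (x k)) * of_real (cmod (x k))"
      using complex_norm_square[of "x k"] by (simp add: power2_eq_square mult.commute)
    show "cnj \<theta> * \<theta> = 1" "cnj \<theta> * x k = of_real (cmod (x k))"
      using zz by (cases "x k = 0"; simp add: \<theta>_def)+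
  qed
  have xx: "(\<Sum>j<n. cnj (x j) * x j) = of_real N"
    by (simp add: N_def complex_norm_square mult.commute del: of_real_power)
  define w where "w j = x j + (if j = k then \<theta> * of_real r else 0)" for j
  define m where "m = N + r * cmod (x k)"
  have m0: "0 < m" using N0 r by (simp add: m_def add_pos_nonneg)
  have wx: "(\<Sum>j<n. cnj (w j) * x j) = of_real m"
  proof -
    have "(\<Sum>j<n. cnj (w j) * x j) = (\<Sum>j<n. cnj (x j) * x j + (if j = k then of_real r * (cnj \<theta> * x j) else 0))"
      by (intro sum.cong refl) (simp add: w_def algebra_simps)
    then show ?thesis using k th by (simp add: sum.distrib xx m_def)
  qed
  have ww: "(\<Sum>j<n. cnj (w j) * w j) = of_real (2 * m)"
  proof -
    have "(\<Sum>j<n. cnj (w j) * w j) = (\<Sum>j<n. cnj (w j) * x j + (if j = k then cnj (w j) * (\<theta> * of_real r) else 0))"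
      by (intro sum.cong refl) (simp add: w_def algebra_simps)
    also have "\<dots> = of_real m + cnj (w k) * (\<theta> * of_real r)" using k by (simp add: sum.distrib wx)
    also have "cnj (w k) * (\<theta> * of_real r) = cnj (cnj \<theta> * x k) * of_real r + (cnj \<theta> * \<theta>) * of_real (r * r)"
      by (simp add: w_def algebra_simps)
    also have "\<dots> = of_real m" unfolding th r by (simp add: m_def algebra_simps)
    finally show ?thesis by simp
  qed
  \<comment> \<open>The usual 1 - 2 w w^* / |w|^2, since |w|^2 = 2 m.\<close>
  define H where "H = mat n n (\<lambda>(i, j). (if i = j then 1 else 0) - w i * cnj (w j) / of_real m)"
  have Hij: "H $$ (i, j) = (if i = j then 1 else 0) - w i * cnj (w j) / of_real m" if "i < n" "j < n" for i j
    using that by (simp add: H_def)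
  have "unitary_mat H"
  proof (rule unitary_matI)
    show "H \<in> carrier_mat n n" by (simp add: H_def)
    fix j l assume j: "j < n" "l < n"
    have "(\<Sum>i<n. cnj (H $$ (i, j)) * H $$ (i, l))
      = (\<Sum>i<n. (if i = j then 1 else 0) * (if i = l then 1 else 0) - (if i = j then 1 else 0) * (w i * cnj (w l) / of_real m)
          - (if i = l then 1 else 0) * (cnj (w i) * w j / of_real m) + (cnj (w i) * w i) * (w j * cnj (w l) / (of_real m * of_real m)))"
      by (intro sum.cong refl) (simp add: Hij j algebra_simps)
    also have "\<dots> = (if j = l then 1 else 0) - w j * cnj (w l) / of_real m - cnj (w l) * w j / of_real m
        + of_real (2 * m) * (w j * cnj (w l) / (of_real m * of_real m))"
      unfolding sum.distrib sum_subtractf sum_delta_mult(2)[OF j(1)] sum_delta_mult(2)[OF j(2)] sum_distrib_right[symmetric] ww ..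
    also have "\<dots> = (if j = l then 1 else 0)" using m0 by (simp add: field_simps)
    finally show "(\<Sum>i<n. cnj (H $$ (i, j)) * H $$ (i, l)) = (if j = l then 1 else 0)" .
  qed
  moreover have "x i = (- \<theta> * of_real r) * H $$ (i, k)" if i: "i < n" for i
  proof -
    have wk: "cnj (w k) * (\<theta> * of_real r) = of_real m"
    proof -
      have "cnj (w k) * (\<theta> * of_real r) = cnj (cnj \<theta> * x k) * of_real r + (cnj \<theta> * \<theta>) * of_real (r * r)"
        by (simp add: w_def algebra_simps)
      then show ?thesis unfolding th r by (simp add: m_def algebra_simps)
    qed
    have "(- \<theta> * of_real r) * H $$ (i, k) = (if i = k then - \<theta> * of_real r else 0) + w i * (cnj (w k) * (\<theta> * of_real r)) / of_real m"
      unfolding Hij[OF i k] by (simp add: algebra_simps)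
    also have "\<dots> = x i" unfolding wk using m0 by (simp add: w_def)
    finally show ?thesis by simp
  qed
  moreover have "H $$ (i, j) = (if i = j then 1 else 0)" if "i < n" "j < k" for i j
    using that k low[of j] by (simp add: Hij w_def)
  moreover have "- \<theta> * of_real r \<noteq> 0" using r th(1) by auto
  moreover have "H \<in> carrier_mat n n" by (simp add: H_def)
  ultimately show ?thesis using that by blast
qed

text \<open>Take k maximal: if a column from k on were not orthogonal to T, a reflection of these columns
  would make k larger.\<close>

lemma adapted_basis:
  assumes T: "T \<subseteq> carrier_vec n"
  shows "\<exists>Q k. k \<le> n \<and> Q \<in> carrier_mat n n \<and> unitary_mat Q \<and>
    (\<forall>j t. k \<le> j \<longrightarrow> j < n \<longrightarrow> t \<in> T \<longrightarrow> cinner t (col Q j) = 0) \<and>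
    (\<forall>j<k. \<forall>v\<in>carrier_vec n. (\<forall>t\<in>T. cinner t v = 0) \<longrightarrow> cinner (col Q j) v = 0)"
proof -
  \<comment> \<open>That the first \<open>k\<close> columns lie in the span of \<open>T\<close> is
    expressed by their orthogonality to every vector orthogonal to \<open>T\<close>.\<close>
  define good where "good k Q \<longleftrightarrow> k \<le> n \<and> Q \<in> carrier_mat n n \<and> unitary_mat Q \<and>
     (\<forall>j<k. \<forall>v\<in>carrier_vec n. (\<forall>t\<in>T. cinner t v = 0) \<longrightarrow> cinner (col Q j) v = 0)" for k Q
  have "unitary_mat (1\<^sub>m n)"
    by (rule unitary_matI) (auto simp: sum_delta_mult if_distrib[of cnj] cong: if_cong)
  then have "good 0 (1\<^sub>m n)" by (simp add: good_def)
  then have ex: "\<exists>Q. good 0 Q" by blast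
  have bdd: "\<forall>k. (\<exists>Q. good k Q) \<longrightarrow> k \<le> n" by (auto simp: good_def)
  define k where "k = (GREATEST k. \<exists>Q. good k Q)"
  have "\<exists>Q. good k Q" unfolding k_def by (rule GreatestI_nat[where P = "\<lambda>k. \<exists>Q. good k Q" and b = n, OF ex]) (use bdd in blast)
  then obtain Q where Q: "good k Q" by blast
  have max: "k' \<le> k" if "\<exists>Q. good k' Q" for k'
    unfolding k_def by (rule Greatest_le_nat[where P = "\<lambda>k. \<exists>Q. good k Q" and b = n, OF that]) (use bdd in blast)
  have Qc: "Q \<in> carrier_mat n n" "unitary_mat Q" "k \<le> n" using Q by (auto simp: good_def)
  have orth: "cinner t (col Q j0) = 0" if j0: "k \<le> j0" "j0 < n" and t: "t \<in> T" for j0 t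
  proof (rule ccontr)
    assume ne: "cinner t (col Q j0) \<noteq> 0"
    have tc: "t \<in> carrier_vec n" using t T by auto
    \<comment> \<open>The coordinates of \<open>t\<close> in the columns of \<open>Q\<close>.
      Deleting the first \<open>k\<close> of them, as in \<open>x\<close>, leaves the part of
      \<open>t\<close> orthogonal to the first \<open>k\<close> columns; the reflection turns column
      \<open>k\<close> into that direction.\<close>
    define y where "y j = (\<Sum>i<n. cnj (Q $$ (i, j)) * t $ i)" for j
    define x where "x j = (if j < k then 0 else y j)" for j
    have "cinner t (col Q j0) = cnj (y j0)"
      using tc Qc j0 by (simp add: cinner_def y_def mult.commute)
    with ne have "y j0 \<noteq> 0" by auto
    with j0 have "x j0 \<noteq> 0" by (simp add: x_def)
    with j0 have nz: "\<exists>j<n. x j \<noteq> 0" by blast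
    have "k < n" using j0 by simp
    have lowx: "x j = 0" if "j < k" for j using that by (simp add: x_def)
    obtain H c where H: "H \<in> carrier_mat n n" "unitary_mat H" "c \<noteq> 0"
      "\<And>i j. i < n \<Longrightarrow> j < k \<Longrightarrow> H $$ (i, j) = (if i = j then 1 else 0)"
      "\<And>i. i < n \<Longrightarrow> x i = c * H $$ (i, k)"
      using householder[OF \<open>k < n\<close> lowx nz] by blast
    define R where "R = Q * H"
    have Rc: "R \<in> carrier_mat n n" unfolding R_def using Qc H by simp
    have QH: "R $$ (i, j) = (\<Sum>l<n. Q $$ (i, l) * H $$ (l, j))" if "i < n" "j < n" for i j
      unfolding R_def using that Qc H by (auto simp: scalar_prod_def lessThan_atLeast0 intro!: sum.cong)
    have low: "R $$ (i, j) = Q $$ (i, j)" if "i < n" "j < k" for i j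
    proof -
      have "j < n" using that \<open>k < n\<close> by simp
      have "R $$ (i, j) = (\<Sum>l<n. Q $$ (i, l) * (if l = j then 1 else 0))"
        unfolding QH[OF that(1) \<open>j < n\<close>] by (intro sum.cong refl) (simp add: H(4) that)
      then show ?thesis unfolding sum_delta_mult(4)[OF \<open>j < n\<close>] .
    qed
    have "good (Suc k) R"
      unfolding good_def
    proof (intro conjI allI impI ballI)
      show "Suc k \<le> n" using \<open>k < n\<close> by simp
      show "R \<in> carrier_mat n n" by (rule Rc)
      show "unitary_mat R" unfolding R_def using unitary_mat_mult Qc H by blast
      fix j v assume j: "j < Suc k" and v: "v \<in> carrier_vec n" and tv: "\<forall>t\<in>T. cinner t v = 0"
      have lowv: "(\<Sum>i<n. cnj (Q $$ (i, j)) * v $ i) = 0" if "j < k" for j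
      proof -
        have "cinner (col Q j) v = 0" using Q that v tv by (auto simp: good_def)
        then show ?thesis using Qc that by (simp add: cinner_def)
      qed
      show "cinner (col R j) v = 0"
      proof (cases "j < k")
        case True
        have "cinner (col R j) v = (\<Sum>i<n. cnj (Q $$ (i, j)) * v $ i)"
          unfolding cinner_def using Rc True \<open>k < n\<close> by (intro sum.cong) (auto simp: low[OF _ True])
        then show ?thesis using lowv[OF True] by simp
      next
        case False
        then have jk: "j = k" using j by simp
        \<comment> \<open>Up to the factor \<open>c\<close>, the new column is \<open>t\<close>
          minus its projection to the first \<open>k\<close> columns, so it remains in the span of
          \<open>T\<close>.\<close>
        have cH: "c * R $$ (i, k) = t $ i - (\<Sum>l<k. Q $$ (i, l) * y l)" if i: "i < n" for i
        proof -
          have "c * R $$ (i, k) = (\<Sum>l<n. Q $$ (i, l) * x l)"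
            unfolding QH[OF i \<open>k < n\<close>] sum_distrib_left by (intro sum.cong refl) (simp add: H(5))
          also have "\<dots> = (\<Sum>l<n. Q $$ (i, l) * y l) - (\<Sum>l<n. if l < k then Q $$ (i, l) * y l else 0)"
            unfolding sum_subtractf[symmetric] by (intro sum.cong refl) (simp add: x_def)
          also have "(\<Sum>l<n. if l < k then Q $$ (i, l) * y l else 0) = (\<Sum>l<k. Q $$ (i, l) * y l)"
            using \<open>k < n\<close> by (intro sum.mono_neutral_cong_right) auto
          also have "(\<Sum>l<n. Q $$ (i, l) * y l) = (\<Sum>l<n. \<Sum>i'<n. Q $$ (i, l) * cnj (Q $$ (i', l)) * t $ i')"
            by (simp add: y_def sum_distrib_left mult.assoc)
          also have "\<dots> = (\<Sum>i'<n. \<Sum>l<n. Q $$ (i, l) * cnj (Q $$ (i', l)) * t $ i')" by (rule sum.swap)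
          also have "\<dots> = (\<Sum>i'<n. (if i = i' then 1 else 0) * t $ i')"
            by (intro sum.cong refl) (simp add: unitary_mat_cols(3)[OF Qc(1,2) i] flip: sum_distrib_right)
          also have "\<dots> = t $ i" by (rule sum_delta_mult(1)[OF i])
          finally show ?thesis .
        qed
        have "cnj c * cinner (col R k) v = (\<Sum>i<n. cnj (c * R $$ (i, k)) * v $ i)"
          unfolding cinner_def using Rc \<open>k < n\<close> by (simp add: sum_distrib_left mult.assoc)
        also have "\<dots> = (\<Sum>i<n. cnj (t $ i) * v $ i - (\<Sum>l<k. cnj (y l) * (cnj (Q $$ (i, l)) * v $ i)))"
          by (intro sum.cong refl) (simp add: cH ring_distribs sum_distrib_left sum_distrib_right mult_ac)
        also have "\<dots> = cinner t v - (\<Sum>i<n. \<Sum>l<k. cnj (y l) * (cnj (Q $$ (i, l)) * v $ i))"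
          using tc by (simp add: sum_subtractf cinner_def)
        also have "(\<Sum>i<n. \<Sum>l<k. cnj (y l) * (cnj (Q $$ (i, l)) * v $ i)) = (\<Sum>l<k. \<Sum>i<n. cnj (y l) * (cnj (Q $$ (i, l)) * v $ i))"
          by (rule sum.swap)
        also have "\<dots> = 0" by (simp add: lowv flip: sum_distrib_left)
        finally show ?thesis using tv t H(3) jk by simp
      qed
    qed
    then have "Suc k \<le> k" using max by blast
    then show False by simp
  qed
  show ?thesis
    using Q orth unfolding good_def by blast
qed

section \<open>The blocks of the Heisenberg images\<close>

definition ap :: "nat \<Rightarrow> (nat \<Rightarrow> nat \<Rightarrow> complex) \<Rightarrow> (nat \<Rightarrow> complex) \<Rightarrow> nat \<Rightarrow> complex" where
  "ap n M v p = (\<Sum>q<n. M p q * v q)"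

lemma ap_comp:
  assumes "\<And>q. q < n \<Longrightarrow> M p q = (\<Sum>r<n. A p r * B r q)"
  shows "ap n M v p = ap n A (ap n B v) p"
proof -
  have "ap n M v p = (\<Sum>q<n. \<Sum>r<n. A p r * (B r q * v q))"
    unfolding ap_def by (intro sum.cong refl) (simp add: assms sum_distrib_right mult.assoc)
  also have "\<dots> = (\<Sum>r<n. \<Sum>q<n. A p r * (B r q * v q))" by (rule sum.swap)
  finally show ?thesis by (simp add: ap_def sum_distrib_left)
qed

lemma ap_cong: "(\<And>q. q < n \<Longrightarrow> v q = w q) \<Longrightarrow> ap n M v p = ap n M w p"
  unfolding ap_def by simp

lemma ap_if: "ap n M (\<lambda>q. if c then v q else 0) p = (if c then ap n M v p else 0)"
  unfolding ap_def by simp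

text \<open>\<open>coiso\<close> states U U^* = 1, which makes T -> U^* T U multiplicative. The
  assumptions are symmetric in the two slots, so the locale can be interpreted with A and B
  exchanged.\<close>

locale slot_coisometry =
  fixes dP dAI dAO dBI dBO dF :: nat and u :: "nat \<Rightarrow> nat \<Rightarrow> nat \<Rightarrow> nat \<Rightarrow> nat \<Rightarrow> nat \<Rightarrow> complex"
  assumes pos: "0 < dAO" "0 < dBO"
    and coiso: "\<And>a b f a' b' f'. a < dAI \<Longrightarrow> b < dBI \<Longrightarrow> f < dF \<Longrightarrow> a' < dAI \<Longrightarrow> b' < dBI \<Longrightarrow> f' < dF \<Longrightarrow>
        (\<Sum>p<dP. \<Sum>x<dAO. \<Sum>y<dBO. u a b f p x y * cnj (u a' b' f' p x y)) = (if a = a' \<and> b = b' \<and> f = f' then 1 else 0)"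
    and sAB: "slot_cond_AB dP dAI dAO dBI dBO (gram dF u)"
    and sB: "slot_cond_B dP dAI dAO dBI dBO (gram dF u)"
    and sA: "slot_cond_A dP dAI dAO dBI dBO (gram dF u)"
begin

abbreviation G where "G \<equiv> gram dF u"

text \<open>The Heisenberg images of the matrix units of A_I act on P and B_O only, those of B_I on P and
  A_O only; X and Y are their blocks, operators on P.\<close>

definition X where "X a a' y y' p p' = (\<Sum>b<dBI. G a b p 0 y a' b p' 0 y')"

definition Y where "Y b b' x x' p p' = (\<Sum>a<dAI. G a b p x 0 a b' p' x' 0)"

text \<open>In a product of two Heisenberg images the sum over the middle index (q, z, w) is an
  inner product of rows of U, which \<open>coiso\<close> collapses.\<close>

lemma combine:
  assumes S: "\<And>m. m \<in> S \<Longrightarrow> \<alpha> m < dAI \<and> \<beta> m < dBI \<and> \<phi> m < dF"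
    and S': "\<And>m. m \<in> S' \<Longrightarrow> \<alpha>' m < dAI \<and> \<beta>' m < dBI \<and> \<phi>' m < dF"
  shows "(\<Sum>q<dP. \<Sum>z<dAO. \<Sum>w<dBO. (\<Sum>m\<in>S. c m * u (\<alpha> m) (\<beta> m) (\<phi> m) q z w) * (\<Sum>m\<in>S'. d m * cnj (u (\<alpha>' m) (\<beta>' m) (\<phi>' m) q z w)))
    = (\<Sum>m\<in>S. \<Sum>m'\<in>S'. if \<alpha> m = \<alpha>' m' \<and> \<beta> m = \<beta>' m' \<and> \<phi> m = \<phi>' m' then c m * d m' else 0)"
proof -
  have "(\<Sum>q<dP. \<Sum>z<dAO. \<Sum>w<dBO. (\<Sum>m\<in>S. c m * u (\<alpha> m) (\<beta> m) (\<phi> m) q z w) * (\<Sum>m\<in>S'. d m * cnj (u (\<alpha>' m) (\<beta>' m) (\<phi>' m) q z w)))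
    = (\<Sum>q<dP. \<Sum>z<dAO. \<Sum>w<dBO. \<Sum>m\<in>S. \<Sum>m'\<in>S'. c m * d m' * (u (\<alpha> m) (\<beta> m) (\<phi> m) q z w * cnj (u (\<alpha>' m') (\<beta>' m') (\<phi>' m') q z w)))"
    unfolding sum_product by (intro sum.cong refl) simp
  also have "\<dots> = (\<Sum>q<dP. \<Sum>z<dAO. \<Sum>m\<in>S. \<Sum>m'\<in>S'. \<Sum>w<dBO. c m * d m' * (u (\<alpha> m) (\<beta> m) (\<phi> m) q z w * cnj (u (\<alpha>' m') (\<beta>' m') (\<phi>' m') q z w)))"
    by (rule sum.cong[OF refl], rule sum.cong[OF refl], rule sum_swap12)
  also have "\<dots> = (\<Sum>q<dP. \<Sum>m\<in>S. \<Sum>m'\<in>S'. \<Sum>z<dAO. \<Sum>w<dBO. c m * d m' * (u (\<alpha> m) (\<beta> m) (\<phi> m) q z w * cnj (u (\<alpha>' m') (\<beta>' m') (\<phi>' m') q z w)))"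
    by (rule sum.cong[OF refl], rule sum_swap12)
  also have "\<dots> = (\<Sum>m\<in>S. \<Sum>m'\<in>S'. \<Sum>q<dP. \<Sum>z<dAO. \<Sum>w<dBO. c m * d m' * (u (\<alpha> m) (\<beta> m) (\<phi> m) q z w * cnj (u (\<alpha>' m') (\<beta>' m') (\<phi>' m') q z w)))"
    by (rule sum_swap12)
  also have "\<dots> = (\<Sum>m\<in>S. \<Sum>m'\<in>S'. if \<alpha> m = \<alpha>' m' \<and> \<beta> m = \<beta>' m' \<and> \<phi> m = \<phi>' m' then c m * d m' else 0)"
    using S S' by (intro sum.cong refl) (simp add: coiso flip: sum_distrib_left)
  finally show ?thesis .
qed

text \<open>|a><a'| \<otimes> |b><b'| is the product of |a><a'| \<otimes> 1 and 1 \<otimes> |b><b'|,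
  and T -> U^* T U preserves this product. The first image is diagonal in A_O and the second in B_O,
  so of the middle indices only the one of P is still summed.\<close>

lemma gram_eq_XY:
  assumes i: "a < dAI" "b < dBI" "p < dP" "x < dAO" "y < dBO" "a' < dAI" "b' < dBI" "p' < dP" "x' < dAO" "y' < dBO"
  shows "G a b p x y a' b' p' x' y' = (\<Sum>q<dP. X a a' y y' p q * Y b b' x x' q p')"
proof -
  let ?S = "{..<dBI} \<times> {..<dF}" and ?S' = "{..<dAI} \<times> {..<dF}"
  have L: "(if z = x then X a a' y w p q else 0) = (\<Sum>m\<in>?S. cnj (u a (fst m) (snd m) p x y) * u a' (fst m) (snd m) q z w)"
    if "q < dP" "z < dAO" "w < dBO" for q z w
  proof -
    have "(\<Sum>m\<in>?S. cnj (u a (fst m) (snd m) p x y) * u a' (fst m) (snd m) q z w) = (\<Sum>b1<dBI. G a b1 p x y a' b1 q z w)"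
      by (simp add: gram_def sum.cartesian_product case_prod_unfold)
    also have "\<dots> = (if x = z then \<Sum>b1<dBI. G a b1 p 0 y a' b1 q 0 w else 0)"
      by (rule sA[unfolded slot_cond_A_def, rule_format]) (use i that in auto)
    finally show ?thesis by (simp add: X_def)
  qed
  have R: "(if w = y' then Y b b' z x' q p' else 0) = (\<Sum>m\<in>?S'. u (fst m) b' (snd m) p' x' y' * cnj (u (fst m) b (snd m) q z w))"
    if "q < dP" "z < dAO" "w < dBO" for q z w
  proof -
    have "(\<Sum>m\<in>?S'. u (fst m) b' (snd m) p' x' y' * cnj (u (fst m) b (snd m) q z w)) = (\<Sum>a1<dAI. G a1 b q z w a1 b' p' x' y')"
      by (simp add: gram_def sum.cartesian_product case_prod_unfold mult.commute)
    also have "\<dots> = (if w = y' then \<Sum>a1<dAI. G a1 b q z 0 a1 b' p' x' 0 else 0)"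
      by (rule sB[unfolded slot_cond_B_def, rule_format]) (use i that in auto)
    finally show ?thesis by (simp add: Y_def)
  qed
  have "(\<Sum>q<dP. X a a' y y' p q * Y b b' x x' q p')
    = (\<Sum>q<dP. \<Sum>z<dAO. \<Sum>w<dBO. if w = y' then if z = x then X a a' y w p q * Y b b' z x' q p' else 0 else 0)"
    using i by simp
  also have "\<dots> = (\<Sum>q<dP. \<Sum>z<dAO. \<Sum>w<dBO. (if z = x then X a a' y w p q else 0) * (if w = y' then Y b b' z x' q p' else 0))"
    by (intro sum.cong refl) simp
  also have "\<dots> = (\<Sum>q<dP. \<Sum>z<dAO. \<Sum>w<dBO. (\<Sum>m\<in>?S. cnj (u a (fst m) (snd m) p x y) * u a' (fst m) (snd m) q z w)
      * (\<Sum>m\<in>?S'. u (fst m) b' (snd m) p' x' y' * cnj (u (fst m) b (snd m) q z w)))"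
    by (intro sum.cong refl arg_cong2[where f = "(*)"] L R) auto
  also have "\<dots> = (\<Sum>m\<in>?S. \<Sum>m'\<in>?S'. if a' = fst m' \<and> fst m = b \<and> snd m = snd m'
      then cnj (u a (fst m) (snd m) p x y) * u (fst m') b' (snd m') p' x' y' else 0)"
    by (rule combine[where \<alpha> = "\<lambda>_. a'" and \<beta>' = "\<lambda>_. b"]) (use i in auto)
  also have "\<dots> = (\<Sum>b1<dBI. \<Sum>f<dF. \<Sum>a1<dAI. \<Sum>f1<dF. if a' = a1 \<and> b1 = b \<and> f = f1
      then cnj (u a b1 f p x y) * u a1 b' f1 p' x' y' else 0)"
    by (simp only: sum.cartesian_product' fst_conv snd_conv)
  also have "\<dots> = (\<Sum>b1<dBI. \<Sum>f<dF. \<Sum>a1<dAI. \<Sum>f1<dF. if f1 = f then if a1 = a' then if b1 = b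
      then cnj (u a b1 f p x y) * u a1 b' f1 p' x' y' else 0 else 0 else 0)"
    by (intro sum.cong refl) auto
  also have "\<dots> = (\<Sum>b1<dBI. if b1 = b then G a b1 p x y a' b' p' x' y' else 0)"
    using i by (intro sum.cong refl) (simp add: gram_def)
  also have "\<dots> = G a b p x y a' b' p' x' y'" using i by simp
  finally show ?thesis by simp
qed

text \<open>The product rule |b1><b2| |b3><b4| = [b2 = b3] |b1><b4| carried over to the Heisenberg
  images, with \<open>Y\<close> read as a block matrix over A_O.\<close>

lemma Y_mult:
  assumes i: "b1 < dBI" "b2 < dBI" "b3 < dBI" "b4 < dBI" "x < dAO" "x' < dAO" "p < dP" "p' < dP"
  shows "(\<Sum>z<dAO. \<Sum>q<dP. Y b1 b2 x z p q * Y b3 b4 z x' q p') = (if b2 = b3 then Y b1 b4 x x' p p' else 0)"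
proof -
  let ?S = "{..<dAI} \<times> {..<dF}"
  have L: "(if w = 0 then Y b1 b2 x z p q else 0) = (\<Sum>m\<in>?S. cnj (u (fst m) b1 (snd m) p x 0) * u (fst m) b2 (snd m) q z w)"
    if "q < dP" "z < dAO" "w < dBO" for q z w
  proof -
    have "(\<Sum>m\<in>?S. cnj (u (fst m) b1 (snd m) p x 0) * u (fst m) b2 (snd m) q z w) = (\<Sum>a<dAI. G a b1 p x 0 a b2 q z w)"
      by (simp add: gram_def sum.cartesian_product case_prod_unfold)
    also have "\<dots> = (if 0 = w then \<Sum>a<dAI. G a b1 p x 0 a b2 q z 0 else 0)"
      by (rule sB[unfolded slot_cond_B_def, rule_format]) (use i that pos in auto)
    finally show ?thesis by (simp add: Y_def)
  qed
  have R: "(if w = 0 then Y b3 b4 z x' q p' else 0) = (\<Sum>m\<in>?S. u (fst m) b4 (snd m) p' x' 0 * cnj (u (fst m) b3 (snd m) q z w))"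
    if "q < dP" "z < dAO" "w < dBO" for q z w
  proof -
    have "(\<Sum>m\<in>?S. u (fst m) b4 (snd m) p' x' 0 * cnj (u (fst m) b3 (snd m) q z w)) = (\<Sum>a<dAI. G a b3 q z w a b4 p' x' 0)"
      by (simp add: gram_def sum.cartesian_product case_prod_unfold mult.commute)
    also have "\<dots> = (if w = 0 then \<Sum>a<dAI. G a b3 q z 0 a b4 p' x' 0 else 0)"
      by (rule sB[unfolded slot_cond_B_def, rule_format]) (use i that pos in auto)
    finally show ?thesis by (simp add: Y_def)
  qed
  have "(\<Sum>z<dAO. \<Sum>q<dP. Y b1 b2 x z p q * Y b3 b4 z x' q p')
    = (\<Sum>q<dP. \<Sum>z<dAO. \<Sum>w<dBO. if w = 0 then Y b1 b2 x z p q * Y b3 b4 z x' q p' else 0)"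
    using pos by (subst sum.swap) simp
  also have "\<dots> = (\<Sum>q<dP. \<Sum>z<dAO. \<Sum>w<dBO. (if w = 0 then Y b1 b2 x z p q else 0) * (if w = 0 then Y b3 b4 z x' q p' else 0))"
    by (intro sum.cong refl) simp
  also have "\<dots> = (\<Sum>q<dP. \<Sum>z<dAO. \<Sum>w<dBO. (\<Sum>m\<in>?S. cnj (u (fst m) b1 (snd m) p x 0) * u (fst m) b2 (snd m) q z w)
      * (\<Sum>m\<in>?S. u (fst m) b4 (snd m) p' x' 0 * cnj (u (fst m) b3 (snd m) q z w)))"
    by (intro sum.cong refl arg_cong2[where f = "(*)"] L R) auto
  also have "\<dots> = (\<Sum>m\<in>?S. \<Sum>m'\<in>?S. if fst m = fst m' \<and> b2 = b3 \<and> snd m = snd m'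
      then cnj (u (fst m) b1 (snd m) p x 0) * u (fst m') b4 (snd m') p' x' 0 else 0)"
    by (rule combine[where \<beta> = "\<lambda>_. b2" and \<beta>' = "\<lambda>_. b3"]) (use i in auto)
  also have "\<dots> = (\<Sum>a<dAI. \<Sum>f<dF. \<Sum>a1<dAI. \<Sum>f1<dF. if a = a1 \<and> b2 = b3 \<and> f = f1
      then cnj (u a b1 f p x 0) * u a1 b4 f1 p' x' 0 else 0)"
    by (simp only: sum.cartesian_product' fst_conv snd_conv)
  also have "\<dots> = (\<Sum>a<dAI. \<Sum>f<dF. \<Sum>a1<dAI. \<Sum>f1<dF. if f1 = f then if a1 = a then if b2 = b3
      then cnj (u a b1 f p x 0) * u a1 b4 f1 p' x' 0 else 0 else 0 else 0)"
    by (intro sum.cong refl) auto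
  also have "\<dots> = (if b2 = b3 then Y b1 b4 x x' p p' else 0)"
    by (simp add: Y_def gram_def)
  finally show ?thesis .
qed

text \<open>The two factors of the matrix unit may also be multiplied in the other order; this is
  the previous factorisation with the slots exchanged. Together they make the blocks
  commute.\<close>

lemma gram_eq_YX:
  assumes i: "a < dAI" "b < dBI" "p < dP" "x < dAO" "y < dBO" "a' < dAI" "b' < dBI" "p' < dP" "x' < dAO" "y' < dBO"
  shows "G a b p x y a' b' p' x' y' = (\<Sum>q<dP. Y b b' x x' p q * X a a' y y' q p')"
proof -
  interpret sw: slot_coisometry dP dBI dBO dAI dAO dF "\<lambda>b a f p y x. u a b f p x y"
  proof
    fix b a f b' a' f' assume "b < dBI" "a < dAI" "f < dF" "b' < dBI" "a' < dAI" "f' < dF"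
    then have "(\<Sum>p<dP. \<Sum>x<dAO. \<Sum>y<dBO. u a b f p x y * cnj (u a' b' f' p x y)) = (if b = b' \<and> a = a' \<and> f = f' then 1 else 0)"
      using coiso[of a b f a' b' f'] by (auto simp: conj_left_commute)
    moreover have "(\<Sum>p<dP. \<Sum>y<dBO. \<Sum>x<dAO. u a b f p x y * cnj (u a' b' f' p x y)) = (\<Sum>p<dP. \<Sum>x<dAO. \<Sum>y<dBO. u a b f p x y * cnj (u a' b' f' p x y))"
      by (rule sum.cong[OF refl], rule sum.swap)
    ultimately show "(\<Sum>p<dP. \<Sum>y<dBO. \<Sum>x<dAO. u a b f p x y * cnj (u a' b' f' p x y)) = (if b = b' \<and> a = a' \<and> f = f' then 1 else 0)"
      by simp
  next
    show "slot_cond_AB dP dBI dBO dAI dAO (gram dF (\<lambda>b a f p y x. u a b f p x y))"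
      unfolding slot_cond_AB_def
    proof (intro allI impI)
      fix b a p y x b' a' p' y' x'
      assume j: "b < dBI" "a < dAI" "p < dP" "y < dBO" "x < dAO" "b' < dBI" "a' < dAI" "p' < dP" "y' < dBO" "x' < dAO"
      from sAB[unfolded slot_cond_AB_def, rule_format, OF j(2,1,3,5,4,7,6,8,10,9)]
      show "gram dF (\<lambda>b a f p y x. u a b f p x y) b a p y x b' a' p' y' x'
        = (if y = y' then gram dF (\<lambda>b a f p y x. u a b f p x y) b a p 0 x b' a' p' 0 x' else 0)
        + (if x = x' then gram dF (\<lambda>b a f p y x. u a b f p x y) b a p y 0 b' a' p' y' 0 else 0)
        - (if y = y' \<and> x = x' then gram dF (\<lambda>b a f p y x. u a b f p x y) b a p 0 0 b' a' p' 0 0 else 0)"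
        unfolding gram_def by (cases "x = x'"; cases "y = y'") simp_all
    qed
    show "slot_cond_B dP dBI dBO dAI dAO (gram dF (\<lambda>b a f p y x. u a b f p x y))"
      unfolding slot_cond_B_def
    proof (intro allI impI)
      fix a p y x a' p' y' x'
      assume j: "a < dAI" "p < dP" "y < dBO" "x < dAO" "a' < dAI" "p' < dP" "y' < dBO" "x' < dAO"
      from sA[unfolded slot_cond_A_def, rule_format, OF j(1,2,4,3,5,6,8,7)]
      show "(\<Sum>b<dBI. gram dF (\<lambda>b a f p y x. u a b f p x y) b a p y x b a' p' y' x')
        = (if x = x' then \<Sum>b<dBI. gram dF (\<lambda>b a f p y x. u a b f p x y) b a p y 0 b a' p' y' 0 else 0)"
        unfolding gram_def .
    qed
    show "slot_cond_A dP dBI dBO dAI dAO (gram dF (\<lambda>b a f p y x. u a b f p x y))"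
      unfolding slot_cond_A_def
    proof (intro allI impI)
      fix b p y x b' p' y' x'
      assume j: "b < dBI" "p < dP" "y < dBO" "x < dAO" "b' < dBI" "p' < dP" "y' < dBO" "x' < dAO"
      from sB[unfolded slot_cond_B_def, rule_format, OF j(1,2,4,3,5,6,8,7)]
      show "(\<Sum>a<dAI. gram dF (\<lambda>b a f p y x. u a b f p x y) b a p y x b' a p' y' x')
        = (if y = y' then \<Sum>a<dAI. gram dF (\<lambda>b a f p y x. u a b f p x y) b a p 0 x b' a p' 0 x' else 0)"
        unfolding gram_def .
    qed
  qed (use pos in auto)
  have "sw.X = Y" "sw.Y = X"
    by (intro ext; simp add: sw.X_def sw.Y_def X_def Y_def gram_def)+
  then show ?thesis
    using sw.gram_eq_XY[OF i(2,1,3,5,4,7,6,8,10,9)] by (simp add: gram_def)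
qed

text \<open>The Heisenberg image of |a'><a| is the adjoint of that of |a><a'|.\<close>

lemma X_hermitian: "cnj (X a a' y y' p p') = X a' a y' y p' p"
  unfolding X_def cnj_sum gram_cnj[symmetric] ..

text \<open>The vectors of P on which \<open>Y\<close> acts as an operator on P times the identity
  of A_O: off-diagonal blocks vanish on them, and the diagonal blocks agree with the one at the
  reference index. They form the summand of P in which B comes before A.\<close>

definition N where
  "N v \<longleftrightarrow> (\<forall>b<dBI. \<forall>b'<dBI. \<forall>x<dAO. \<forall>x'<dAO. \<forall>p<dP.
     ap dP (Y b b' x x') v p = (if x = x' then ap dP (Y b b' 0 0) v p else 0))"

lemma ap_X_Y_commute:
  assumes "a < dAI" "b < dBI" "p < dP" "x < dAO" "y < dBO" "a' < dAI" "b' < dBI" "x' < dAO" "y' < dBO"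
  shows "ap dP (Y b b' x x') (ap dP (X a a' y y') v) p = ap dP (X a a' y y') (ap dP (Y b b' x x') v) p"
proof -
  have "ap dP (Y b b' x x') (ap dP (X a a' y y') v) p = ap dP (\<lambda>p p'. G a b p x y a' b' p' x' y') v p"
    by (rule ap_comp[symmetric], rule gram_eq_YX) (use assms in auto)
  also have "\<dots> = ap dP (X a a' y y') (ap dP (Y b b' x x') v) p"
    by (rule ap_comp, rule gram_eq_XY) (use assms in auto)
  finally show ?thesis .
qed

text \<open>Blocks of \<open>X\<close> commute with all blocks of \<open>Y\<close>, hence preserve
  linear equations stated in terms of \<open>Y\<close>.\<close>

lemma N_X:
  assumes N: "N v" and i: "a < dAI" "a' < dAI" "y < dBO" "y' < dBO"
  shows "N (ap dP (X a a' y y') v)"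
  unfolding N_def
proof (intro allI impI)
  fix b b' x x' p assume j: "b < dBI" "b' < dBI" "x < dAO" "x' < dAO" "p < dP"
  have "ap dP (Y b b' x x') (ap dP (X a a' y y') v) p = ap dP (X a a' y y') (ap dP (Y b b' x x') v) p"
    by (rule ap_X_Y_commute) (use i j in auto)
  also have "\<dots> = ap dP (X a a' y y') (\<lambda>q. if x = x' then ap dP (Y b b' 0 0) v q else 0) p"
    by (rule ap_cong, rule N[unfolded N_def, rule_format]) (use j in auto)
  also have "\<dots> = (if x = x' then ap dP (X a a' y y') (ap dP (Y b b' 0 0) v) p else 0)" by (rule ap_if)
  also have "ap dP (X a a' y y') (ap dP (Y b b' 0 0) v) p = ap dP (Y b b' 0 0) (ap dP (X a a' y y') v) p"
    by (rule ap_X_Y_commute[symmetric]) (use i j pos in auto)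
  finally show "ap dP (Y b b' x x') (ap dP (X a a' y y') v) p = (if x = x' then ap dP (Y b b' 0 0) (ap dP (X a a' y y') v) p else 0)" .
qed

text \<open>In the product rule for \<open>Y\<close> applied to a vector of \<open>N\<close>, only
  the term w = x' of the sum over A_O survives. So a block applied after a block is again a single
  block applied to \<open>v\<close>, or 0, and the equations for \<open>v\<close> carry
  over.\<close>

lemma N_Y:
  assumes N: "N v" and i: "c < dBI" "c' < dBI" "z < dAO" "z' < dAO"
  shows "N (ap dP (Y c c' z z') v)"
proof -
  have mult: "ap dP (Y b b' x x') (ap dP (Y c c' 0 0) v) p = (if b' = c then ap dP (Y b c' x x') v p else 0)"
    if j: "b < dBI" "b' < dBI" "x < dAO" "x' < dAO" "p < dP" for b b' x x' p
  proof -
    have "(if b' = c then ap dP (Y b c' x x') v p else 0) = ap dP (\<lambda>p p'. \<Sum>w<dAO. \<Sum>q<dP. Y b b' x w p q * Y c c' w x' q p') v p"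
      unfolding ap_def using i j by (simp add: Y_mult)
    also have "\<dots> = (\<Sum>w<dAO. ap dP (\<lambda>p p'. \<Sum>q<dP. Y b b' x w p q * Y c c' w x' q p') v p)"
      unfolding ap_def sum_distrib_right by (rule sum.swap)
    also have "\<dots> = (\<Sum>w<dAO. ap dP (Y b b' x w) (ap dP (Y c c' w x') v) p)"
      by (intro sum.cong refl ap_comp)
    also have "\<dots> = (\<Sum>w<dAO. ap dP (Y b b' x w) (\<lambda>q. if w = x' then ap dP (Y c c' 0 0) v q else 0) p)"
      by (intro sum.cong refl ap_cong N[unfolded N_def, rule_format]) (use i j in auto)
    also have "\<dots> = (\<Sum>w<dAO. if w = x' then ap dP (Y b b' x w) (ap dP (Y c c' 0 0) v) p else 0)"
      unfolding ap_if ..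
    also have "\<dots> = ap dP (Y b b' x x') (ap dP (Y c c' 0 0) v) p" using j by simp
    finally show ?thesis by simp
  qed
  have e: "ap dP (Y c c' z z') v q = (if z = z' then ap dP (Y c c' 0 0) v q else 0)" if "q < dP" for q
    by (rule N[unfolded N_def, rule_format]) (use i that in auto)
  have *: "ap dP M (ap dP (Y c c' z z') v) p = (if z = z' then ap dP M (ap dP (Y c c' 0 0) v) p else 0)" for M p
  proof -
    have "ap dP M (ap dP (Y c c' z z') v) p = ap dP M (\<lambda>q. if z = z' then ap dP (Y c c' 0 0) v q else 0) p"
      by (rule ap_cong, rule e)
    then show ?thesis unfolding ap_if .
  qed
  show ?thesis
    unfolding N_def
  proof (intro allI impI)
    fix b b' x x' p assume j: "b < dBI" "b' < dBI" "x < dAO" "x' < dAO" "p < dP"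
    have "ap dP (Y b c' x x') v p = (if x = x' then ap dP (Y b c' 0 0) v p else 0)"
      by (rule N[unfolded N_def, rule_format]) (use i j in auto)
    then show "ap dP (Y b b' x x') (ap dP (Y c c' z z') v) p = (if x = x' then ap dP (Y b b' 0 0) (ap dP (Y c c' z z') v) p else 0)"
      unfolding * mult[OF j] mult[OF j(1,2) pos(1) pos(1) j(5)] by (cases "x = x'") simp_all
  qed
qed

lemma N_cong:
  assumes "N v" "\<And>q. q < dP \<Longrightarrow> v q = w q"
  shows "N w"
proof -
  have e: "ap dP M w p = ap dP M v p" for M p by (rule ap_cong) (use assms(2) in auto)
  show ?thesis using assms(1) unfolding N_def e .
qed

lemma N_G:
  assumes N: "N v" and i: "a < dAI" "b < dBI" "x < dAO" "y < dBO" "a' < dAI" "b' < dBI" "x' < dAO" "y' < dBO"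
  shows "N (ap dP (\<lambda>p p'. G a b p x y a' b' p' x' y') v)"
proof (rule N_cong)
  show "N (ap dP (X a a' y y') (ap dP (Y b b' x x') v))"
    by (intro N_X N_Y N i)
  fix q assume "q < dP"
  then show "ap dP (X a a' y y') (ap dP (Y b b' x x') v) q = ap dP (\<lambda>p p'. G a b p x y a' b' p' x' y') v q"
    by (intro ap_comp[symmetric] gram_eq_XY) (use i in auto)
qed

text \<open>Applying a block of \<open>Y\<close> to the adjoint of the non-trivial part of
  \<open>X\<close> gives \<open>G\<close> minus its part proportional to the identity on B_O; by
  \<open>slot_cond_AB\<close> the difference is proportional to the identity on A_O. These are the
  equations of \<open>N\<close>: the annihilation of the two non-trivial parts in the form needed
  for the orthogonal complement.\<close>

lemma N_X_row:
  assumes i: "a < dAI" "a' < dAI" "y < dBO" "y' < dBO" "p < dP"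
  shows "N (\<lambda>q. cnj (X a a' y y' p q - (if y = y' then X a a' 0 0 p q else 0)))"
  unfolding N_def
proof (intro allI impI)
  fix b b' x x' p0 assume j: "b < dBI" "b' < dBI" "x < dAO" "x' < dAO" "p0 < dP"
  have e: "ap dP (Y b b' x x') (\<lambda>q. cnj (X a a' y y' p q - (if y = y' then X a a' 0 0 p q else 0))) p0
    = G a' b p0 x y' a b' p x' y - (if y = y' then G a' b p0 x 0 a b' p x' 0 else 0)"
    if "x < dAO" "x' < dAO" for x x'
  proof -
    have "ap dP (Y b b' x x') (\<lambda>q. cnj (X a a' y y' p q - (if y = y' then X a a' 0 0 p q else 0))) p0
      = (\<Sum>q<dP. Y b b' x x' p0 q * X a' a y' y q p) - (if y = y' then \<Sum>q<dP. Y b b' x x' p0 q * X a' a 0 0 q p else 0)"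
      unfolding ap_def by (cases "y = y'") (simp_all add: X_hermitian ring_distribs sum_subtractf)
    moreover have "G a' b p0 x y' a b' p x' y = (\<Sum>q<dP. Y b b' x x' p0 q * X a' a y' y q p)"
      by (rule gram_eq_YX) (use i j that in auto)
    moreover have "G a' b p0 x 0 a b' p x' 0 = (\<Sum>q<dP. Y b b' x x' p0 q * X a' a 0 0 q p)"
      by (rule gram_eq_YX) (use i j that pos in auto)
    ultimately show ?thesis by simp
  qed
  have "G a' b p0 x y' a b' p x' y = (if x = x' then G a' b p0 0 y' a b' p 0 y else 0)
      + (if y' = y then G a' b p0 x 0 a b' p x' 0 else 0)
      - (if x = x' \<and> y' = y then G a' b p0 0 0 a b' p 0 0 else 0)"
    by (rule sAB[unfolded slot_cond_AB_def, rule_format]) (use i j in auto)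
  then show "ap dP (Y b b' x x') (\<lambda>q. cnj (X a a' y y' p q - (if y = y' then X a a' 0 0 p q else 0))) p0
    = (if x = x' then ap dP (Y b b' 0 0) (\<lambda>q. cnj (X a a' y y' p q - (if y = y' then X a a' 0 0 p q else 0))) p0 else 0)"
    unfolding e[OF j(3,4)] e[OF pos(1) pos(1)] by (cases "y = y'"; cases "x = x'") simp_all
qed

text \<open>\<open>N\<close> is the orthogonal complement of \<open>T\<close>, the conjugated rows
  of the non-trivial part of \<open>Y\<close>; a basis adapted to \<open>T\<close> lists the
  complement of \<open>N\<close> first. A column in that complement is orthogonal to the conjugated
  rows of the non-trivial part of \<open>X\<close>, as these lie in \<open>N\<close>, so
  \<open>X\<close> is trivial on it.\<close>

lemma block_basis:
  "\<exists>Q k. k \<le> dP \<and> Q \<in> carrier_mat dP dP \<and> unitary_mat Q \<and>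
    (\<forall>j v. j < k \<longrightarrow> N v \<longrightarrow> (\<Sum>p<dP. cnj (Q $$ (p, j)) * v p) = 0) \<and>
    (\<forall>j. k \<le> j \<longrightarrow> j < dP \<longrightarrow> N (\<lambda>p. Q $$ (p, j))) \<and>
    (\<forall>j a a' y y' p. j < k \<longrightarrow> a < dAI \<longrightarrow> a' < dAI \<longrightarrow> y < dBO \<longrightarrow> y' < dBO \<longrightarrow> p < dP \<longrightarrow>
       ap dP (X a a' y y') (\<lambda>p. Q $$ (p, j)) p = (if y = y' then ap dP (X a a' 0 0) (\<lambda>p. Q $$ (p, j)) p else 0))"
proof -
  define row where "row b b' x x' p = vec dP (\<lambda>q. cnj (Y b b' x x' p q - (if x = x' then Y b b' 0 0 p q else 0)))" for b b' x x' p
  define T where "T = {row b b' x x' p | b b' x x' p. b < dBI \<and> b' < dBI \<and> x < dAO \<and> x' < dAO \<and> p < dP}"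
  have row: "cinner (row b b' x x' p) v = ap dP (Y b b' x x') (\<lambda>q. v $ q) p - (if x = x' then ap dP (Y b b' 0 0) (\<lambda>q. v $ q) p else 0)"
    for b b' x x' p v
    unfolding row_def cinner_def ap_def by (cases "x = x'") (simp_all add: ring_distribs sum_subtractf)
  have NT: "N (\<lambda>q. v $ q) \<longleftrightarrow> (\<forall>t\<in>T. cinner t v = 0)" for v
  proof
    assume N: "N (\<lambda>q. v $ q)"
    have "cinner (row b b' x x' p) v = 0"
      if "b < dBI" "b' < dBI" "x < dAO" "x' < dAO" "p < dP" for b b' x x' p
      unfolding row N[unfolded N_def, rule_format, OF that] by simp
    then show "\<forall>t\<in>T. cinner t v = 0" unfolding T_def by blast
  next
    assume t: "\<forall>t\<in>T. cinner t v = 0"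
    show "N (\<lambda>q. v $ q)"
      unfolding N_def
    proof (intro allI impI)
      fix b b' x x' p assume "b < dBI" "b' < dBI" "x < dAO" "x' < dAO" "p < dP"
      then have "cinner (row b b' x x' p) v = 0" using t unfolding T_def by blast
      then show "ap dP (Y b b' x x') (\<lambda>q. v $ q) p = (if x = x' then ap dP (Y b b' 0 0) (\<lambda>q. v $ q) p else 0)"
        unfolding row by simp
    qed
  qed
  have "T \<subseteq> carrier_vec dP" by (auto simp: T_def row_def)
  from adapted_basis[OF this] obtain Q k where Q: "k \<le> dP" "Q \<in> carrier_mat dP dP" "unitary_mat Q"
    and ge: "\<forall>j t. k \<le> j \<longrightarrow> j < dP \<longrightarrow> t \<in> T \<longrightarrow> cinner t (col Q j) = 0"
    and lt: "\<forall>j<k. \<forall>v\<in>carrier_vec dP. (\<forall>t\<in>T. cinner t v = 0) \<longrightarrow> cinner (col Q j) v = 0"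
    by blast
  have col: "col Q j $ q = Q $$ (q, j)" if "q < dP" "j < dP" for q j using Q that by simp
  have 1: "(\<Sum>p<dP. cnj (Q $$ (p, j)) * v p) = 0" if "j < k" "N v" for j v
  proof -
    have "N (\<lambda>q. vec dP v $ q)" by (rule N_cong[OF that(2)]) simp
    then have "\<forall>t\<in>T. cinner t (vec dP v) = 0" unfolding NT .
    then have "cinner (col Q j) (vec dP v) = 0"
      using lt[THEN spec, THEN mp, OF that(1), THEN bspec, of "vec dP v"] by simp
    then show ?thesis using Q that by (simp add: cinner_def col)
  qed
  have 2: "N (\<lambda>p. Q $$ (p, j))" if "k \<le> j" "j < dP" for j
  proof (rule N_cong)
    show "N (\<lambda>q. col Q j $ q)" unfolding NT using ge that by blast
  qed (simp add: col that)
  have 3: "ap dP (X a a' y y') (\<lambda>p. Q $$ (p, j)) p = (if y = y' then ap dP (X a a' 0 0) (\<lambda>p. Q $$ (p, j)) p else 0)"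
    if "j < k" "a < dAI" "a' < dAI" "y < dBO" "y' < dBO" "p < dP" for j a a' y y' p
  proof -
    have "(\<Sum>q<dP. cnj (Q $$ (q, j)) * cnj (X a a' y y' p q - (if y = y' then X a a' 0 0 p q else 0))) = 0"
      by (rule 1[OF that(1)], rule N_X_row) (use that in auto)
    then have "cnj (\<Sum>q<dP. cnj (Q $$ (q, j)) * cnj (X a a' y y' p q - (if y = y' then X a a' 0 0 p q else 0))) = 0" by simp
    then have "(\<Sum>q<dP. (X a a' y y' p q - (if y = y' then X a a' 0 0 p q else 0)) * Q $$ (q, j)) = 0"
      by (simp add: mult.commute)
    then show ?thesis
      unfolding ap_def by (cases "y = y'") (simp_all add: ring_distribs sum_subtractf)
  qed
  show ?thesis
    by (intro exI[of _ Q] exI[of _ k] conjI allI impI Q 1 2 3)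
qed

end

section \<open>Combs\<close>

lemma flat3_eq_iff:
  assumes "s < d2" "t < d3" "s' < d2" "t' < (d3::nat)"
  shows "(p * d2 + s) * d3 + t = (p' * d2 + s') * d3 + t' \<longleftrightarrow> p = p' \<and> s = s' \<and> t = t'"
  using assms by (simp add: flat2_eq_iff)

lemma uent_iso:
  assumes U: "U \<in> carrier_mat (dAI * dBI * dF) (dP * dAO * dBO)" "unitary_mat U"
    and i: "p < dP" "x < dAO" "y < dBO" "p' < dP" "x' < dAO" "y' < dBO"
  shows "(\<Sum>a<dAI. \<Sum>b<dBI. gram dF (uent dAO dBI dBO dF U) a b p x y a b p' x' y') = (if p = p' \<and> x = x' \<and> y = y' then 1 else 0)"
  using unitary_mat_cols(2)[OF U flat3_less[OF i(1-3)] flat3_less[OF i(4-6)]]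
  unfolding flat3_eq_iff[OF i(2,3,5,6)] sum_lessThan_mult gram_def uent_def .

lemma uent_coiso:
  assumes U: "U \<in> carrier_mat (dAI * dBI * dF) (dP * dAO * dBO)" "unitary_mat U"
    and i: "a < dAI" "b < dBI" "f < dF" "a' < dAI" "b' < dBI" "f' < dF"
  shows "(\<Sum>p<dP. \<Sum>x<dAO. \<Sum>y<dBO. uent dAO dBI dBO dF U a b f p x y * cnj (uent dAO dBI dBO dF U a' b' f' p x y))
    = (if a = a' \<and> b = b' \<and> f = f' then 1 else 0)"
  using unitary_mat_cols(3)[OF U flat3_less[OF i(1-3)] flat3_less[OF i(4-6)]]
  unfolding flat3_eq_iff[OF i(2,3,5,6)] sum_lessThan_mult uent_def .

text \<open>Adding the squared norms of all entries by rows and by columns gives n = m. This serves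
  the blocks of a direct sum, whose sizes are not known beforehand to match.\<close>

lemma unitary_mat_rectI:
  assumes V: "V \<in> carrier_mat n m"
    and c: "\<And>j j'. j < m \<Longrightarrow> j' < m \<Longrightarrow> (\<Sum>i<n. cnj (V $$ (i, j)) * V $$ (i, j')) = (if j = j' then 1 else 0)"
    and r: "\<And>i i'. i < n \<Longrightarrow> i' < n \<Longrightarrow> (\<Sum>j<m. V $$ (i, j) * cnj (V $$ (i', j))) = (if i = i' then 1 else 0)"
  shows "unitary_mat V"
proof -
  have "of_nat n = (\<Sum>i<n. \<Sum>j<m. V $$ (i, j) * cnj (V $$ (i, j)))" by (simp add: r)
  also have "\<dots> = (\<Sum>j<m. \<Sum>i<n. cnj (V $$ (i, j)) * V $$ (i, j))"
    by (subst sum.swap) (simp add: mult.commute)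
  also have "\<dots> = (of_nat m :: complex)" by (simp add: c)
  finally have "n = m" by simp
  then show ?thesis using V c by (intro unitary_matI[of V n]) auto
qed

text \<open>Inverse of \<open>uent\<close>: a kernel in six tensor indices is flattened to a
  matrix.\<close>

definition umat :: "nat \<Rightarrow> nat \<Rightarrow> nat \<Rightarrow> nat \<Rightarrow> nat \<Rightarrow> nat \<Rightarrow> (nat \<Rightarrow> nat \<Rightarrow> nat \<Rightarrow> nat \<Rightarrow> nat \<Rightarrow> nat \<Rightarrow> complex) \<Rightarrow> complex mat" where
  "umat dP dAI dAO dBI dBO dF w = mat (dAI * dBI * dF) (dP * dAO * dBO) (\<lambda>(i, j).
     w (i div dF div dBI) (i div dF mod dBI) (i mod dF) (j div dBO div dAO) (j div dBO mod dAO) (j mod dBO))"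

lemma umat_carrier [simp]: "umat dP dAI dAO dBI dBO dF w \<in> carrier_mat (dAI * dBI * dF) (dP * dAO * dBO)"
  by (simp add: umat_def)

lemma uent_umat:
  assumes "a < dAI" "b < dBI" "f < dF" "p < dP" "x < dAO" "y < dBO"
  shows "uent dAO dBI dBO dF (umat dP dAI dAO dBI dBO dF w) a b f p x y = w a b f p x y"
  using flat3_less[OF assms(1-3)] flat3_less[OF assms(4-6)] assms by (simp add: uent_def umat_def)

lemma unitary_umat:
  assumes c: "\<And>p x y p' x' y'. p < dP \<Longrightarrow> x < dAO \<Longrightarrow> y < dBO \<Longrightarrow> p' < dP \<Longrightarrow> x' < dAO \<Longrightarrow> y' < dBO \<Longrightarrow>
      (\<Sum>a<dAI. \<Sum>b<dBI. gram dF w a b p x y a b p' x' y') = (if p = p' \<and> x = x' \<and> y = y' then 1 else 0)"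
    and r: "\<And>a b f a' b' f'. a < dAI \<Longrightarrow> b < dBI \<Longrightarrow> f < dF \<Longrightarrow> a' < dAI \<Longrightarrow> b' < dBI \<Longrightarrow> f' < dF \<Longrightarrow>
      (\<Sum>p<dP. \<Sum>x<dAO. \<Sum>y<dBO. w a b f p x y * cnj (w a' b' f' p x y)) = (if a = a' \<and> b = b' \<and> f = f' then 1 else 0)"
  shows "unitary_mat (umat dP dAI dAO dBI dBO dF w)"
proof (rule unitary_mat_rectI[OF umat_carrier])
  let ?V = "umat dP dAI dAO dBI dBO dF w"
  have e: "?V $$ ((a * dBI + b) * dF + f, (p * dAO + x) * dBO + y) = w a b f p x y"
    if "a < dAI" "b < dBI" "f < dF" "p < dP" "x < dAO" "y < dBO" for a b f p x y
    using uent_umat[OF that] by (simp add: uent_def)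
  {
    fix j j' assume "j < dP * dAO * dBO" "j' < dP * dAO * dBO"
    then obtain p x y p' x' y' where j: "p < dP" "x < dAO" "y < dBO" "j = (p * dAO + x) * dBO + y"
      and j': "p' < dP" "x' < dAO" "y' < dBO" "j' = (p' * dAO + x') * dBO + y'" by (elim flat3_cases)
    have "(\<Sum>i<dAI * dBI * dF. cnj (?V $$ (i, j)) * ?V $$ (i, j')) = (\<Sum>a<dAI. \<Sum>b<dBI. gram dF w a b p x y a b p' x' y')"
      unfolding sum_lessThan_mult gram_def j(4) j'(4) using j j' by (intro sum.cong refl) (simp add: e)
    also have "\<dots> = (if j = j' then 1 else 0)"
      unfolding c[OF j(1-3) j'(1-3)] j(4) j'(4) flat3_eq_iff[OF j(2,3) j'(2,3)] ..
    finally show "(\<Sum>i<dAI * dBI * dF. cnj (?V $$ (i, j)) * ?V $$ (i, j')) = (if j = j' then 1 else 0)" .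
  next
    fix i i' assume "i < dAI * dBI * dF" "i' < dAI * dBI * dF"
    then obtain a b f a' b' f' where i: "a < dAI" "b < dBI" "f < dF" "i = (a * dBI + b) * dF + f"
      and i': "a' < dAI" "b' < dBI" "f' < dF" "i' = (a' * dBI + b') * dF + f'" by (elim flat3_cases)
    have "(\<Sum>j<dP * dAO * dBO. ?V $$ (i, j) * cnj (?V $$ (i', j))) = (\<Sum>p<dP. \<Sum>x<dAO. \<Sum>y<dBO. w a b f p x y * cnj (w a' b' f' p x y))"
      unfolding sum_lessThan_mult i(4) i'(4) using i i' by (intro sum.cong refl) (simp add: e)
    also have "\<dots> = (if i = i' then 1 else 0)"
      unfolding r[OF i(1-3) i'(1-3)] i(4) i'(4) flat3_eq_iff[OF i(2,3) i'(2,3)] ..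
    finally show "(\<Sum>j<dP * dAO * dBO. ?V $$ (i, j) * cnj (?V $$ (i', j))) = (if i = i' then 1 else 0)" .
  }
qed

text \<open>The comb equations with \<open>R2\<close> and \<open>R1\<close> eliminated, since these
  are forced to be slices at output index 0.\<close>

definition comb_gram where
  "comb_gram dP dAI dAO dBI dBO g \<longleftrightarrow>
    (\<forall>a<dAI. \<forall>b<dBI. \<forall>p<dP. \<forall>x<dAO. \<forall>y<dBO. \<forall>a'<dAI. \<forall>b'<dBI. \<forall>p'<dP. \<forall>x'<dAO. \<forall>y'<dBO.
      g a b p x y a' b' p' x' y' = (if y = y' then g a b p x 0 a' b' p' x' 0 else 0)) \<and>
    (\<forall>a<dAI. \<forall>p<dP. \<forall>x<dAO. \<forall>a'<dAI. \<forall>p'<dP. \<forall>x'<dAO.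
      (\<Sum>b<dBI. g a b p x 0 a' b p' x' 0) = (if x = x' then \<Sum>b<dBI. g a b p 0 0 a' b p' 0 0 else (0::complex)))"

lemma comb_gramD:
  assumes "comb_gram dP dAI dAO dBI dBO g" "p < dP" "x < dAO" "p' < dP" "x' < dAO" "a < dAI" "a' < dAI"
  shows "b < dBI \<Longrightarrow> y < dBO \<Longrightarrow> b' < dBI \<Longrightarrow> y' < dBO \<Longrightarrow>
      g a b p x y a' b' p' x' y' = (if y = y' then g a b p x 0 a' b' p' x' 0 else 0)"
    and "(\<Sum>b<dBI. g a b p x 0 a' b p' x' 0) = (if x = x' then \<Sum>b<dBI. g a b p 0 0 a' b p' 0 0 else 0)"
proof -
  assume j: "b < dBI" "y < dBO" "b' < dBI" "y' < dBO"
  show "g a b p x y a' b' p' x' y' = (if y = y' then g a b p x 0 a' b' p' x' 0 else 0)"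
    by (rule conjunct1[OF assms(1)[unfolded comb_gram_def], rule_format]) (use assms j in auto)
next
  show "(\<Sum>b<dBI. g a b p x 0 a' b p' x' 0) = (if x = x' then \<Sum>b<dBI. g a b p 0 0 a' b p' 0 0 else 0)"
    by (rule conjunct2[OF assms(1)[unfolded comb_gram_def], rule_format]) (use assms in auto)
qed

text \<open>If \<open>g\<close> is proportional to the identity on B_O, the two terms with A_O at
  the reference index cancel in (a), and (b) is immediate. Condition (c) is the second comb
  equation, repeated on the diagonal y = y'.\<close>

lemma comb_gram_imp_slot_conds:
  assumes c: "comb_gram dP dAI dAO dBI dBO g" and pos: "0 < dAO" "0 < dBO"
  shows "slot_conds dP dAI dAO dBI dBO g"
  unfolding slot_conds_def slot_cond_AB_def slot_cond_B_def slot_cond_A_def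
proof (intro conjI allI impI)
  fix a b p x y a' b' p' x' y'
  assume i: "a < dAI" "b < dBI" "p < dP" "x < dAO" "y < dBO" "a' < dAI" "b' < dBI" "p' < dP" "x' < dAO" "y' < dBO"
  have 1: "g a b p x y a' b' p' x' y' = (if y = y' then g a b p x 0 a' b' p' x' 0 else 0)"
    by (rule comb_gramD(1)[OF c]) (use i in auto)
  have 2: "g a b p 0 y a' b' p' 0 y' = (if y = y' then g a b p 0 0 a' b' p' 0 0 else 0)"
    by (rule comb_gramD(1)[OF c]) (use i pos in auto)
  show "g a b p x y a' b' p' x' y' = (if x = x' then g a b p 0 y a' b' p' 0 y' else 0)
      + (if y = y' then g a b p x 0 a' b' p' x' 0 else 0) - (if x = x' \<and> y = y' then g a b p 0 0 a' b' p' 0 0 else 0)"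
    unfolding 1 2 by (cases "x = x'"; cases "y = y'") simp_all
next
  fix b p x y b' p' x' y'
  assume i: "b < dBI" "p < dP" "x < dAO" "y < dBO" "b' < dBI" "p' < dP" "x' < dAO" "y' < dBO"
  have "(\<Sum>a<dAI. g a b p x y a b' p' x' y') = (\<Sum>a<dAI. if y = y' then g a b p x 0 a b' p' x' 0 else 0)"
    by (intro sum.cong refl comb_gramD(1)[OF c]) (use i in auto)
  then show "(\<Sum>a<dAI. g a b p x y a b' p' x' y') = (if y = y' then \<Sum>a<dAI. g a b p x 0 a b' p' x' 0 else 0)" by simp
next
  fix a p x y a' p' x' y'
  assume i: "a < dAI" "p < dP" "x < dAO" "y < dBO" "a' < dAI" "p' < dP" "x' < dAO" "y' < dBO"
  have e: "(\<Sum>b<dBI. g a b p x y a' b p' x' y') = (if y = y' then \<Sum>b<dBI. g a b p x 0 a' b p' x' 0 else 0)"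
    if "x < dAO" "x' < dAO" for x x'
  proof -
    have "(\<Sum>b<dBI. g a b p x y a' b p' x' y') = (\<Sum>b<dBI. if y = y' then g a b p x 0 a' b p' x' 0 else 0)"
      by (intro sum.cong refl comb_gramD(1)[OF c]) (use i that in auto)
    then show ?thesis by simp
  qed
  have "(\<Sum>b<dBI. g a b p x 0 a' b p' x' 0) = (if x = x' then \<Sum>b<dBI. g a b p 0 0 a' b p' 0 0 else 0)"
    by (rule comb_gramD(2)[OF c]) (use i in auto)
  then show "(\<Sum>b<dBI. g a b p x y a' b p' x' y') = (if x = x' then \<Sum>b<dBI. g a b p 0 y a' b p' 0 y' else 0)"
    unfolding e[OF i(3,7)] e[OF pos(1) pos(1)] by (cases "x = x'"; cases "y = y'") simp_all
qed

lemma psd_repW: "psd (prod_list ds) (repW ds U)"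
proof -
  have "psdf (prod_list ds) (\<lambda>i j. repW ds U $$ (i, j))"
    by (rule psdfI_gram[of "{0::nat}" _ _ "\<lambda>_ i. choivecU ds U $ i"]) (simp_all add: repW_def)
  then show ?thesis by (simp add: psd_iff_psdf repW_def)
qed

lemma repW_trace_F:
  assumes "p < dP" "a < dAI" "x < dAO" "b < dBI" "y < dBO" "p' < dP" "a' < dAI" "x' < dAO" "b' < dBI" "y' < dBO"
  shows "(\<Sum>f<dF. ent [dP, dAI, dAO, dBI, dBO, dF] (repW [dP, dAI, dAO, dBI, dBO, dF] U) [p, a, x, b, y, f] [p', a', x', b', y', f])
    = cnj (gram dF (uent dAO dBI dBO dF U) a b p x y a' b' p' x' y')"
  unfolding ent_def gram_def cnj_sum by (intro sum.cong refl) (subst repW_index, use assms in auto)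

text \<open>Tr_F of |U>><<U| is the conjugate Gram kernel, so the comb equations are conditions on
  that kernel. The normalisation of \<open>R1\<close> is the isometry hypothesis, and the
  superchannel property follows from the slot conditions.\<close>

lemma comb_AB_iff:
  assumes pos: "0 < dAO" "0 < dBO"
    and nrm: "\<And>p p'. p < dP \<Longrightarrow> p' < dP \<Longrightarrow> (\<Sum>a<dAI. \<Sum>b<dBI. gram dF (uent dAO dBI dBO dF U) a b p 0 0 a b p' 0 0) = (if p = p' then 1 else 0)"
  shows "comb_AB [dP, dAI, dAO, dBI, dBO, dF] (repW [dP, dAI, dAO, dBI, dBO, dF] U)
    \<longleftrightarrow> comb_gram dP dAI dAO dBI dBO (gram dF (uent dAO dBI dBO dF U))"
proof -
  let ?ds = "[dP, dAI, dAO, dBI, dBO, dF]" and ?d4 = "[dP, dAI, dAO, dBI]"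
  define g where "g = gram dF (uent dAO dBI dBO dF U)"
  have tk: "take 5 ?ds = [dP, dAI, dAO, dBI, dBO]" "take 4 ?ds = ?d4" "take 3 ?ds = [dP, dAI, dAO]" "take 2 ?ds = [dP, dAI]"
    and n: "?ds ! 0 = dP" "?ds ! 1 = dAI" "?ds ! 3 = dBI" "?ds ! 5 = dF" by simp_all
  have nr: "\<exists>R2 R1. P R2 R1" if "P R2 R1" for P :: "complex mat \<Rightarrow> complex mat \<Rightarrow> bool" and R2 R1 using that by blast
  show ?thesis
  proof
    assume "comb_AB ?ds (repW ?ds U)"
    then obtain R2 R1 where
      R2: "\<And>x y. x \<in> tuples [dP, dAI, dAO, dBI, dBO] \<Longrightarrow> y \<in> tuples [dP, dAI, dAO, dBI, dBO] \<Longrightarrow>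
        (\<Sum>f<dF. ent ?ds (repW ?ds U) (x @ [f]) (y @ [f])) = (if x!4 = y!4 then ent ?d4 R2 (take 4 x) (take 4 y) else 0)"
      and R1: "\<And>x y. x \<in> tuples [dP, dAI, dAO] \<Longrightarrow> y \<in> tuples [dP, dAI, dAO] \<Longrightarrow>
          (\<Sum>b<dBI. ent ?d4 R2 (x @ [b]) (y @ [b])) = (if x!2 = y!2 then ent [dP, dAI] R1 (take 2 x) (take 2 y) else 0)"
      unfolding comb_AB_def tk n by blast
    have 1: "cnj (g a b p x y a' b' p' x' y') = (if y = y' then ent ?d4 R2 [p, a, x, b] [p', a', x', b'] else 0)"
      if "p < dP" "a < dAI" "x < dAO" "b < dBI" "y < dBO" "p' < dP" "a' < dAI" "x' < dAO" "b' < dBI" "y' < dBO" for a b p x y a' b' p' x' y'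
      using R2[of "[p, a, x, b, y]" "[p', a', x', b', y']"] repW_trace_F[OF that, of dF U] that by (simp add: g_def)
    have 2: "ent ?d4 R2 [p, a, x, b] [p', a', x', b'] = cnj (g a b p x 0 a' b' p' x' 0)"
      if "p < dP" "a < dAI" "x < dAO" "b < dBI" "p' < dP" "a' < dAI" "x' < dAO" "b' < dBI" for a b p x a' b' p' x'
      using 1[OF that(1-4) pos(2) that(5-8) pos(2)] by simp
    have 3: "cnj (\<Sum>b<dBI. g a b p x 0 a' b p' x' 0) = (if x = x' then ent [dP, dAI] R1 [p, a] [p', a'] else 0)"
      if "p < dP" "a < dAI" "x < dAO" "p' < dP" "a' < dAI" "x' < dAO" for a p x a' p' x'
    proof -
      have "cnj (\<Sum>b<dBI. g a b p x 0 a' b p' x' 0) = (\<Sum>b<dBI. ent ?d4 R2 ([p, a, x] @ [b]) ([p', a', x'] @ [b]))"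
        unfolding cnj_sum using that by (intro sum.cong refl) (simp add: 2)
      also have "\<dots> = (if x = x' then ent [dP, dAI] R1 [p, a] [p', a'] else 0)"
        using R1[of "[p, a, x]" "[p', a', x']"] that by simp
      finally show ?thesis .
    qed
    have "comb_gram dP dAI dAO dBI dBO g"
      unfolding comb_gram_def
    proof (intro conjI allI impI)
      fix a b p x y a' b' p' x' y'
      assume i: "a < dAI" "b < dBI" "p < dP" "x < dAO" "y < dBO" "a' < dAI" "b' < dBI" "p' < dP" "x' < dAO" "y' < dBO"
      have "cnj (g a b p x y a' b' p' x' y') = cnj (if y = y' then g a b p x 0 a' b' p' x' 0 else 0)"
        unfolding 1[OF i(3,1,4,2,5,8,6,9,7,10)] 2[OF i(3,1,4,2,8,6,9,7)] by simp
      then show "g a b p x y a' b' p' x' y' = (if y = y' then g a b p x 0 a' b' p' x' 0 else 0)"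
        by (simp only: complex_cnj_cancel_iff)
    next
      fix a p x a' p' x'
      assume i: "a < dAI" "p < dP" "x < dAO" "a' < dAI" "p' < dP" "x' < dAO"
      have "cnj (\<Sum>b<dBI. g a b p x 0 a' b p' x' 0) = cnj (if x = x' then \<Sum>b<dBI. g a b p 0 0 a' b p' 0 0 else 0)"
        using 3[OF i(2,1,3,5,4,6)] 3[OF i(2,1) pos(1) i(5,4) pos(1)] by (cases "x = x'") simp_all
      then show "(\<Sum>b<dBI. g a b p x 0 a' b p' x' 0) = (if x = x' then \<Sum>b<dBI. g a b p 0 0 a' b p' 0 0 else 0)"
        by (simp only: complex_cnj_cancel_iff)
    qed
    then show "comb_gram dP dAI dAO dBI dBO (gram dF (uent dAO dBI dBO dF U))" by (simp add: g_def)
  next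
    assume c: "comb_gram dP dAI dAO dBI dBO (gram dF (uent dAO dBI dBO dF U))"
    \<comment> \<open>The conjugated kernel at y = 0; for \<open>R1\<close> it is also taken at x =
      0, after tracing out B_I.\<close>
    define R2 where "R2 = mat (prod_list ?d4) (prod_list ?d4) (\<lambda>(i, j). let s = dec ?d4 i; t = dec ?d4 j in
       cnj (g (s!1) (s!3) (s!0) (s!2) 0 (t!1) (t!3) (t!0) (t!2) 0))"
    define R1 where "R1 = mat (prod_list [dP, dAI]) (prod_list [dP, dAI]) (\<lambda>(i, j). let s = dec [dP, dAI] i; t = dec [dP, dAI] j in
       cnj (\<Sum>b<dBI. g (s!1) b (s!0) 0 0 (t!1) b (t!0) 0 0))"
    have R2: "ent ?d4 R2 [p, a, x, b] [p', a', x', b'] = cnj (g a b p x 0 a' b' p' x' 0)"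
      if "p < dP" "a < dAI" "x < dAO" "b < dBI" "p' < dP" "a' < dAI" "x' < dAO" "b' < dBI" for a b p x a' b' p' x'
    proof -
      have t: "[p, a, x, b] \<in> tuples ?d4" "[p', a', x', b'] \<in> tuples ?d4" using that by simp_all
      show ?thesis
        unfolding ent_def R2_def index_mat(1)[OF enc_less[OF t(1)] enc_less[OF t(2)]] prod.case dec_enc[OF t(1)] dec_enc[OF t(2)] Let_def
        by simp
    qed
    have R1: "ent [dP, dAI] R1 [p, a] [p', a'] = cnj (\<Sum>b<dBI. g a b p 0 0 a' b p' 0 0)"
      if "p < dP" "a < dAI" "p' < dP" "a' < dAI" for a p a' p'
    proof -
      have t: "[p, a] \<in> tuples [dP, dAI]" "[p', a'] \<in> tuples [dP, dAI]" using that by simp_all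
      show ?thesis
        unfolding ent_def R1_def index_mat(1)[OF enc_less[OF t(1)] enc_less[OF t(2)]] prod.case dec_enc[OF t(1)] dec_enc[OF t(2)] Let_def
        by simp
    qed
    show "comb_AB ?ds (repW ?ds U)"
      unfolding comb_AB_def
    proof (intro conjI nr[of _ R2 R1])
      show "superchannel ?ds (repW ?ds U)"
        by (rule superchannel_repW[OF comb_gram_imp_slot_conds[OF c pos] pos nrm])
      show "psd (prod_list ?ds) (repW ?ds U)" by (rule psd_repW)
      show "R2 \<in> carrier_mat (prod_list (take 4 ?ds)) (prod_list (take 4 ?ds))" unfolding tk R2_def by simp
      show "R1 \<in> carrier_mat (prod_list (take 2 ?ds)) (prod_list (take 2 ?ds))" unfolding tk R1_def by simp
      show "\<forall>s\<in>tuples (take 5 ?ds). \<forall>t\<in>tuples (take 5 ?ds). (\<Sum>f<?ds!5. ent ?ds (repW ?ds U) (s @ [f]) (t @ [f])) =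
          (if s!4 = t!4 then ent (take 4 ?ds) R2 (take 4 s) (take 4 t) else 0)"
        unfolding tk n
      proof (intro ballI)
        fix s t assume "s \<in> tuples [dP, dAI, dAO, dBI, dBO]" "t \<in> tuples [dP, dAI, dAO, dBI, dBO]"
        then obtain p a x b y p' a' x' b' y' where s: "s = [p, a, x, b, y]" and t: "t = [p', a', x', b', y']"
          and i: "p < dP" "a < dAI" "x < dAO" "b < dBI" "y < dBO" "p' < dP" "a' < dAI" "x' < dAO" "b' < dBI" "y' < dBO"
          by (auto simp: tuples_Cons)
        have "g a b p x y a' b' p' x' y' = (if y = y' then g a b p x 0 a' b' p' x' 0 else 0)"
          unfolding g_def by (rule comb_gramD(1)[OF c]) (use i in auto)
        then show "(\<Sum>f<dF. ent ?ds (repW ?ds U) (s @ [f]) (t @ [f])) = (if s!4 = t!4 then ent ?d4 R2 (take 4 s) (take 4 t) else 0)"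
          using repW_trace_F[OF i, of dF U] R2[OF i(1-4,6-9)] unfolding s t g_def[symmetric] by simp
      qed
      show "\<forall>s\<in>tuples (take 3 ?ds). \<forall>t\<in>tuples (take 3 ?ds). (\<Sum>b<?ds!3. ent (take 4 ?ds) R2 (s @ [b]) (t @ [b])) =
          (if s!2 = t!2 then ent (take 2 ?ds) R1 (take 2 s) (take 2 t) else 0)"
        unfolding tk n
      proof (intro ballI)
        fix s t assume "s \<in> tuples [dP, dAI, dAO]" "t \<in> tuples [dP, dAI, dAO]"
        then obtain p a x p' a' x' where s: "s = [p, a, x]" and t: "t = [p', a', x']"
          and i: "p < dP" "a < dAI" "x < dAO" "p' < dP" "a' < dAI" "x' < dAO" by (auto simp: tuples_Cons)
        have "(\<Sum>b<dBI. ent ?d4 R2 (s @ [b]) (t @ [b])) = cnj (\<Sum>b<dBI. g a b p x 0 a' b p' x' 0)"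
          unfolding s t cnj_sum using i by (intro sum.cong refl) (simp add: R2)
        also have "(\<Sum>b<dBI. g a b p x 0 a' b p' x' 0) = (if x = x' then \<Sum>b<dBI. g a b p 0 0 a' b p' 0 0 else 0)"
          unfolding g_def by (rule comb_gramD(2)[OF c]) (use i in auto)
        finally show "(\<Sum>b<dBI. ent ?d4 R2 (s @ [b]) (t @ [b])) = (if s!2 = t!2 then ent [dP, dAI] R1 (take 2 s) (take 2 t) else 0)"
          using R1[OF i(1,2,4,5)] unfolding s t by simp
      qed
      show "\<forall>p<?ds!0. \<forall>p'<?ds!0. (\<Sum>a<?ds!1. ent (take 2 ?ds) R1 [p, a] [p', a]) = (if p = p' then 1 else 0)"
        unfolding tk n
      proof (intro allI impI)
        fix p p' assume p: "p < dP" "p' < dP"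
        have "(\<Sum>a<dAI. ent [dP, dAI] R1 [p, a] [p', a]) = cnj (\<Sum>a<dAI. \<Sum>b<dBI. g a b p 0 0 a b p' 0 0)"
          using p by (simp add: R1)
        then show "(\<Sum>a<dAI. ent [dP, dAI] R1 [p, a] [p', a]) = (if p = p' then 1 else 0)"
          unfolding g_def nrm[OF p] by simp
      qed
    qed
  qed
qed

section \<open>Exchange of the two slots\<close>

definition swapU :: "nat \<Rightarrow> nat \<Rightarrow> nat \<Rightarrow> nat \<Rightarrow> nat \<Rightarrow> nat \<Rightarrow> complex mat \<Rightarrow> complex mat" where
  "swapU dP dAI dAO dBI dBO dF U = umat dP dBI dBO dAI dAO dF (\<lambda>b a f p y x. uent dAO dBI dBO dF U a b f p x y)"

lemma gram_swapU:
  assumes "a < dAI" "b < dBI" "p < dP" "x < dAO" "y < dBO" "a' < dAI" "b' < dBI" "p' < dP" "x' < dAO" "y' < dBO"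
  shows "gram dF (uent dBO dAI dAO dF (swapU dP dAI dAO dBI dBO dF U)) b a p y x b' a' p' y' x'
    = gram dF (uent dAO dBI dBO dF U) a b p x y a' b' p' x' y'"
  unfolding gram_def swapU_def using assms by (intro sum.cong refl) (simp add: uent_umat)

text \<open>Reordering the factors of |U>><<U| only relabels the tensor indices of U; in this way
  the order B before A is reduced to A before B for \<open>swapU\<close>.\<close>

lemma swapW_repW:
  "swapW [dP, dAI, dAO, dBI, dBO, dF] (repW [dP, dAI, dAO, dBI, dBO, dF] U)
    = repW [dP, dBI, dBO, dAI, dAO, dF] (swapU dP dAI dAO dBI dBO dF U)"
proof (rule eq_matI)
  let ?ds = "[dP, dAI, dAO, dBI, dBO, dF]" and ?sw = "[dP, dBI, dBO, dAI, dAO, dF]"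
  have sw: "swp ?ds = ?sw" by (simp add: swp_def)
  have pl: "prod_list ?ds = prod_list ?sw" by simp
  fix i j assume "i < dim_row (repW ?sw (swapU dP dAI dAO dBI dBO dF U))" "j < dim_col (repW ?sw (swapU dP dAI dAO dBI dBO dF U))"
  then have ij: "i < prod_list ?sw" "j < prod_list ?sw" by (simp_all add: repW_def)
  obtain p b y a x f p' b' y' a' x' f' where d: "dec ?sw i = [p, b, y, a, x, f]" "dec ?sw j = [p', b', y', a', x', f']" by simp
  have t: "[p, b, y, a, x, f] \<in> tuples ?sw" "[p', b', y', a', x', f'] \<in> tuples ?sw"
    and e: "i = enc ?sw [p, b, y, a, x, f]" "j = enc ?sw [p', b', y', a', x', f']"
    using enc_dec[OF ij(1)] enc_dec[OF ij(2)] unfolding d by simp_all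
  have "swapW ?ds (repW ?ds U) $$ (i, j) = ent ?ds (repW ?ds U) [p, a, x, b, y, f] [p', a', x', b', y', f']"
    using ij unfolding swapW_def pl sw by (simp add: d swp_def del: dec_Cons prod_list.Cons)
  also have "\<dots> = uent dAO dBI dBO dF U a b f p x y * cnj (uent dAO dBI dBO dF U a' b' f' p' x' y')"
    unfolding ent_def by (rule repW_index) (use t in auto)
  also have "\<dots> = repW ?sw (swapU dP dAI dAO dBI dBO dF U) $$ (i, j)"
    unfolding e by (subst repW_index) (use t in \<open>auto simp: swapU_def uent_umat\<close>)
  finally show "swapW ?ds (repW ?ds U) $$ (i, j) = repW ?sw (swapU dP dAI dAO dBI dBO dF U) $$ (i, j)" .
qed (simp_all add: swapW_def repW_def)

lemma comb_BA_iff: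
  assumes pos: "0 < dAO" "0 < dBO"
    and nrm: "\<And>p p'. p < dP \<Longrightarrow> p' < dP \<Longrightarrow> (\<Sum>a<dAI. \<Sum>b<dBI. gram dF (uent dAO dBI dBO dF U) a b p 0 0 a b p' 0 0) = (if p = p' then 1 else 0)"
  shows "comb_BA [dP, dAI, dAO, dBI, dBO, dF] (repW [dP, dAI, dAO, dBI, dBO, dF] U)
    \<longleftrightarrow> comb_gram dP dBI dBO dAI dAO (\<lambda>b a p y x b' a' p' y' x'. gram dF (uent dAO dBI dBO dF U) a b p x y a' b' p' x' y')"
proof -
  let ?g = "gram dF (uent dBO dAI dAO dF (swapU dP dAI dAO dBI dBO dF U))" and ?g' = "gram dF (uent dAO dBI dBO dF U)"
  have sw: "swp [dP, dAI, dAO, dBI, dBO, dF] = [dP, dBI, dBO, dAI, dAO, dF]" by (simp add: swp_def)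
  have "(\<Sum>b<dBI. \<Sum>a<dAI. ?g b a p 0 0 b a p' 0 0) = (if p = p' then 1 else 0)" if "p < dP" "p' < dP" for p p'
  proof -
    have "(\<Sum>b<dBI. \<Sum>a<dAI. ?g b a p 0 0 b a p' 0 0) = (\<Sum>b<dBI. \<Sum>a<dAI. ?g' a b p 0 0 a b p' 0 0)"
      using that pos by (intro sum.cong refl) (simp add: gram_swapU)
    also have "\<dots> = (\<Sum>a<dAI. \<Sum>b<dBI. ?g' a b p 0 0 a b p' 0 0)" by (rule sum.swap)
    finally show ?thesis using nrm[OF that] by simp
  qed
  then have "comb_BA [dP, dAI, dAO, dBI, dBO, dF] (repW [dP, dAI, dAO, dBI, dBO, dF] U) \<longleftrightarrow> comb_gram dP dBI dBO dAI dAO ?g"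
    unfolding comb_BA_def sw swapW_repW by (rule comb_AB_iff[OF pos(2,1)])
  also have "\<dots> \<longleftrightarrow> comb_gram dP dBI dBO dAI dAO (\<lambda>b a p y x b' a' p' y' x'. ?g' a b p x y a' b' p' x' y')"
    unfolding comb_gram_def using pos by (simp add: gram_swapU cong: sum.cong_simp)
  finally show ?thesis .
qed

lemma slot_conds_swap:
  assumes "slot_conds dP dBI dBO dAI dAO (\<lambda>b a p y x b' a' p' y' x'. g a b p x y a' b' p' x' y')"
  shows "slot_conds dP dAI dAO dBI dBO g"
proof -
  let ?h = "\<lambda>b a p y x b' a' p' y' x'. g a b p x y a' b' p' x' y'"
  have AB: "slot_cond_AB dP dBI dBO dAI dAO ?h" and B: "slot_cond_B dP dBI dBO dAI dAO ?h"
    and A: "slot_cond_A dP dBI dBO dAI dAO ?h" using assms by (simp_all add: slot_conds_def)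
  show ?thesis
    unfolding slot_conds_def
  proof (intro conjI)
    show "slot_cond_AB dP dAI dAO dBI dBO g"
      unfolding slot_cond_AB_def
    proof (intro allI impI)
      fix a b p x y a' b' p' x' y'
      assume i: "a < dAI" "b < dBI" "p < dP" "x < dAO" "y < dBO" "a' < dAI" "b' < dBI" "p' < dP" "x' < dAO" "y' < dBO"
      from AB[unfolded slot_cond_AB_def, rule_format, OF i(2,1,3,5,4,7,6,8,10,9)]
      show "g a b p x y a' b' p' x' y' = (if x = x' then g a b p 0 y a' b' p' 0 y' else 0)
        + (if y = y' then g a b p x 0 a' b' p' x' 0 else 0) - (if x = x' \<and> y = y' then g a b p 0 0 a' b' p' 0 0 else 0)"
        by (cases "x = x'"; cases "y = y'") simp_all
    qed
    show "slot_cond_B dP dAI dAO dBI dBO g"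
      unfolding slot_cond_B_def
    proof (intro allI impI)
      fix b p x y b' p' x' y'
      assume i: "b < dBI" "p < dP" "x < dAO" "y < dBO" "b' < dBI" "p' < dP" "x' < dAO" "y' < dBO"
      from A[unfolded slot_cond_A_def, rule_format, OF i(1,2,4,3,5,6,8,7)]
      show "(\<Sum>a<dAI. g a b p x y a b' p' x' y') = (if y = y' then \<Sum>a<dAI. g a b p x 0 a b' p' x' 0 else 0)" .
    qed
    show "slot_cond_A dP dAI dAO dBI dBO g"
      unfolding slot_cond_A_def
    proof (intro allI impI)
      fix a p x y a' p' x' y'
      assume i: "a < dAI" "p < dP" "x < dAO" "y < dBO" "a' < dAI" "p' < dP" "x' < dAO" "y' < dBO"
      from B[unfolded slot_cond_B_def, rule_format, OF i(1,2,4,3,5,6,8,7)]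
      show "(\<Sum>b<dBI. g a b p x y a' b p' x' y') = (if x = x' then \<Sum>b<dBI. g a b p 0 y a' b p' 0 y' else 0)" .
    qed
  qed
qed

section \<open>Direct sums\<close>

text \<open>The conditions do not mix different pairs p, p' and are linear in the kernel. Fixing the
  pair, encoded by a one-dimensional P, turns them into a linear space of kernels.\<close>

definition slot_at where
  "slot_at dAI dAO dBI dBO K \<longleftrightarrow> slot_conds 1 dAI dAO dBI dBO (\<lambda>a b (p::nat) x y a' b' (p'::nat) x' y'. K a b x y a' b' x' y')"

lemma slot_atD:
  assumes "slot_at dAI dAO dBI dBO K"
  shows "a < dAI \<Longrightarrow> b < dBI \<Longrightarrow> x < dAO \<Longrightarrow> y < dBO \<Longrightarrow> a' < dAI \<Longrightarrow> b' < dBI \<Longrightarrow> x' < dAO \<Longrightarrow> y' < dBO \<Longrightarrow>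
      K a b x y a' b' x' y' = (if x = x' then K a b 0 y a' b' 0 y' else 0)
      + (if y = y' then K a b x 0 a' b' x' 0 else 0) - (if x = x' \<and> y = y' then K a b 0 0 a' b' 0 0 else 0)"
    and "b < dBI \<Longrightarrow> x < dAO \<Longrightarrow> y < dBO \<Longrightarrow> b' < dBI \<Longrightarrow> x' < dAO \<Longrightarrow> y' < dBO \<Longrightarrow>
      (\<Sum>a<dAI. K a b x y a b' x' y') = (if y = y' then \<Sum>a<dAI. K a b x 0 a b' x' 0 else 0)"
    and "a < dAI \<Longrightarrow> x < dAO \<Longrightarrow> y < dBO \<Longrightarrow> a' < dAI \<Longrightarrow> x' < dAO \<Longrightarrow> y' < dBO \<Longrightarrow>
      (\<Sum>b<dBI. K a b x y a' b x' y') = (if x = x' then \<Sum>b<dBI. K a b 0 y a' b 0 y' else 0)"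
proof -
  note s = assms[unfolded slot_at_def slot_conds_def slot_cond_AB_def slot_cond_B_def slot_cond_A_def]
  show "a < dAI \<Longrightarrow> b < dBI \<Longrightarrow> x < dAO \<Longrightarrow> y < dBO \<Longrightarrow> a' < dAI \<Longrightarrow> b' < dBI \<Longrightarrow> x' < dAO \<Longrightarrow> y' < dBO \<Longrightarrow>
      K a b x y a' b' x' y' = (if x = x' then K a b 0 y a' b' 0 y' else 0)
      + (if y = y' then K a b x 0 a' b' x' 0 else 0) - (if x = x' \<and> y = y' then K a b 0 0 a' b' 0 0 else 0)"
    by (rule conjunct1[OF s, rule_format, where p = 0 and p' = 0]) auto
  show "b < dBI \<Longrightarrow> x < dAO \<Longrightarrow> y < dBO \<Longrightarrow> b' < dBI \<Longrightarrow> x' < dAO \<Longrightarrow> y' < dBO \<Longrightarrow>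
      (\<Sum>a<dAI. K a b x y a b' x' y') = (if y = y' then \<Sum>a<dAI. K a b x 0 a b' x' 0 else 0)"
    by (rule conjunct1[OF conjunct2[OF s], rule_format, where p = 0 and p' = 0]) auto
  show "a < dAI \<Longrightarrow> x < dAO \<Longrightarrow> y < dBO \<Longrightarrow> a' < dAI \<Longrightarrow> x' < dAO \<Longrightarrow> y' < dBO \<Longrightarrow>
      (\<Sum>b<dBI. K a b x y a' b x' y') = (if x = x' then \<Sum>b<dBI. K a b 0 y a' b 0 y' else 0)"
    by (rule conjunct2[OF conjunct2[OF s], rule_format, where p = 0 and p' = 0]) auto
qed

lemma slot_conds_iff_slot_at:
  "slot_conds dP dAI dAO dBI dBO g \<longleftrightarrow>
    (\<forall>p<dP. \<forall>p'<dP. slot_at dAI dAO dBI dBO (\<lambda>a b x y a' b' x' y'. g a b p x y a' b' p' x' y'))"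
proof
  assume "slot_conds dP dAI dAO dBI dBO g"
  then have AB: "slot_cond_AB dP dAI dAO dBI dBO g" and B: "slot_cond_B dP dAI dAO dBI dBO g"
    and A: "slot_cond_A dP dAI dAO dBI dBO g" by (simp_all add: slot_conds_def)
  show "\<forall>p<dP. \<forall>p'<dP. slot_at dAI dAO dBI dBO (\<lambda>a b x y a' b' x' y'. g a b p x y a' b' p' x' y')"
  proof (intro allI impI)
    fix p p' assume p: "p < dP" "p' < dP"
    show "slot_at dAI dAO dBI dBO (\<lambda>a b x y a' b' x' y'. g a b p x y a' b' p' x' y')"
      unfolding slot_at_def slot_conds_def
    proof (intro conjI)
      show "slot_cond_AB 1 dAI dAO dBI dBO (\<lambda>a b q x y a' b' q' x' y'. g a b p x y a' b' p' x' y')"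
        unfolding slot_cond_AB_def
        by (intro allI impI AB[unfolded slot_cond_AB_def, rule_format, where p = p and p' = p'] p)
      show "slot_cond_B 1 dAI dAO dBI dBO (\<lambda>a b q x y a' b' q' x' y'. g a b p x y a' b' p' x' y')"
        unfolding slot_cond_B_def
        by (intro allI impI B[unfolded slot_cond_B_def, rule_format, where p = p and p' = p'] p)
      show "slot_cond_A 1 dAI dAO dBI dBO (\<lambda>a b q x y a' b' q' x' y'. g a b p x y a' b' p' x' y')"
        unfolding slot_cond_A_def
        by (intro allI impI A[unfolded slot_cond_A_def, rule_format, where p = p and p' = p'] p)
    qed
  qed
next
  assume "\<forall>p<dP. \<forall>p'<dP. slot_at dAI dAO dBI dBO (\<lambda>a b x y a' b' x' y'. g a b p x y a' b' p' x' y')"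
  then have s: "slot_at dAI dAO dBI dBO (\<lambda>a b x y a' b' x' y'. g a b p x y a' b' p' x' y')" if "p < dP" "p' < dP" for p p'
    using that by blast
  show "slot_conds dP dAI dAO dBI dBO g"
    unfolding slot_conds_def slot_cond_AB_def slot_cond_B_def slot_cond_A_def
    by (intro conjI allI impI) (rule slot_atD[OF s]; assumption)+
qed

lemma slot_atI:
  assumes "\<And>a b x y a' b' x' y'. a < dAI \<Longrightarrow> b < dBI \<Longrightarrow> x < dAO \<Longrightarrow> y < dBO \<Longrightarrow> a' < dAI \<Longrightarrow> b' < dBI \<Longrightarrow> x' < dAO \<Longrightarrow> y' < dBO \<Longrightarrow>
      K a b x y a' b' x' y' = (if x = x' then K a b 0 y a' b' 0 y' else 0)
      + (if y = y' then K a b x 0 a' b' x' 0 else 0) - (if x = x' \<and> y = y' then K a b 0 0 a' b' 0 0 else 0)"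
    and "\<And>b x y b' x' y'. b < dBI \<Longrightarrow> x < dAO \<Longrightarrow> y < dBO \<Longrightarrow> b' < dBI \<Longrightarrow> x' < dAO \<Longrightarrow> y' < dBO \<Longrightarrow>
      (\<Sum>a<dAI. K a b x y a b' x' y') = (if y = y' then \<Sum>a<dAI. K a b x 0 a b' x' 0 else 0)"
    and "\<And>a x y a' x' y'. a < dAI \<Longrightarrow> x < dAO \<Longrightarrow> y < dBO \<Longrightarrow> a' < dAI \<Longrightarrow> x' < dAO \<Longrightarrow> y' < dBO \<Longrightarrow>
      (\<Sum>b<dBI. K a b x y a' b x' y') = (if x = x' then \<Sum>b<dBI. K a b 0 y a' b 0 y' else 0)"
  shows "slot_at dAI dAO dBI dBO K"
  unfolding slot_at_def slot_conds_def slot_cond_AB_def slot_cond_B_def slot_cond_A_def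
  by (intro conjI allI impI assms)

lemma slot_at_cong:
  assumes s: "slot_at dAI dAO dBI dBO K" and pos: "0 < dAO" "0 < dBO"
    and e: "\<And>a b x y a' b' x' y'. a < dAI \<Longrightarrow> b < dBI \<Longrightarrow> x < dAO \<Longrightarrow> y < dBO \<Longrightarrow> a' < dAI \<Longrightarrow> b' < dBI \<Longrightarrow> x' < dAO \<Longrightarrow> y' < dBO \<Longrightarrow>
      L a b x y a' b' x' y' = K a b x y a' b' x' y'"
  shows "slot_at dAI dAO dBI dBO L"
proof (rule slot_atI)
  fix a b x y a' b' x' y'
  assume i: "a < dAI" "b < dBI" "x < dAO" "y < dBO" "a' < dAI" "b' < dBI" "x' < dAO" "y' < dBO"
  show "L a b x y a' b' x' y' = (if x = x' then L a b 0 y a' b' 0 y' else 0)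
      + (if y = y' then L a b x 0 a' b' x' 0 else 0) - (if x = x' \<and> y = y' then L a b 0 0 a' b' 0 0 else 0)"
    using slot_atD(1)[OF s i] i pos by (simp only: e)
next
  fix b x y b' x' y'
  assume i: "b < dBI" "x < dAO" "y < dBO" "b' < dBI" "x' < dAO" "y' < dBO"
  have "(\<Sum>a<dAI. L a b x y a b' x' y') = (\<Sum>a<dAI. K a b x y a b' x' y')" "(\<Sum>a<dAI. L a b x 0 a b' x' 0) = (\<Sum>a<dAI. K a b x 0 a b' x' 0)"
    by (intro sum.cong refl e; use i pos in auto)+
  then show "(\<Sum>a<dAI. L a b x y a b' x' y') = (if y = y' then \<Sum>a<dAI. L a b x 0 a b' x' 0 else 0)"
    using slot_atD(2)[OF s i] by (simp only:)
next
  fix a x y a' x' y'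
  assume i: "a < dAI" "x < dAO" "y < dBO" "a' < dAI" "x' < dAO" "y' < dBO"
  have "(\<Sum>b<dBI. L a b x y a' b x' y') = (\<Sum>b<dBI. K a b x y a' b x' y')" "(\<Sum>b<dBI. L a b 0 y a' b 0 y') = (\<Sum>b<dBI. K a b 0 y a' b 0 y')"
    by (intro sum.cong refl e; use i pos in auto)+
  then show "(\<Sum>b<dBI. L a b x y a' b x' y') = (if x = x' then \<Sum>b<dBI. L a b 0 y a' b 0 y' else 0)"
    using slot_atD(3)[OF s i] by (simp only:)
qed

lemma slot_at_zero: "slot_at dAI dAO dBI dBO (\<lambda>a b x y a' b' x' y'. 0)"
  by (rule slot_atI) simp_all

lemma slot_at_sum:
  assumes s: "\<And>j. j \<in> J \<Longrightarrow> slot_at dAI dAO dBI dBO (K j)"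
  shows "slot_at dAI dAO dBI dBO (\<lambda>a b x y a' b' x' y'. \<Sum>j\<in>J. c j * K j a b x y a' b' x' y')"
proof (rule slot_atI)
  fix a b x y a' b' x' y'
  assume i: "a < dAI" "b < dBI" "x < dAO" "y < dBO" "a' < dAI" "b' < dBI" "x' < dAO" "y' < dBO"
  have "(\<Sum>j\<in>J. c j * K j a b x y a' b' x' y') = (\<Sum>j\<in>J. c j * ((if x = x' then K j a b 0 y a' b' 0 y' else 0)
      + (if y = y' then K j a b x 0 a' b' x' 0 else 0) - (if x = x' \<and> y = y' then K j a b 0 0 a' b' 0 0 else 0)))"
    by (intro sum.cong refl arg_cong2[where f = "(*)"] slot_atD(1)[OF s] i)
  then show "(\<Sum>j\<in>J. c j * K j a b x y a' b' x' y') = (if x = x' then \<Sum>j\<in>J. c j * K j a b 0 y a' b' 0 y' else 0)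
      + (if y = y' then \<Sum>j\<in>J. c j * K j a b x 0 a' b' x' 0 else 0) - (if x = x' \<and> y = y' then \<Sum>j\<in>J. c j * K j a b 0 0 a' b' 0 0 else 0)"
    by (cases "x = x'"; cases "y = y'") (simp_all add: ring_distribs sum.distrib sum_subtractf)
next
  fix b x y b' x' y'
  assume i: "b < dBI" "x < dAO" "y < dBO" "b' < dBI" "x' < dAO" "y' < dBO"
  have "(\<Sum>a<dAI. \<Sum>j\<in>J. c j * K j a b x y a b' x' y') = (\<Sum>j\<in>J. c j * (\<Sum>a<dAI. K j a b x y a b' x' y'))" for x y x' y'
    unfolding sum_distrib_left by (rule sum.swap)
  moreover have "(\<Sum>j\<in>J. c j * (\<Sum>a<dAI. K j a b x y a b' x' y')) = (\<Sum>j\<in>J. c j * (if y = y' then \<Sum>a<dAI. K j a b x 0 a b' x' 0 else 0))"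
    by (intro sum.cong refl arg_cong2[where f = "(*)"] slot_atD(2)[OF s] i)
  ultimately show "(\<Sum>a<dAI. \<Sum>j\<in>J. c j * K j a b x y a b' x' y') = (if y = y' then \<Sum>a<dAI. \<Sum>j\<in>J. c j * K j a b x 0 a b' x' 0 else 0)"
    by (cases "y = y'") simp_all
next
  fix a x y a' x' y'
  assume i: "a < dAI" "x < dAO" "y < dBO" "a' < dAI" "x' < dAO" "y' < dBO"
  have "(\<Sum>b<dBI. \<Sum>j\<in>J. c j * K j a b x y a' b x' y') = (\<Sum>j\<in>J. c j * (\<Sum>b<dBI. K j a b x y a' b x' y'))" for x y x' y'
    unfolding sum_distrib_left by (rule sum.swap)
  moreover have "(\<Sum>j\<in>J. c j * (\<Sum>b<dBI. K j a b x y a' b x' y')) = (\<Sum>j\<in>J. c j * (if x = x' then \<Sum>b<dBI. K j a b 0 y a' b 0 y' else 0))"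
    by (intro sum.cong refl arg_cong2[where f = "(*)"] slot_atD(3)[OF s] i)
  ultimately show "(\<Sum>b<dBI. \<Sum>j\<in>J. c j * K j a b x y a' b x' y') = (if x = x' then \<Sum>b<dBI. \<Sum>j\<in>J. c j * K j a b 0 y a' b 0 y' else 0)"
    by (cases "x = x'") simp_all
qed

section \<open>Changes of basis in P and F\<close>

lemma gram_lincomb:
  "gram dF (\<lambda>a b f p x y. \<Sum>j<n. c p j * w a b f j x y) a b p x y a' b' p' x' y'
    = (\<Sum>j<n. \<Sum>j'<n. cnj (c p j) * c p' j' * gram dF w a b j x y a' b' j' x' y')"
  unfolding gram_def by (rule sum_cnj_prod_combination)

text \<open>Recombining the vectors of P replaces each block of the Gram kernel by a linear
  combination of blocks, and for fixed p, p' the conditions are linear.\<close>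

lemma slot_conds_lincomb:
  assumes s: "slot_conds n dAI dAO dBI dBO (gram dF w)"
  shows "slot_conds dP dAI dAO dBI dBO (gram dF (\<lambda>a b f p x y. \<Sum>j<n. c p j * w a b f j x y))"
  unfolding slot_conds_iff_slot_at gram_lincomb
proof (intro allI impI)
  fix p p'
  have "slot_at dAI dAO dBI dBO (\<lambda>a b x y a' b' x' y'. \<Sum>j<n. 1 * (\<Sum>j'<n. (cnj (c p j) * c p' j') * gram dF w a b j x y a' b' j' x' y'))"
    by (intro slot_at_sum) (use s in \<open>auto simp: slot_conds_iff_slot_at\<close>)
  then show "slot_at dAI dAO dBI dBO (\<lambda>a b x y a' b' x' y'. \<Sum>j<n. \<Sum>j'<n. cnj (c p j) * c p' j' * gram dF w a b j x y a' b' j' x' y')"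
    by simp
qed

lemma unitary_expand:
  assumes Q: "Q \<in> carrier_mat n n" "unitary_mat Q" and i: "i < n"
  shows "(\<Sum>g<n. Q $$ (i, g) * (\<Sum>f<n. cnj (Q $$ (f, g)) * h f)) = h i"
    and "(\<Sum>g<n. cnj (Q $$ (i, g)) * (\<Sum>f<n. Q $$ (f, g) * h f)) = h i"
proof -
  have "(\<Sum>g<n. Q $$ (i, g) * (\<Sum>f<n. cnj (Q $$ (f, g)) * h f)) = (\<Sum>g<n. \<Sum>f<n. Q $$ (i, g) * cnj (Q $$ (f, g)) * h f)"
    by (simp add: sum_distrib_left mult.assoc)
  also have "\<dots> = (\<Sum>f<n. \<Sum>g<n. Q $$ (i, g) * cnj (Q $$ (f, g)) * h f)" by (rule sum.swap)
  also have "\<dots> = (\<Sum>f<n. (if i = f then 1 else 0) * h f)"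
    by (intro sum.cong refl) (simp add: unitary_mat_cols(3)[OF Q i] flip: sum_distrib_right)
  finally show "(\<Sum>g<n. Q $$ (i, g) * (\<Sum>f<n. cnj (Q $$ (f, g)) * h f)) = h i"
    unfolding sum_delta_mult(1)[OF i] .
  have "(\<Sum>g<n. cnj (Q $$ (i, g)) * (\<Sum>f<n. Q $$ (f, g) * h f)) = (\<Sum>g<n. \<Sum>f<n. Q $$ (f, g) * cnj (Q $$ (i, g)) * h f)"
    by (simp add: sum_distrib_left mult_ac)
  also have "\<dots> = (\<Sum>f<n. \<Sum>g<n. Q $$ (f, g) * cnj (Q $$ (i, g)) * h f)" by (rule sum.swap)
  also have "\<dots> = (\<Sum>f<n. (if f = i then 1 else 0) * h f)"
    by (intro sum.cong refl) (simp add: unitary_mat_cols(3)[OF Q _ i] flip: sum_distrib_right)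
  finally show "(\<Sum>g<n. cnj (Q $$ (i, g)) * (\<Sum>f<n. Q $$ (f, g) * h f)) = h i"
    unfolding sum_delta_mult(2)[OF i] .
qed

lemma unitary_rows_sum:
  assumes Q: "Q \<in> carrier_mat n n" "unitary_mat Q"
  shows "(\<Sum>j<n. (\<Sum>p<n. Q $$ (p, j) * v p) * cnj (\<Sum>p<n. Q $$ (p, j) * w p)) = (\<Sum>p<n. v p * cnj (w p))"
proof -
  have "(\<Sum>j<n. (\<Sum>p<n. Q $$ (p, j) * v p) * cnj (\<Sum>p<n. Q $$ (p, j) * w p))
     = (\<Sum>j<n. cnj (\<Sum>p<n. w p * Q $$ (p, j)) * (\<Sum>p<n. v p * Q $$ (p, j)))"
    by (simp add: mult.commute)
  also have "\<dots> = (\<Sum>p<n. \<Sum>q<n. cnj (w p) * v q * (\<Sum>j<n. cnj (Q $$ (p, j)) * Q $$ (q, j)))"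
    by (rule sum_cnj_prod_combination)
  also have "\<dots> = (\<Sum>p<n. \<Sum>q<n. (if q = p then 1 else 0) * (cnj (w p) * v q))"
    using unitary_mat_cols(3)[OF Q] by (intro sum.cong refl) (simp add: mult.commute)
  also have "\<dots> = (\<Sum>p<n. v p * cnj (w p))"
    by (intro sum.cong refl) (subst sum_delta_mult(2), simp_all add: mult.commute)
  finally show ?thesis .
qed

lemma unitary_adj_rows_sum:
  assumes Q: "Q \<in> carrier_mat n n" "unitary_mat Q"
  shows "(\<Sum>g<n. cnj (\<Sum>f<n. cnj (Q $$ (f, g)) * v f) * (\<Sum>f<n. cnj (Q $$ (f, g)) * w f)) = (\<Sum>f<n. cnj (v f) * w f)"
proof -
  have "(\<Sum>g<n. cnj (\<Sum>f<n. cnj (Q $$ (f, g)) * v f) * (\<Sum>f<n. cnj (Q $$ (f, g)) * w f))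
      = cnj (\<Sum>g<n. (\<Sum>f<n. Q $$ (f, g) * cnj (w f)) * cnj (\<Sum>f<n. Q $$ (f, g) * cnj (v f)))"
    by (simp add: mult.commute)
  then show ?thesis unfolding unitary_rows_sum[OF Q] by (simp add: mult.commute)
qed

lemma mult_adj_index:
  assumes "M \<in> carrier_mat n m" "L \<in> carrier_mat l m" "i < n" "j < l"
  shows "(M * adj L) $$ (i, j) = (\<Sum>c<m. M $$ (i, c) * cnj (L $$ (j, c)))"
  using assms by (auto simp: scalar_prod_def adj_def lessThan_atLeast0 intro!: sum.cong)

text \<open>\<open>QF\<close> acts on the index of F and the adjoint of \<open>QP\<close> on that of
  P; the identity factors collapse all other sums.\<close>

lemma kron_sandwich_index:
  assumes D: "D \<in> carrier_mat (dAI * dBI * dF) (dP * dAO * dBO)"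
    and QF: "QF \<in> carrier_mat dF dF" and QP: "QP \<in> carrier_mat dP dP"
    and i: "a < dAI" "b < dBI" "f < dF" "p < dP" "x < dAO" "y < dBO"
  shows "(kron (1\<^sub>m (dAI * dBI)) QF * D * adj (kron QP (1\<^sub>m (dAO * dBO)))) $$ ((a * dBI + b) * dF + f, (p * dAO + x) * dBO + y)
    = (\<Sum>j<dP. cnj (QP $$ (p, j)) * (\<Sum>g<dF. QF $$ (f, g) * uent dAO dBI dBO dF D a b g j x y))"
proof -
  let ?K = "kron (1\<^sub>m (dAI * dBI)) QF" and ?L = "kron QP (1\<^sub>m (dAO * dBO))"
  let ?h = "a * dBI + b" and ?r = "x * dBO + y"
  have h: "?h < dAI * dBI" and r: "?r < dAO * dBO" using i by (simp_all add: mult_add_less)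
  have K: "?K \<in> carrier_mat (dAI * dBI * dF) (dAI * dBI * dF)" using QF by (auto simp: kron_def)
  have L: "?L \<in> carrier_mat (dP * dAO * dBO) (dP * dAO * dBO)" using QP by (auto simp: kron_def mult.assoc)
  have c: "(p * dAO + x) * dBO + y = p * (dAO * dBO) + ?r" by (simp add: algebra_simps)
  have KD: "(?K * D) $$ (?h * dF + f, c) = (\<Sum>g<dF. QF $$ (f, g) * D $$ (?h * dF + g, c))" if "c < dP * dAO * dBO" for c
  proof -
    have "(?K * D) $$ (?h * dF + f, c) = (\<Sum>i'<dAI * dBI * dF. ?K $$ (?h * dF + f, i') * D $$ (i', c))"
      using K D that mult_add_less[OF h i(3)] by (auto simp: scalar_prod_def lessThan_atLeast0)
    also have "\<dots> = (\<Sum>h'<dAI * dBI. \<Sum>g<dF. ?K $$ (?h * dF + f, h' * dF + g) * D $$ (h' * dF + g, c))"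
      by (rule sum_lessThan_mult)
    also have "\<dots> = (\<Sum>h'<dAI * dBI. (if ?h = h' then 1 else 0) * (\<Sum>g<dF. QF $$ (f, g) * D $$ (h' * dF + g, c)))"
      unfolding sum_distrib_left
    proof (intro sum.cong refl)
      fix h' g assume "h' \<in> {..<dAI * dBI}" "g \<in> {..<dF}"
      then have "h' < dAI * dBI" "g < dF" by auto
      then show "?K $$ (?h * dF + f, h' * dF + g) * D $$ (h' * dF + g, c)
        = (if ?h = h' then 1 else 0) * (QF $$ (f, g) * D $$ (h' * dF + g, c))"
        using QF h i mult_add_less[of h' "dAI * dBI" g dF] mult_add_less[OF h i(3)] by (simp add: kron_def)
    qed
    finally show ?thesis unfolding sum_delta_mult(1)[OF h] .
  qed
  have "(?K * D * adj ?L) $$ (?h * dF + f, p * (dAO * dBO) + ?r)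
      = (\<Sum>c<dP * (dAO * dBO). (?K * D) $$ (?h * dF + f, c) * cnj (?L $$ (p * (dAO * dBO) + ?r, c)))"
    using mult_adj_index[OF mult_carrier_mat[OF K D] L mult_add_less[OF h i(3)], of "p * (dAO * dBO) + ?r"]
      mult_add_less[OF i(4) r] by (simp only: mult.assoc)
  also have "\<dots> = (\<Sum>j<dP. \<Sum>r'<dAO * dBO. (?K * D) $$ (?h * dF + f, j * (dAO * dBO) + r') * cnj (?L $$ (p * (dAO * dBO) + ?r, j * (dAO * dBO) + r')))"
    by (rule sum_lessThan_mult)
  also have "\<dots> = (\<Sum>j<dP. \<Sum>r'<dAO * dBO. (if ?r = r' then 1 else 0) * (cnj (QP $$ (p, j)) * (?K * D) $$ (?h * dF + f, j * (dAO * dBO) + r')))"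
  proof (intro sum.cong refl)
    fix j r' assume "j \<in> {..<dP}" "r' \<in> {..<dAO * dBO}"
    then have j: "j < dP" "r' < dAO * dBO" by auto
    have "?L $$ (p * (dAO * dBO) + ?r, j * (dAO * dBO) + r') = (if ?r = r' then QP $$ (p, j) else 0)"
    proof -
      have "0 < dAO * dBO" using j by (cases "dAO * dBO") auto
      then show ?thesis
        using QP mult_add_less[OF i(4) r] mult_add_less[OF j] r j unfolding kron_def by simp
    qed
    then show "(?K * D) $$ (?h * dF + f, j * (dAO * dBO) + r') * cnj (?L $$ (p * (dAO * dBO) + ?r, j * (dAO * dBO) + r'))
      = (if ?r = r' then 1 else 0) * (cnj (QP $$ (p, j)) * (?K * D) $$ (?h * dF + f, j * (dAO * dBO) + r'))"
      by (simp del: index_mult_mat(1))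
  qed
  also have "\<dots> = (\<Sum>j<dP. cnj (QP $$ (p, j)) * (?K * D) $$ (?h * dF + f, j * (dAO * dBO) + ?r))"
    unfolding sum_delta_mult(1)[OF r] ..
  also have "\<dots> = (\<Sum>j<dP. cnj (QP $$ (p, j)) * (\<Sum>g<dF. QF $$ (f, g) * uent dAO dBI dBO dF D a b g j x y))"
  proof (intro sum.cong refl arg_cong2[where f = "(*)"])
    fix j assume "j \<in> {..<dP}"
    then have j: "j < dP" by simp
    have e: "j * (dAO * dBO) + ?r = (j * dAO + x) * dBO + y" by (simp add: algebra_simps)
    show "(?K * D) $$ (?h * dF + f, j * (dAO * dBO) + ?r) = (\<Sum>g<dF. QF $$ (f, g) * uent dAO dBI dBO dF D a b g j x y)"
      unfolding e KD[OF flat3_less[OF j i(5,6)]] uent_def ..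
  qed
  finally show ?thesis unfolding c .
qed

lemma dsum_op_index:
  assumes "a < dAI" "b < dBI" "g < dF" "j < dP" "x < dAO" "y < dBO"
  shows "uent dAO dBI dBO dF (dsum_op [dP, dAI, dAO, dBI, dBO, dF] kP kF U1 U2) a b g j x y
    = (if j < kP \<and> g < kF then uent dAO dBI dBO kF U1 a b g j x y
       else if kP \<le> j \<and> kF \<le> g then uent dAO dBI dBO (dF - kF) U2 a b (g - kF) (j - kP) x y else 0)"
proof -
  let ?ds = "[dP, dAI, dAO, dBI, dBO, dF]"
  have n: "?ds ! 0 = dP" "?ds ! 1 = dAI" "?ds ! 2 = dAO" "?ds ! 3 = dBI" "?ds ! 4 = dBO" "?ds ! 5 = dF" by simp_all
  have t: "[a, b, g] \<in> tuples [dAI, dBI, dF]" "[j, x, y] \<in> tuples [dP, dAO, dBO]" using assms by simp_all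
  have l: "(a * dBI + b) * dF + g < dAI * dBI * dF" "(j * dAO + x) * dBO + y < dP * dAO * dBO"
    using assms by (simp_all add: flat3_less)
  have d: "dec [dAI, dBI, dF] ((a * dBI + b) * dF + g) = [a, b, g]" "dec [dP, dAO, dBO] ((j * dAO + x) * dBO + y) = [j, x, y]"
    using dec_enc[OF t(1)] dec_enc[OF t(2)] unfolding enc3 by simp_all
  have s: "[a, b, g] ! 0 = a" "[a, b, g] ! 1 = b" "[a, b, g] ! 2 = g" "[j, x, y] ! 0 = j" "[j, x, y] ! 1 = x" "[j, x, y] ! 2 = y" by simp_all
  show ?thesis
    unfolding dsum_op_def uent_def n index_mat(1)[OF l] prod.case d Let_def s enc3 ..
qed

lemma dsum_op_carrier: "dsum_op [dP, dAI, dAO, dBI, dBO, dF] kP kF U1 U2 \<in> carrier_mat (dAI * dBI * dF) (dP * dAO * dBO)"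
  by (simp add: dsum_op_def)

lemma sum_lessThan_split:
  fixes f :: "nat \<Rightarrow> 'a::comm_monoid_add"
  assumes "k \<le> n"
  shows "(\<Sum>i<n. f i) = (\<Sum>i<k. f i) + (\<Sum>i<n - k. f (i + k))"
proof -
  have "(\<Sum>i<k + m. f i) = (\<Sum>i<k. f i) + (\<Sum>i<m. f (i + k))" for m
    by (induction m) (simp_all add: add.assoc add.commute[of k])
  from this[of "n - k"] assms show ?thesis by simp
qed

lemma slot_conds_cong:
  assumes "slot_conds dP dAI dAO dBI dBO g" "0 < dAO" "0 < dBO"
    and "\<And>a b p x y a' b' p' x' y'. a < dAI \<Longrightarrow> b < dBI \<Longrightarrow> p < dP \<Longrightarrow> x < dAO \<Longrightarrow> y < dBO \<Longrightarrow>
      a' < dAI \<Longrightarrow> b' < dBI \<Longrightarrow> p' < dP \<Longrightarrow> x' < dAO \<Longrightarrow> y' < dBO \<Longrightarrow> h a b p x y a' b' p' x' y' = g a b p x y a' b' p' x' y'"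
  shows "slot_conds dP dAI dAO dBI dBO h"
  unfolding slot_conds_iff_slot_at
proof (intro allI impI)
  fix p p' assume p: "p < dP" "p' < dP"
  then have "slot_at dAI dAO dBI dBO (\<lambda>a b x y a' b' x' y'. g a b p x y a' b' p' x' y')"
    using assms(1) unfolding slot_conds_iff_slot_at by blast
  then show "slot_at dAI dAO dBI dBO (\<lambda>a b x y a' b' x' y'. h a b p x y a' b' p' x' y')"
    by (rule slot_at_cong[OF _ assms(2,3)]) (use p in \<open>simp add: assms(4)\<close>)
qed

lemma comb_gram_cong:
  assumes c: "comb_gram dP dAI dAO dBI dBO g" and pos: "0 < dAO" "0 < dBO"
    and e: "\<And>a b p x y a' b' p' x' y'. a < dAI \<Longrightarrow> b < dBI \<Longrightarrow> p < dP \<Longrightarrow> x < dAO \<Longrightarrow> y < dBO \<Longrightarrow>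
      a' < dAI \<Longrightarrow> b' < dBI \<Longrightarrow> p' < dP \<Longrightarrow> x' < dAO \<Longrightarrow> y' < dBO \<Longrightarrow> h a b p x y a' b' p' x' y' = g a b p x y a' b' p' x' y'"
  shows "comb_gram dP dAI dAO dBI dBO h"
  unfolding comb_gram_def
proof (intro conjI allI impI)
  fix a b p x y a' b' p' x' y'
  assume i: "a < dAI" "b < dBI" "p < dP" "x < dAO" "y < dBO" "a' < dAI" "b' < dBI" "p' < dP" "x' < dAO" "y' < dBO"
  have "g a b p x y a' b' p' x' y' = (if y = y' then g a b p x 0 a' b' p' x' 0 else 0)"
    by (rule comb_gramD(1)[OF c]) (use i in auto)
  then show "h a b p x y a' b' p' x' y' = (if y = y' then h a b p x 0 a' b' p' x' 0 else 0)"
    using i pos by (simp only: e)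
next
  fix a p x a' p' x'
  assume i: "a < dAI" "p < dP" "x < dAO" "a' < dAI" "p' < dP" "x' < dAO"
  have "(\<Sum>b<dBI. h a b p x 0 a' b p' x' 0) = (\<Sum>b<dBI. g a b p x 0 a' b p' x' 0)"
    "(\<Sum>b<dBI. h a b p 0 0 a' b p' 0 0) = (\<Sum>b<dBI. g a b p 0 0 a' b p' 0 0)"
    by (intro sum.cong refl e; use i pos in auto)+
  moreover have "(\<Sum>b<dBI. g a b p x 0 a' b p' x' 0) = (if x = x' then \<Sum>b<dBI. g a b p 0 0 a' b p' 0 0 else 0)"
    by (rule comb_gramD(2)[OF c]) (use i in auto)
  ultimately show "(\<Sum>b<dBI. h a b p x 0 a' b p' x' 0) = (if x = x' then \<Sum>b<dBI. h a b p 0 0 a' b p' 0 0 else 0)"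
    by (simp only:)
qed

text \<open>The contraction over F is an inner product and therefore invariant under a unitary
  change of basis of F.\<close>

lemma gram_unitary_F:
  assumes Q: "QF \<in> carrier_mat dF dF" "unitary_mat QF"
  shows "gram dF (\<lambda>a b f p x y. \<Sum>g<dF. QF $$ (f, g) * d a b g p x y) = gram dF d"
    and "gram dF (\<lambda>a b g p x y. \<Sum>f<dF. cnj (QF $$ (f, g)) * d a b f p x y) = gram dF d"
proof -
  show "gram dF (\<lambda>a b g p x y. \<Sum>f<dF. cnj (QF $$ (f, g)) * d a b f p x y) = gram dF d"
    unfolding gram_def unitary_adj_rows_sum[OF Q] ..
  have "(\<Sum>f<dF. cnj (\<Sum>g<dF. QF $$ (f, g) * v g) * (\<Sum>g<dF. QF $$ (f, g) * w g)) = (\<Sum>f<dF. cnj (v f) * w f)" for v w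
  proof -
    have "(\<Sum>f<dF. cnj (\<Sum>g<dF. QF $$ (f, g) * v g) * (\<Sum>g<dF. QF $$ (f, g) * w g))
      = (\<Sum>f<dF. cnj (\<Sum>g<dF. v g * QF $$ (f, g)) * (\<Sum>g<dF. w g * QF $$ (f, g)))"
      by (simp add: mult.commute)
    also have "\<dots> = (\<Sum>g<dF. \<Sum>h<dF. cnj (v g) * w h * (\<Sum>f<dF. cnj (QF $$ (f, g)) * QF $$ (f, h)))"
      by (rule sum_cnj_prod_combination)
    also have "\<dots> = (\<Sum>g<dF. \<Sum>h<dF. cnj (v g) * w h * (if g = h then 1 else 0))"
      by (intro sum.cong refl) (simp add: unitary_mat_cols(2)[OF Q])
    also have "\<dots> = (\<Sum>g<dF. cnj (v g) * w g)"
      by (intro sum.cong refl) (subst sum_delta_mult(3), simp_all)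
    finally show ?thesis .
  qed
  then show "gram dF (\<lambda>a b f p x y. \<Sum>g<dF. QF $$ (f, g) * d a b g p x y) = gram dF d"
    unfolding gram_def by simp
qed

text \<open>Blocks of the Gram kernel between different summands of P vanish, because their images
  lie in orthogonal parts of F. The diagonal blocks satisfy the conditions as combs, and the changes
  of basis in P and F preserve them.\<close>

lemma direct_sum_imp_slot_conds:
  assumes pos: "0 < dAO" "0 < dBO"
    and ds: "direct_sum_pure_combs [dP, dAI, dAO, dBI, dBO, dF] U"
  shows "slot_conds dP dAI dAO dBI dBO (gram dF (uent dAO dBI dBO dF U))"
proof -
  let ?ds = "[dP, dAI, dAO, dBI, dBO, dF]"
  have n: "?ds ! 0 = dP" "?ds ! 1 = dAI" "?ds ! 2 = dAO" "?ds ! 3 = dBI" "?ds ! 4 = dBO" "?ds ! 5 = dF" by simp_all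
  obtain k kF QP QF U1 U2 where k: "k \<le> dP" "kF \<le> dF" and QP: "QP \<in> carrier_mat dP dP" "unitary_mat QP"
    and QF: "QF \<in> carrier_mat dF dF" "unitary_mat QF"
    and U1: "U1 \<in> carrier_mat (dAI * dBI * kF) (k * dAO * dBO)" "unitary_mat U1"
    and c1: "comb_AB [k, dAI, dAO, dBI, dBO, kF] (repW [k, dAI, dAO, dBI, dBO, kF] U1)"
    and U2: "U2 \<in> carrier_mat (dAI * dBI * (dF - kF)) ((dP - k) * dAO * dBO)" "unitary_mat U2"
    and c2: "comb_BA [dP - k, dAI, dAO, dBI, dBO, dF - kF] (repW [dP - k, dAI, dAO, dBI, dBO, dF - kF] U2)"
    and U: "U = kron (1\<^sub>m (dAI * dBI)) QF * dsum_op ?ds k kF U1 U2 * adj (kron QP (1\<^sub>m (dAO * dBO)))"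
    using ds unfolding direct_sum_pure_combs_def n by blast
  define d where "d = uent dAO dBI dBO dF (dsum_op ?ds k kF U1 U2)"
  define g1 where "g1 = gram kF (uent dAO dBI dBO kF U1)"
  define g2 where "g2 = gram (dF - kF) (uent dAO dBI dBO (dF - kF) U2)"
  have s1: "slot_conds k dAI dAO dBI dBO g1"
    using c1 unfolding g1_def
    by (subst (asm) comb_AB_iff[OF pos]) (auto simp: uent_iso[OF U1] pos intro: comb_gram_imp_slot_conds)
  have s2: "slot_conds (dP - k) dAI dAO dBI dBO g2"
    unfolding g2_def
  proof (rule slot_conds_swap, rule comb_gram_imp_slot_conds[OF _ pos(2,1)])
    show "comb_gram (dP - k) dBI dBO dAI dAO (\<lambda>b a p y x b' a' p' y' x'. gram (dF - kF) (uent dAO dBI dBO (dF - kF) U2) a b p x y a' b' p' x' y')"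
      using c2 by (subst (asm) comb_BA_iff[OF pos]) (auto simp: uent_iso[OF U2] pos)
  qed
  have split: "gram dF d a b j x y a' b' j' x' y' =
      (if j < k \<and> j' < k then g1 a b j x y a' b' j' x' y'
       else if k \<le> j \<and> k \<le> j' then g2 a b (j - k) x y a' b' (j' - k) x' y' else 0)"
    if i: "a < dAI" "b < dBI" "j < dP" "x < dAO" "y < dBO" "a' < dAI" "b' < dBI" "j' < dP" "x' < dAO" "y' < dBO"
    for a b j x y a' b' j' x' y'
  proof -
    have lo: "d a b g j x y = (if j < k then uent dAO dBI dBO kF U1 a b g j x y else 0)"
      if "a < dAI" "b < dBI" "j < dP" "x < dAO" "y < dBO" "g < kF" for a b g j x y
      using dsum_op_index[of a dAI b dBI g dF j dP x dAO y dBO k kF U1 U2] that k by (simp add: d_def)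
    have hi: "d a b (g + kF) j x y = (if k \<le> j then uent dAO dBI dBO (dF - kF) U2 a b g (j - k) x y else 0)"
      if "a < dAI" "b < dBI" "j < dP" "x < dAO" "y < dBO" "g < dF - kF" for a b g j x y
      using dsum_op_index[of a dAI b dBI "g + kF" dF j dP x dAO y dBO k kF U1 U2] that k by (simp add: d_def)
    have "gram dF d a b j x y a' b' j' x' y' = (\<Sum>g<kF. cnj (d a b g j x y) * d a' b' g j' x' y')
      + (\<Sum>g<dF - kF. cnj (d a b (g + kF) j x y) * d a' b' (g + kF) j' x' y')"
      unfolding gram_def by (rule sum_lessThan_split[OF k(2)])
    also have "(\<Sum>g<kF. cnj (d a b g j x y) * d a' b' g j' x' y') = (if j < k \<and> j' < k then g1 a b j x y a' b' j' x' y' else 0)"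
      using i by (cases "j < k"; cases "j' < k") (simp_all add: lo g1_def gram_def)
    also have "(\<Sum>g<dF - kF. cnj (d a b (g + kF) j x y) * d a' b' (g + kF) j' x' y')
      = (if k \<le> j \<and> k \<le> j' then g2 a b (j - k) x y a' b' (j' - k) x' y' else 0)"
      using i by (cases "k \<le> j"; cases "k \<le> j'") (simp_all add: hi g2_def gram_def)
    finally show ?thesis by (auto split: if_splits)
  qed
  have sd: "slot_conds dP dAI dAO dBI dBO (gram dF d)"
    unfolding slot_conds_iff_slot_at
  proof (intro allI impI)
    fix j j' assume j: "j < dP" "j' < dP"
    consider "j < k" "j' < k" | "k \<le> j" "k \<le> j'" | "(j < k) \<noteq> (j' < k)" by linarith
    then show "slot_at dAI dAO dBI dBO (\<lambda>a b x y a' b' x' y'. gram dF d a b j x y a' b' j' x' y')"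
    proof cases
      case 1
      then have "slot_at dAI dAO dBI dBO (\<lambda>a b x y a' b' x' y'. g1 a b j x y a' b' j' x' y')"
        using s1 unfolding slot_conds_iff_slot_at by blast
      then show ?thesis by (rule slot_at_cong[OF _ pos]) (use 1 j in \<open>simp add: split\<close>)
    next
      case 2
      then have "j - k < dP - k" "j' - k < dP - k" using j by auto
      then have "slot_at dAI dAO dBI dBO (\<lambda>a b x y a' b' x' y'. g2 a b (j - k) x y a' b' (j' - k) x' y')"
        using s2 unfolding slot_conds_iff_slot_at by blast
      then show ?thesis by (rule slot_at_cong[OF _ pos]) (use 2 j in \<open>simp add: split\<close>)
    next
      case 3
      show ?thesis by (rule slot_at_cong[OF slot_at_zero pos]) (use 3 j in \<open>auto simp: split\<close>)
    qed
  qed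
  define e where "e a b f j x y = (\<Sum>g<dF. QF $$ (f, g) * d a b g j x y)" for a b f j x y
  have "gram dF e = gram dF d" unfolding e_def by (rule gram_unitary_F(1)[OF QF])
  then have "slot_conds dP dAI dAO dBI dBO (gram dF (\<lambda>a b f p x y. \<Sum>j<dP. cnj (QP $$ (p, j)) * e a b f j x y))"
    using sd by (intro slot_conds_lincomb) simp
  then show ?thesis
  proof (rule slot_conds_cong[OF _ pos])
    fix a b p x y a' b' p' x' y'
    assume i: "a < dAI" "b < dBI" "p < dP" "x < dAO" "y < dBO" "a' < dAI" "b' < dBI" "p' < dP" "x' < dAO" "y' < dBO"
    have "uent dAO dBI dBO dF U a b f p x y = (\<Sum>j<dP. cnj (QP $$ (p, j)) * e a b f j x y)"
      if "a < dAI" "b < dBI" "f < dF" "p < dP" "x < dAO" "y < dBO" for a b f p x y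
      unfolding uent_def U kron_sandwich_index[OF dsum_op_carrier QF(1) QP(1) that] e_def d_def ..
    then show "gram dF (uent dAO dBI dBO dF U) a b p x y a' b' p' x' y'
      = gram dF (\<lambda>a b f p x y. \<Sum>j<dP. cnj (QP $$ (p, j)) * e a b f j x y) a b p x y a' b' p' x' y'"
      unfolding gram_def using i by (intro sum.cong refl) simp
  qed
qed

text \<open>On the first \<open>k\<close> columns of the adapted basis \<open>X\<close> is trivial
  on B_O: what A receives does not depend on what B returns, so A comes before B. On the remaining
  columns \<open>Y\<close> is trivial on A_O and B comes before A.\<close>

lemma slot_conds_imp_direct_sum:
  assumes pos: "0 < dAO" "0 < dBO"
    and U: "U \<in> carrier_mat (dAI * dBI * dF) (dP * dAO * dBO)" "unitary_mat U"
    and sc: "slot_conds dP dAI dAO dBI dBO (gram dF (uent dAO dBI dBO dF U))"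
  shows "direct_sum_pure_combs [dP, dAI, dAO, dBI, dBO, dF] U"
proof -
  let ?ds = "[dP, dAI, dAO, dBI, dBO, dF]"
  have n: "?ds ! 0 = dP" "?ds ! 1 = dAI" "?ds ! 2 = dAO" "?ds ! 3 = dBI" "?ds ! 4 = dBO" "?ds ! 5 = dF" by simp_all
  define u where "u = uent dAO dBI dBO dF U"
  interpret slot_coisometry dP dAI dAO dBI dBO dF u
    using sc by unfold_locales (simp_all only: slot_conds_def u_def pos uent_coiso[OF U])
  from block_basis obtain QP k where k: "k \<le> dP" and QP: "QP \<in> carrier_mat dP dP" "unitary_mat QP"
    and lo: "\<forall>j v. j < k \<longrightarrow> N v \<longrightarrow> (\<Sum>p<dP. cnj (QP $$ (p, j)) * v p) = 0"
    and hi: "\<forall>j. k \<le> j \<longrightarrow> j < dP \<longrightarrow> N (\<lambda>p. QP $$ (p, j))"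
    and X0: "\<forall>j a a' y y' p. j < k \<longrightarrow> a < dAI \<longrightarrow> a' < dAI \<longrightarrow> y < dBO \<longrightarrow> y' < dBO \<longrightarrow> p < dP \<longrightarrow>
       ap dP (X a a' y y') (\<lambda>p. QP $$ (p, j)) p = (if y = y' then ap dP (X a a' 0 0) (\<lambda>p. QP $$ (p, j)) p else 0)"
    by (elim exE conjE)
  note lo = lo[rule_format] and hi = hi[rule_format] and X0 = X0[rule_format]
  \<comment> \<open>\<open>w\<close> is \<open>U\<close> in the adapted basis of P; \<open>z\<close>
    below is \<open>U\<close> in the adapted bases of both P and F.\<close>
  define w where "w a b f j x y = (\<Sum>p<dP. QP $$ (p, j) * u a b f p x y)" for a b f j x y
  have gw: "gram dF w a b j x y a' b' j' x' y' =
      (\<Sum>p<dP. cnj (QP $$ (p, j)) * ap dP (\<lambda>p p'. G a b p x y a' b' p' x' y') (\<lambda>p. QP $$ (p, j')) p)"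
    for a b j x y a' b' j' x' y'
    unfolding w_def gram_lincomb ap_def sum_distrib_left by (intro sum.cong refl) simp
  have "slot_conds dP dAI dAO dBI dBO (gram dF w)"
    unfolding w_def u_def by (rule slot_conds_lincomb[OF sc])
  then have swB: "slot_cond_B dP dAI dAO dBI dBO (gram dF w)" and swA: "slot_cond_A dP dAI dAO dBI dBO (gram dF w)"
    by (simp_all only: slot_conds_def)
  \<comment> \<open>Column \<open>j'\<close> lies in \<open>N\<close>, the blocks of
    \<open>G\<close> preserve \<open>N\<close>, and column \<open>j\<close> is orthogonal to
    \<open>N\<close>.\<close>
  have off1: "gram dF w a b j x y a' b' j' x' y' = 0"
    if "j < k" "k \<le> j'" "j' < dP" "a < dAI" "b < dBI" "x < dAO" "y < dBO" "a' < dAI" "b' < dBI" "x' < dAO" "y' < dBO"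
    for a b j x y a' b' j' x' y'
    unfolding gw by (intro lo N_G hi that)
  \<comment> \<open>The factorisation with \<open>X\<close> on the right is chosen, so that
    \<open>X\<close> meets column \<open>j'\<close> first and is trivial there.\<close>
  have gAB: "gram dF w a b j x y a' b' j' x' y' = (if y = y' then gram dF w a b j x 0 a' b' j' x' 0 else 0)"
    if i: "j' < k" "a < dAI" "b < dBI" "x < dAO" "y < dBO" "a' < dAI" "b' < dBI" "x' < dAO" "y' < dBO"
    for a b j x y a' b' j' x' y'
  proof -
    have *: "ap dP (\<lambda>p p'. G a b p x y a' b' p' x' y') v p = ap dP (Y b b' x x') (ap dP (X a a' y y') v) p"
      if "p < dP" "y < dBO" "y' < dBO" for y y' p v
      by (rule ap_comp, rule gram_eq_YX) (use i that in auto)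
    have "ap dP (\<lambda>p p'. G a b p x y a' b' p' x' y') (\<lambda>p. QP $$ (p, j')) p
      = (if y = y' then ap dP (\<lambda>p p'. G a b p x 0 a' b' p' x' 0) (\<lambda>p. QP $$ (p, j')) p else 0)" if p: "p < dP" for p
    proof -
      have "ap dP (\<lambda>p p'. G a b p x y a' b' p' x' y') (\<lambda>p. QP $$ (p, j')) p
        = ap dP (Y b b' x x') (ap dP (X a a' y y') (\<lambda>p. QP $$ (p, j'))) p" by (rule *) (use i p in auto)
      also have "\<dots> = ap dP (Y b b' x x') (\<lambda>q. if y = y' then ap dP (X a a' 0 0) (\<lambda>p. QP $$ (p, j')) q else 0) p"
        by (intro ap_cong X0 i)
      also have "\<dots> = (if y = y' then ap dP (Y b b' x x') (ap dP (X a a' 0 0) (\<lambda>p. QP $$ (p, j'))) p else 0)" by (rule ap_if)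
      also have "ap dP (Y b b' x x') (ap dP (X a a' 0 0) (\<lambda>p. QP $$ (p, j'))) p = ap dP (\<lambda>p p'. G a b p x 0 a' b' p' x' 0) (\<lambda>p. QP $$ (p, j')) p"
        by (rule *[symmetric]) (use pos p in auto)
      finally show ?thesis .
    qed
    then show ?thesis unfolding gw by (cases "y = y'") simp_all
  qed
  \<comment> \<open>Here \<open>Y\<close> stands on the right: it meets column \<open>j'\<close>
    first, which now lies in \<open>N\<close>.\<close>
  have gBA: "gram dF w a b j x y a' b' j' x' y' = (if x = x' then gram dF w a b j 0 y a' b' j' 0 y' else 0)"
    if i: "k \<le> j'" "j' < dP" "a < dAI" "b < dBI" "x < dAO" "y < dBO" "a' < dAI" "b' < dBI" "x' < dAO" "y' < dBO"
    for a b j x y a' b' j' x' y'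
  proof -
    have *: "ap dP (\<lambda>p p'. G a b p x y a' b' p' x' y') v p = ap dP (X a a' y y') (ap dP (Y b b' x x') v) p"
      if "p < dP" "x < dAO" "x' < dAO" for x x' p v
      by (rule ap_comp, rule gram_eq_XY) (use i that in auto)
    have "ap dP (\<lambda>p p'. G a b p x y a' b' p' x' y') (\<lambda>p. QP $$ (p, j')) p
      = (if x = x' then ap dP (\<lambda>p p'. G a b p 0 y a' b' p' 0 y') (\<lambda>p. QP $$ (p, j')) p else 0)" if p: "p < dP" for p
    proof -
      have "ap dP (\<lambda>p p'. G a b p x y a' b' p' x' y') (\<lambda>p. QP $$ (p, j')) p
        = ap dP (X a a' y y') (ap dP (Y b b' x x') (\<lambda>p. QP $$ (p, j'))) p" by (rule *) (use i p in auto)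
      also have "\<dots> = ap dP (X a a' y y') (\<lambda>q. if x = x' then ap dP (Y b b' 0 0) (\<lambda>p. QP $$ (p, j')) q else 0) p"
        by (intro ap_cong hi[OF i(1,2), unfolded N_def, rule_format] i)
      also have "\<dots> = (if x = x' then ap dP (X a a' y y') (ap dP (Y b b' 0 0) (\<lambda>p. QP $$ (p, j'))) p else 0)" by (rule ap_if)
      also have "ap dP (X a a' y y') (ap dP (Y b b' 0 0) (\<lambda>p. QP $$ (p, j'))) p = ap dP (\<lambda>p p'. G a b p 0 y a' b' p' 0 y') (\<lambda>p. QP $$ (p, j')) p"
        by (rule *[symmetric]) (use pos p in auto)
      finally show ?thesis .
    qed
    then show ?thesis unfolding gw by (cases "x = x'") simp_all
  qed
  have w_iso: "(\<Sum>a<dAI. \<Sum>b<dBI. gram dF w a b j x y a b j' x' y') = (if j = j' \<and> x = x' \<and> y = y' then 1 else 0)"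
    if i: "j < dP" "x < dAO" "y < dBO" "j' < dP" "x' < dAO" "y' < dBO" for j x y j' x' y'
  proof -
    have "(\<Sum>a<dAI. \<Sum>b<dBI. gram dF w a b j x y a b j' x' y')
      = (\<Sum>p<dP. \<Sum>p'<dP. \<Sum>a<dAI. \<Sum>b<dBI. cnj (QP $$ (p, j)) * QP $$ (p', j') * G a b p x y a b p' x' y')"
      unfolding w_def gram_lincomb by (rule sum_swap22)
    also have "\<dots> = (\<Sum>p<dP. \<Sum>p'<dP. cnj (QP $$ (p, j)) * QP $$ (p', j') * (if p = p' \<and> x = x' \<and> y = y' then 1 else 0))"
      unfolding sum_distrib_left[symmetric]
      by (intro sum.cong refl arg_cong2[where f = "(*)"]) (unfold u_def, rule uent_iso[OF U], use i in auto)
    also have "\<dots> = (\<Sum>p<dP. (if x = x' \<and> y = y' then 1 else 0) * (\<Sum>p'<dP. cnj (QP $$ (p, j)) * QP $$ (p', j') * (if p = p' then 1 else 0)))"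
      unfolding sum_distrib_left by (intro sum.cong refl) simp
    also have "\<dots> = (\<Sum>p<dP. (if x = x' \<and> y = y' then 1 else 0) * (cnj (QP $$ (p, j)) * QP $$ (p, j')))"
      by (intro sum.cong refl) (subst sum_delta_mult(3), simp_all)
    also have "\<dots> = (if j = j' \<and> x = x' \<and> y = y' then 1 else 0)"
      unfolding sum_distrib_left[symmetric] unitary_mat_cols(2)[OF QP i(1,4)] by simp
    finally show ?thesis .
  qed
  have w_coiso: "(\<Sum>j<dP. \<Sum>x<dAO. \<Sum>y<dBO. w a b f j x y * cnj (w a' b' f' j x y)) = (if a = a' \<and> b = b' \<and> f = f' then 1 else 0)"
    if i: "a < dAI" "b < dBI" "f < dF" "a' < dAI" "b' < dBI" "f' < dF" for a b f a' b' f'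
  proof -
    have "(\<Sum>j<dP. \<Sum>x<dAO. \<Sum>y<dBO. w a b f j x y * cnj (w a' b' f' j x y)) = (\<Sum>x<dAO. \<Sum>y<dBO. \<Sum>j<dP. w a b f j x y * cnj (w a' b' f' j x y))"
      by (rule sum_swap12)
    also have "\<dots> = (\<Sum>x<dAO. \<Sum>y<dBO. \<Sum>p<dP. u a b f p x y * cnj (u a' b' f' p x y))"
      unfolding w_def unitary_rows_sum[OF QP] ..
    also have "\<dots> = (\<Sum>p<dP. \<Sum>x<dAO. \<Sum>y<dBO. u a b f p x y * cnj (u a' b' f' p x y))"
      by (rule sum_swap12[symmetric])
    finally show ?thesis using coiso[OF i] by simp
  qed
  \<comment> \<open>The vectors of F reached from the first summand of P; their span becomes the
    first summand of F.\<close>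
  define T where "T = {vec dF (\<lambda>f. w a b f j x y) | a b j x y. a < dAI \<and> b < dBI \<and> j < k \<and> x < dAO \<and> y < dBO}"
  have "T \<subseteq> carrier_vec dF" by (auto simp: T_def)
  from adapted_basis[OF this] obtain QF kF where kF: "kF \<le> dF" and QF: "QF \<in> carrier_mat dF dF" "unitary_mat QF"
    and ge: "\<forall>g t. kF \<le> g \<longrightarrow> g < dF \<longrightarrow> t \<in> T \<longrightarrow> cinner t (col QF g) = 0"
    and lt: "\<forall>g<kF. \<forall>v\<in>carrier_vec dF. (\<forall>t\<in>T. cinner t v = 0) \<longrightarrow> cinner (col QF g) v = 0"
    by blast
  define z where "z a b g j x y = (\<Sum>f<dF. cnj (QF $$ (f, g)) * w a b f j x y)" for a b g j x y
  have z0a: "z a b g j x y = 0" if "a < dAI" "b < dBI" "kF \<le> g" "g < dF" "j < k" "x < dAO" "y < dBO" for a b g j x y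
  proof -
    have "vec dF (\<lambda>f. w a b f j x y) \<in> T" unfolding T_def using that by blast
    then have "cinner (vec dF (\<lambda>f. w a b f j x y)) (col QF g) = 0" using ge that by blast
    then have "cnj (\<Sum>f<dF. cnj (w a b f j x y) * QF $$ (f, g)) = 0" using QF that by (simp add: cinner_def)
    then show ?thesis by (simp add: z_def mult.commute)
  qed
  have z0b: "z a b g j x y = 0" if i: "a < dAI" "b < dBI" "g < kF" "k \<le> j" "j < dP" "x < dAO" "y < dBO" for a b g j x y
  proof -
    let ?v = "vec dF (\<lambda>f. w a b f j x y)"
    \<comment> \<open>What is reached from the second summand of P is orthogonal to
      \<open>T\<close>, hence to the first \<open>kF\<close> columns of \<open>QF\<close>.\<close>
    have "cinner t ?v = 0" if tT: "t \<in> T" for t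
    proof -
      obtain a0 b0 j0 x0 y0 where t: "t = vec dF (\<lambda>f. w a0 b0 f j0 x0 y0)" and t0: "a0 < dAI" "b0 < dBI" "j0 < k" "x0 < dAO" "y0 < dBO"
        using tT unfolding T_def by blast
      have "cinner t ?v = gram dF w a0 b0 j0 x0 y0 a b j x y" by (simp add: t cinner_def gram_def)
      also have "\<dots> = 0" by (rule off1) (use t0 i in auto)
      finally show ?thesis .
    qed
    then have "cinner (col QF g) ?v = 0"
      using lt[THEN spec, THEN mp, OF i(3), THEN bspec, of ?v] by simp
    then show ?thesis using QF i kF by (simp add: cinner_def z_def)
  qed
  have gz: "gram dF z = gram dF w" unfolding z_def by (rule gram_unitary_F(2)[OF QF])
  have z_coiso: "(\<Sum>j<dP. \<Sum>x<dAO. \<Sum>y<dBO. z a b g j x y * cnj (z a' b' g' j x y)) = (if a = a' \<and> b = b' \<and> g = g' then 1 else 0)"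
    if i: "a < dAI" "b < dBI" "g < dF" "a' < dAI" "b' < dBI" "g' < dF" for a b g a' b' g'
  proof -
    have "(\<Sum>j<dP. \<Sum>x<dAO. \<Sum>y<dBO. z a b g j x y * cnj (z a' b' g' j x y))
       = (\<Sum>j<dP. \<Sum>x<dAO. \<Sum>y<dBO. \<Sum>f<dF. \<Sum>f'<dF. cnj (QF $$ (f, g)) * QF $$ (f', g') * (w a b f j x y * cnj (w a' b' f' j x y)))"
      unfolding z_def cnj_sum sum_product by (intro sum.cong refl) simp
    also have "\<dots> = (\<Sum>j<dP. \<Sum>f<dF. \<Sum>f'<dF. \<Sum>x<dAO. \<Sum>y<dBO. cnj (QF $$ (f, g)) * QF $$ (f', g') * (w a b f j x y * cnj (w a' b' f' j x y)))"
      by (rule sum.cong[OF refl], rule sum_swap22)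
    also have "\<dots> = (\<Sum>f<dF. \<Sum>f'<dF. \<Sum>j<dP. \<Sum>x<dAO. \<Sum>y<dBO. cnj (QF $$ (f, g)) * QF $$ (f', g') * (w a b f j x y * cnj (w a' b' f' j x y)))"
      by (rule sum_swap12)
    also have "\<dots> = (\<Sum>f<dF. \<Sum>f'<dF. cnj (QF $$ (f, g)) * QF $$ (f', g') * (if a = a' \<and> b = b' \<and> f = f' then 1 else 0))"
      unfolding sum_distrib_left[symmetric]
      by (intro sum.cong refl arg_cong2[where f = "(*)"] w_coiso) (use i in auto)
    also have "\<dots> = (\<Sum>f<dF. (if a = a' \<and> b = b' then 1 else 0) * (\<Sum>f'<dF. cnj (QF $$ (f, g)) * QF $$ (f', g') * (if f = f' then 1 else 0)))"
      unfolding sum_distrib_left by (intro sum.cong refl) simp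
    also have "\<dots> = (\<Sum>f<dF. (if a = a' \<and> b = b' then 1 else 0) * (cnj (QF $$ (f, g)) * QF $$ (f, g')))"
      by (intro sum.cong refl) (subst sum_delta_mult(3), simp_all)
    also have "\<dots> = (if a = a' \<and> b = b' \<and> g = g' then 1 else 0)"
      unfolding sum_distrib_left[symmetric] unitary_mat_cols(2)[OF QF i(3,6)] by simp
    finally show ?thesis .
  qed
  define z2 where "z2 a b g j x y = z a b (g + kF) (j + k) x y" for a b g j x y
  have g1: "gram kF z a b j x y a' b' j' x' y' = gram dF w a b j x y a' b' j' x' y'"
    if "j < k" "j' < k" "a < dAI" "b < dBI" "x < dAO" "y < dBO" "a' < dAI" "b' < dBI" "x' < dAO" "y' < dBO"
    for a b j x y a' b' j' x' y'
  proof -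
    have "(\<Sum>g<dF - kF. cnj (z a b (g + kF) j x y) * z a' b' (g + kF) j' x' y') = 0"
      by (rule sum.neutral) (use that in \<open>auto simp: z0a\<close>)
    then show ?thesis unfolding gz[symmetric] gram_def sum_lessThan_split[OF kF] by simp
  qed
  have g2: "gram (dF - kF) z2 a b j x y a' b' j' x' y' = gram dF w a b (j + k) x y a' b' (j' + k) x' y'"
    if "j < dP - k" "j' < dP - k" "a < dAI" "b < dBI" "x < dAO" "y < dBO" "a' < dAI" "b' < dBI" "x' < dAO" "y' < dBO"
    for a b j x y a' b' j' x' y'
  proof -
    have "(\<Sum>g<kF. cnj (z a b g (j + k) x y) * z a' b' g (j' + k) x' y') = 0"
      by (rule sum.neutral) (use that in \<open>auto simp: z0b\<close>)
    then show ?thesis unfolding gz[symmetric] gram_def sum_lessThan_split[OF kF] z2_def by simp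
  qed
  define U1 where "U1 = umat k dAI dAO dBI dBO kF z"
  define U2 where "U2 = umat (dP - k) dAI dAO dBI dBO (dF - kF) z2"
  have gU1: "gram kF (uent dAO dBI dBO kF U1) a b j x y a' b' j' x' y' = gram dF w a b j x y a' b' j' x' y'"
    if "a < dAI" "b < dBI" "j < k" "x < dAO" "y < dBO" "a' < dAI" "b' < dBI" "j' < k" "x' < dAO" "y' < dBO"
    for a b j x y a' b' j' x' y'
  proof -
    have "gram kF (uent dAO dBI dBO kF U1) a b j x y a' b' j' x' y' = gram kF z a b j x y a' b' j' x' y'"
      unfolding gram_def U1_def using that by (intro sum.cong refl) (simp add: uent_umat)
    then show ?thesis using g1 that by simp
  qed
  have gU2: "gram (dF - kF) (uent dAO dBI dBO (dF - kF) U2) a b j x y a' b' j' x' y' = gram dF w a b (j + k) x y a' b' (j' + k) x' y'"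
    if "a < dAI" "b < dBI" "j < dP - k" "x < dAO" "y < dBO" "a' < dAI" "b' < dBI" "j' < dP - k" "x' < dAO" "y' < dBO"
    for a b j x y a' b' j' x' y'
  proof -
    have "gram (dF - kF) (uent dAO dBI dBO (dF - kF) U2) a b j x y a' b' j' x' y' = gram (dF - kF) z2 a b j x y a' b' j' x' y'"
      unfolding gram_def U2_def using that by (intro sum.cong refl) (simp add: uent_umat)
    then show ?thesis using g2 that by simp
  qed
  \<comment> \<open>Columns are orthonormal by \<open>w_iso\<close>; rows are orthonormal because
    the entries cut off from the full rows are zero. That the sizes \<open>k\<close> and
    \<open>kF\<close> fit together is a consequence, through \<open>unitary_umat\<close>.\<close>
  have U1: "U1 \<in> carrier_mat (dAI * dBI * kF) (k * dAO * dBO)" "unitary_mat U1"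
  proof -
    show "U1 \<in> carrier_mat (dAI * dBI * kF) (k * dAO * dBO)" by (simp add: U1_def)
    show "unitary_mat U1"
      unfolding U1_def
    proof (rule unitary_umat)
      fix p x y p' x' y' assume i: "p < k" "x < dAO" "y < dBO" "p' < k" "x' < dAO" "y' < dBO"
      have "(\<Sum>a<dAI. \<Sum>b<dBI. gram kF z a b p x y a b p' x' y') = (\<Sum>a<dAI. \<Sum>b<dBI. gram dF w a b p x y a b p' x' y')"
        using i by (intro sum.cong refl g1) auto
      also have "\<dots> = (if p = p' \<and> x = x' \<and> y = y' then 1 else 0)" by (rule w_iso) (use i k in auto)
      finally show "(\<Sum>a<dAI. \<Sum>b<dBI. gram kF z a b p x y a b p' x' y') = (if p = p' \<and> x = x' \<and> y = y' then 1 else 0)" .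
    next
      fix a b g a' b' g' assume i: "a < dAI" "b < dBI" "g < kF" "a' < dAI" "b' < dBI" "g' < kF"
      have "(\<Sum>j<dP - k. \<Sum>x<dAO. \<Sum>y<dBO. z a b g (j + k) x y * cnj (z a' b' g' (j + k) x y)) = 0"
        by (intro sum.neutral ballI) (use i in \<open>auto simp: z0b\<close>)
      moreover have "(\<Sum>j<dP. \<Sum>x<dAO. \<Sum>y<dBO. z a b g j x y * cnj (z a' b' g' j x y)) = (if a = a' \<and> b = b' \<and> g = g' then 1 else 0)"
        by (rule z_coiso) (use i kF in auto)
      ultimately show "(\<Sum>j<k. \<Sum>x<dAO. \<Sum>y<dBO. z a b g j x y * cnj (z a' b' g' j x y)) = (if a = a' \<and> b = b' \<and> g = g' then 1 else 0)"
        unfolding sum_lessThan_split[OF k] by simp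
    qed
  qed
  have U2: "U2 \<in> carrier_mat (dAI * dBI * (dF - kF)) ((dP - k) * dAO * dBO)" "unitary_mat U2"
  proof -
    show "U2 \<in> carrier_mat (dAI * dBI * (dF - kF)) ((dP - k) * dAO * dBO)" by (simp add: U2_def)
    show "unitary_mat U2"
      unfolding U2_def
    proof (rule unitary_umat)
      fix p x y p' x' y' assume i: "p < dP - k" "x < dAO" "y < dBO" "p' < dP - k" "x' < dAO" "y' < dBO"
      have "(\<Sum>a<dAI. \<Sum>b<dBI. gram (dF - kF) z2 a b p x y a b p' x' y') = (\<Sum>a<dAI. \<Sum>b<dBI. gram dF w a b (p + k) x y a b (p' + k) x' y')"
        using i by (intro sum.cong refl g2) auto
      also have "\<dots> = (if p + k = p' + k \<and> x = x' \<and> y = y' then 1 else 0)" by (rule w_iso) (use i in auto)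
      finally show "(\<Sum>a<dAI. \<Sum>b<dBI. gram (dF - kF) z2 a b p x y a b p' x' y') = (if p = p' \<and> x = x' \<and> y = y' then 1 else 0)" by simp
    next
      fix a b g a' b' g' assume i: "a < dAI" "b < dBI" "g < dF - kF" "a' < dAI" "b' < dBI" "g' < dF - kF"
      have "(\<Sum>j<k. \<Sum>x<dAO. \<Sum>y<dBO. z a b (g + kF) j x y * cnj (z a' b' (g' + kF) j x y)) = 0"
        by (intro sum.neutral ballI) (use i in \<open>auto simp: z0a\<close>)
      moreover have "(\<Sum>j<dP. \<Sum>x<dAO. \<Sum>y<dBO. z a b (g + kF) j x y * cnj (z a' b' (g' + kF) j x y)) = (if a = a' \<and> b = b' \<and> g + kF = g' + kF then 1 else 0)"
        by (rule z_coiso) (use i in auto)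
      ultimately show "(\<Sum>j<dP - k. \<Sum>x<dAO. \<Sum>y<dBO. z2 a b g j x y * cnj (z2 a' b' g' j x y)) = (if a = a' \<and> b = b' \<and> g = g' then 1 else 0)"
        unfolding sum_lessThan_split[OF k] z2_def by simp
    qed
  qed
  have c1: "comb_AB [k, dAI, dAO, dBI, dBO, kF] (repW [k, dAI, dAO, dBI, dBO, kF] U1)"
  proof (subst comb_AB_iff[OF pos])
    show "(\<Sum>a<dAI. \<Sum>b<dBI. gram kF (uent dAO dBI dBO kF U1) a b p 0 0 a b p' 0 0) = (if p = p' then 1 else 0)" if "p < k" "p' < k" for p p'
      using uent_iso[OF U1 that(1) pos that(2) pos] by simp
    have "comb_gram k dAI dAO dBI dBO (gram dF w)"
      unfolding comb_gram_def
    proof (intro conjI allI impI)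
      fix a b p x y a' b' p' x' y'
      assume i: "a < dAI" "b < dBI" "p < k" "x < dAO" "y < dBO" "a' < dAI" "b' < dBI" "p' < k" "x' < dAO" "y' < dBO"
      show "gram dF w a b p x y a' b' p' x' y' = (if y = y' then gram dF w a b p x 0 a' b' p' x' 0 else 0)"
        by (rule gAB) (use i in auto)
    next
      \<comment> \<open>The second comb equation holds on all of P: it is \<open>slot_cond_A\<close>
        at y = y' = 0.\<close>
      fix a p x a' p' x'
      assume i: "a < dAI" "p < k" "x < dAO" "a' < dAI" "p' < k" "x' < dAO"
      show "(\<Sum>b<dBI. gram dF w a b p x 0 a' b p' x' 0) = (if x = x' then \<Sum>b<dBI. gram dF w a b p 0 0 a' b p' 0 0 else 0)"
        by (rule swA[unfolded slot_cond_A_def, rule_format]) (use i pos k in auto)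
    qed
    then show "comb_gram k dAI dAO dBI dBO (gram kF (uent dAO dBI dBO kF U1))"
      by (rule comb_gram_cong[OF _ pos]) (rule gU1)
  qed
  have c2: "comb_BA [dP - k, dAI, dAO, dBI, dBO, dF - kF] (repW [dP - k, dAI, dAO, dBI, dBO, dF - kF] U2)"
  proof (subst comb_BA_iff[OF pos])
    show "(\<Sum>a<dAI. \<Sum>b<dBI. gram (dF - kF) (uent dAO dBI dBO (dF - kF) U2) a b p 0 0 a b p' 0 0) = (if p = p' then 1 else 0)"
      if "p < dP - k" "p' < dP - k" for p p'
      using uent_iso[OF U2 that(1) pos that(2) pos] by simp
    have "comb_gram (dP - k) dBI dBO dAI dAO (\<lambda>b a p y x b' a' p' y' x'. gram dF w a b (p + k) x y a' b' (p' + k) x' y')"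
      unfolding comb_gram_def
    proof (intro conjI allI impI)
      fix b a p y x b' a' p' y' x'
      assume i: "b < dBI" "a < dAI" "p < dP - k" "y < dBO" "x < dAO" "b' < dBI" "a' < dAI" "p' < dP - k" "y' < dBO" "x' < dAO"
      show "gram dF w a b (p + k) x y a' b' (p' + k) x' y' = (if x = x' then gram dF w a b (p + k) 0 y a' b' (p' + k) 0 y' else 0)"
        by (rule gBA) (use i in auto)
    next
      fix b p y b' p' y'
      assume i: "b < dBI" "p < dP - k" "y < dBO" "b' < dBI" "p' < dP - k" "y' < dBO"
      show "(\<Sum>a<dAI. gram dF w a b (p + k) 0 y a b' (p' + k) 0 y') = (if y = y' then \<Sum>a<dAI. gram dF w a b (p + k) 0 0 a b' (p' + k) 0 0 else 0)"
        by (rule swB[unfolded slot_cond_B_def, rule_format]) (use i pos in auto)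
    qed
    then show "comb_gram (dP - k) dBI dBO dAI dAO (\<lambda>b a p y x b' a' p' y' x'. gram (dF - kF) (uent dAO dBI dBO (dF - kF) U2) a b p x y a' b' p' x' y')"
      by (rule comb_gram_cong[OF _ pos(2,1)]) (rule gU2)
  qed
  let ?D = "dsum_op ?ds k kF U1 U2"
  have D: "uent dAO dBI dBO dF ?D a b g j x y = z a b g j x y"
    if i: "a < dAI" "b < dBI" "g < dF" "j < dP" "x < dAO" "y < dBO" for a b g j x y
  proof -
    consider "j < k" "g < kF" | "k \<le> j" "kF \<le> g" | "j < k" "kF \<le> g" | "k \<le> j" "g < kF" by linarith
    then show ?thesis
    proof cases
      case 1 then show ?thesis unfolding dsum_op_index[OF i] U1_def using i by (simp add: uent_umat)
    next
      case 2
      then have "g - kF < dF - kF" "j - k < dP - k" using i by auto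
      then show ?thesis unfolding dsum_op_index[OF i] U2_def using 2 i by (simp add: uent_umat z2_def)
    next
      case 3 then show ?thesis unfolding dsum_op_index[OF i] using z0a[OF i(1,2) 3(2) i(3) 3(1) i(5,6)] by simp
    next
      case 4 then show ?thesis unfolding dsum_op_index[OF i] using z0b[OF i(1,2) 4(2,1) i(4-6)] by simp
    qed
  qed
  let ?M = "kron (1\<^sub>m (dAI * dBI)) QF * ?D * adj (kron QP (1\<^sub>m (dAO * dBO)))"
  have dimM: "dim_row ?M = dAI * dBI * dF" "dim_col ?M = dP * dAO * dBO"
    using QF QP by (simp_all add: kron_def adj_def)
  have "U = ?M"
  proof (rule eq_matI)
    fix i j assume "i < dim_row ?M" "j < dim_col ?M"
    then have ij: "i < dAI * dBI * dF" "j < dP * dAO * dBO" unfolding dimM .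
    then obtain a b f p x y where i: "a < dAI" "b < dBI" "f < dF" "i = (a * dBI + b) * dF + f"
      and j: "p < dP" "x < dAO" "y < dBO" "j = (p * dAO + x) * dBO + y" by (elim flat3_cases)
    have "?M $$ (i, j) = (\<Sum>j<dP. cnj (QP $$ (p, j)) * (\<Sum>g<dF. QF $$ (f, g) * uent dAO dBI dBO dF ?D a b g j x y))"
      unfolding i(4) j(4) by (rule kron_sandwich_index[OF dsum_op_carrier QF(1) QP(1) i(1-3) j(1-3)])
    also have "\<dots> = (\<Sum>j<dP. cnj (QP $$ (p, j)) * (\<Sum>g<dF. QF $$ (f, g) * z a b g j x y))"
      using i j by (intro sum.cong refl arg_cong2[where f = "(*)"] D) auto
    also have "\<dots> = (\<Sum>j<dP. cnj (QP $$ (p, j)) * w a b f j x y)"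
      unfolding z_def unitary_expand(1)[OF QF i(3)] ..
    also have "\<dots> = u a b f p x y"
      unfolding w_def by (rule unitary_expand(2)[OF QP j(1)])
    finally show "U $$ (i, j) = ?M $$ (i, j)" unfolding u_def uent_def i(4) j(4) by simp
  qed (simp_all only: dimM carrier_matD[OF U(1)])
  then show ?thesis
    unfolding direct_sum_pure_combs_def n
    by - (rule exI[of _ k], rule exI[of _ kF], rule exI[of _ QP], rule exI[of _ QF], rule exI[of _ U1], rule exI[of _ U2],
        intro conjI k kF QP QF U1 U2 c1 c2)
qed

theorem theorem5:
  fixes dP dAI dAO dBI dBO dF :: nat and U :: "complex mat"
  assumes "0 < dP" "0 < dAI" "0 < dAO" "0 < dBI" "0 < dBO" "0 < dF"
    and "U \<in> carrier_mat (dAI * dBI * dF) (dP * dAO * dBO)"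
    and "unitary_mat U"
  shows "(pure_superchannel [dP, dAI, dAO, dBI, dBO, dF] (repW [dP, dAI, dAO, dBI, dBO, dF] U)
            \<longleftrightarrow> cond2 [dP, dAI, dAO, dBI, dBO, dF] U)
       \<and> (cond2 [dP, dAI, dAO, dBI, dBO, dF] U
            \<longleftrightarrow> direct_sum_pure_combs [dP, dAI, dAO, dBI, dBO, dF] U)"
proof -
  let ?ds = "[dP, dAI, dAO, dBI, dBO, dF]"
  let ?S = "slot_conds dP dAI dAO dBI dBO (gram dF (uent dAO dBI dBO dF U))"
  note pos = assms(1-6) and U = assms(7,8)
  have nrm: "(\<Sum>a<dAI. \<Sum>b<dBI. gram dF (uent dAO dBI dBO dF U) a b p 0 0 a b p' 0 0) = (if p = p' then 1 else 0)"
    if "p < dP" "p' < dP" for p p'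
    using uent_iso[OF U that(1) pos(3,5) that(2) pos(3,5)] by simp
  \<comment> \<open>All three statements are compared with the conditions on the Gram kernel in
    basis indices.\<close>
  have "cond2 ?ds U \<longleftrightarrow> ?S" by (rule cond2_iff_slot_conds[OF pos(3,5) U(1)])
  moreover have "pure_superchannel ?ds (repW ?ds U) \<longleftrightarrow> ?S"
  proof
    assume "pure_superchannel ?ds (repW ?ds U)"
    then show ?S using superchannel_imp_slot_conds[OF _ pos(3,5)] by (simp add: pure_superchannel_def)
  next
    assume s: ?S
    have "superchannel ?ds (repW ?ds U)" by (rule superchannel_repW[OF s pos(3,5) nrm])
    moreover have "pure_supermap ?ds (repW ?ds U)"
      by (rule pure_supermap_repW[OF s pos(2,3,4,5) nrm unitary_mat_cols(1)[OF U]])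
    ultimately show "pure_superchannel ?ds (repW ?ds U)" by (simp add: pure_superchannel_def)
  qed
  moreover have "?S \<longleftrightarrow> direct_sum_pure_combs ?ds U"
    using slot_conds_imp_direct_sum[OF pos(3,5) U] direct_sum_imp_slot_conds[OF pos(3,5)] by blast
  ultimately show ?thesis by blast
qed

end
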